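(* (i) Generalised measurability is preserved by elementary equivalence. (ii) If $M$ is generalised measurable then $\mathrm{Th}(M)$ does not have the strict order property and is functionally unimodular. (iii) If $M$ is ring-measurable then any definable function from a definable set in $M$ to itself is injective if and only if it is surjective. (iv) If $M$ is generalised measurable with well-ordered set of dimensions $D$ (e.g. if $M$ is an ultraproduct of a polynomial m.a.c.) then $\mathrm{Th}(M)$ is supersimple.
   Context: Measuring semirings. An ordered semiring $S=(S,+,\cdot,0,1,<)$ satisfies: $(S,+,0)$ and $(S,\cdot,1)$ are commutative monoids; $\cdot$ distributes over $+$; $<$ is a total order with least element $0$; $x\le y\Rightarrow x+z\le y+z$; $x\le y\Rightarrow xz\le yz$; $0\cdot x=x\cdot 0=0$; $0<x,\ 0<y\Rightarrow 0<xy$; $0\ne1$. Write $a\sim b$ if $a\le b\le n\cdot a$ or $b\le a\le n\cdot b$ for some positive integer $n$; $\sim$ is an equivalence relation with convex classes, and $d:S\to S/{\sim}$ is the quotient map onto the induced totally ordered set. $S$ is a measuring semiring if in addition for all $x,y,z\in S$: if $x<y$ and $d(y)=d(z)$ then $x+z<y+z$. Generalised measurability. $\mathrm{Def}(M)$ is the collection of sets (in powers of $M$) definable in $M$ with parameters; "definable" means definable with parameters. For a measuring semiring $S$, an $L$-structure $M$ is $S$-measurable if there is $h:\mathrm{Def}(M)\to S$ such that: (1) $h(X)=|X|$ (i.e. $|X|\cdot1$) for finite $X$; (2) $h(X\cup Y)=h(X)+h(Y)$ for disjoint $X,Y\in\mathrm{Def}(M)$; (3) for each family $\{\phi(M^{|\bar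 x|};\bar b):\bar b\in M^{|\bar y|}\}$ given by an $L$-formula $\phi(\bar x;\bar y)$, the set $F$ of values of $h$ on the family is finite, and for each $f\in F$ the set $\{\bar b:h(\phi(M^{|\bar x|};\bar b))=f\}$ is $\emptyset$-definable; (4) if $p:X\to Y$ is a definable function and $f\in S$ is such that $h(p^{-1}(a))=f$ for all $a\in Y$, then $h(X)=f\cdot h(Y)$. $M$ is generalised measurable if it is $S$-measurable for some measuring semiring $S$; it is ring-measurable if there is a commutative unital ordered ring $S$ such that $M$ is $S^{\ge0}$-measurable. In (iv), $D=\{d(h(X)):X\in\mathrm{Def}(M)\}$ is the set of dimensions of definable sets. A theory has the strict order property if some model has an interpretable partial order containing an infinite totally ordered subset. A structure $M$ is functionally unimodular if whenever $f_1,f_2:A\to B$ are definable maps with $B\neq\emptyset$ and $k_1,k_2$ are integers such that $|f_1^{-1}(b)|=k_1$ and $|f_2^{-1}(b)|=k_2$ for all $b\in B$, then $k_1=k_2$; a theory is functionally unimodular if its models are. Polynomial m.a.c. Let $\mathcal{C}$ be a class of finite $L$-structures, $R$ a set of functions $\mathcal{C}\to\mathbb{R}^{\ge0}$, and $(\mathcal{C},\bar y)$ the set of pairs $(M,\bar a)$ with $M\in\mathcal{C}$, $\bar a\in M^{|\bar y|}$. $\mathcal{C}$ is an $R$-m.a.c. if for every $L$-formula $\phi(\bar x;\bar y)$ there is a finite partition $\Pi$ of $(\mathcal{C},\bar y)$, each part of which is defined uniformly across $\mathcal{C}$ by a parameter-free formula in $\bar y$, and functions $h_\pi\in R$ ($\pi\in\Pi$)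 such that for each $\pi\in\Pi$ and $\epsilon>0$ there is $Q$ with $\big||\phi(M^{|\bar x|};\bar b)|-h_\pi(M)\big|\le\epsilon h_\pi(M)$ for all $(M,\bar b)\in\pi$ with $|M|>Q$. A formula $\delta(\bar x,\bar y)$ is balanced if for every $\epsilon>0$ there is $Q$ such that for $M\in\mathcal{C}$ with $|M|>Q$ and all $\bar a,\bar b$ with $\delta(M^{|\bar x|},\bar a),\delta(M^{|\bar x|},\bar b)\ne\emptyset$, $\big||\delta(M^{|\bar x|},\bar a)|-|\delta(M^{|\bar x|},\bar b)|\big|<\epsilon|\delta(M^{|\bar x|},\bar b)|$. An $R$-m.a.c. is polynomial if there are balanced formulas $\delta_1,\dots,\delta_k$, positive integers $N_1,\dots,N_k$ and for each $h\in R$ a polynomial $P_h\in\mathbb{R}[X_1,\dots,X_k]$ such that for every $M\in\mathcal{C}$ there are $\bar a_1,\dots,\bar a_k$ in $M$ with all $\delta_i(M^{|\bar x_i|},\bar a_i)\ne\emptyset$ and $h(M)=P_h(|\delta_1(M^{|\bar x_1|},\bar a_1)|^{1/N_1},\dots,|\delta_k(M^{|\bar x_k|},\bar a_k)|^{1/N_k})$.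
   Formalization: In (iv), an ultraproduct of a polynomial m.a.c. is shown to have well-ordered D and supersimple theory only if the terms of each P_h do not cancel asymptotically (sum of their absolute values at most c·h(M) for large M); with arbitrary real polynomials the example is false. *)

theory Defs
  imports Complex_Main "HOL-Algebra.Ring" "HOL-Library.Poly_Mapping" "HOL-Library.Disjoint_Sets"
begin

section \<open>First-order structures\<close>

text \<open>
  A language is given by partial arity maps: a symbol with arity \<open>None\<close> is not in the language,
  so that, for example, purely relational languages are covered.
\<close>

record ('f, 'r) lang =
  fun_ar :: "'f \<Rightarrow> nat option"
  rel_ar :: "'r \<Rightarrow> nat option"

datatype 'f trm = Var nat | Fun 'f "'f trm list"

datatype ('f, 'r) fm =
    Eq "'f trm" "'f trm"
  | Rel 'r "'f trm list"
  | Neg "('f, 'r) fm"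
  | Conj "('f, 'r) fm" "('f, 'r) fm"
  | Ex nat "('f, 'r) fm"

primrec fv_trm :: "'f trm \<Rightarrow> nat set" where
  "fv_trm (Var i) = {i}"
| "fv_trm (Fun f ts) = \<Union> (set (map fv_trm ts))"

primrec fv :: "('f, 'r) fm \<Rightarrow> nat set" where
  "fv (Eq s t) = fv_trm s \<union> fv_trm t"
| "fv (Rel r ts) = \<Union> (set (map fv_trm ts))"
| "fv (Neg p) = fv p"
| "fv (Conj p q) = fv p \<union> fv q"
| "fv (Ex i p) = fv p - {i}"

primrec wf_trm :: "('f, 'r) lang \<Rightarrow> 'f trm \<Rightarrow> bool" where
  "wf_trm L (Var i) \<longleftrightarrow> True"
| "wf_trm L (Fun f ts) \<longleftrightarrow> fun_ar L f = Some (length ts) \<and> list_all id (map (wf_trm L) ts)"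

primrec wf_fm :: "('f, 'r) lang \<Rightarrow> ('f, 'r) fm \<Rightarrow> bool" where
  "wf_fm L (Eq s t) \<longleftrightarrow> wf_trm L s \<and> wf_trm L t"
| "wf_fm L (Rel r ts) \<longleftrightarrow> rel_ar L r = Some (length ts) \<and> list_all (wf_trm L) ts"
| "wf_fm L (Neg p) \<longleftrightarrow> wf_fm L p"
| "wf_fm L (Conj p q) \<longleftrightarrow> wf_fm L p \<and> wf_fm L q"
| "wf_fm L (Ex i p) \<longleftrightarrow> wf_fm L p"

text \<open>The interpretation of a symbol matters only at argument lists of the right length from the domain.\<close>

record ('f, 'r, 'm) struct =
  dom :: "'m set"
  fn :: "'f \<Rightarrow> 'm list \<Rightarrow> 'm"
  rl :: "'r \<Rightarrow> 'm list \<Rightarrow> bool"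

definition tuples :: "'m set \<Rightarrow> nat \<Rightarrow> 'm list set" where
  "tuples A n = {xs. length xs = n \<and> set xs \<subseteq> A}"

definition is_structure :: "('f, 'r) lang \<Rightarrow> ('f, 'r, 'm) struct \<Rightarrow> bool" where
  "is_structure L M \<longleftrightarrow> dom M \<noteq> {} \<and>
     (\<forall>f n. fun_ar L f = Some n \<longrightarrow> (\<forall>xs \<in> tuples (dom M) n. fn M f xs \<in> dom M))"

primrec eval_trm :: "('f, 'r, 'm) struct \<Rightarrow> (nat \<Rightarrow> 'm) \<Rightarrow> 'f trm \<Rightarrow> 'm" where
  "eval_trm M e (Var i) = e i"
| "eval_trm M e (Fun f ts) = fn M f (map (eval_trm M e) ts)"

primrec sat :: "('f, 'r, 'm) struct \<Rightarrow> (nat \<Rightarrow> 'm) \<Rightarrow> ('f, 'r) fm \<Rightarrow> bool" where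
  "sat M e (Eq s t) \<longleftrightarrow> eval_trm M e s = eval_trm M e t"
| "sat M e (Rel r ts) \<longleftrightarrow> rl M r (map (eval_trm M e) ts)"
| "sat M e (Neg p) \<longleftrightarrow> \<not> sat M e p"
| "sat M e (Conj p q) \<longleftrightarrow> sat M e p \<and> sat M e q"
| "sat M e (Ex i p) \<longleftrightarrow> (\<exists>a \<in> dom M. sat M (e(i := a)) p)"

definition Th :: "('f, 'r) lang \<Rightarrow> ('f, 'r, 'm) struct \<Rightarrow> ('f, 'r) fm set" where
  "Th L M = {p. wf_fm L p \<and> fv p = {} \<and> (\<forall>e. range e \<subseteq> dom M \<longrightarrow> sat M e p)}"

definition elementarily_equivalent ::
  "('f, 'r) lang \<Rightarrow> ('f, 'r, 'm) struct \<Rightarrow> ('f, 'r, 'n) struct \<Rightarrow> bool" where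
  "elementarily_equivalent L M N \<longleftrightarrow> Th L M = Th L N"

definition is_model :: "('f, 'r) lang \<Rightarrow> ('f, 'r, 'm) struct \<Rightarrow> ('f, 'r) fm set \<Rightarrow> bool" where
  "is_model L M T \<longleftrightarrow> is_structure L M \<and> T \<subseteq> Th L M"

text \<open>
  A partitioned formula \<open>\<phi>(x;y)\<close> with \<open>|x| = n\<close> and \<open>|y| = m\<close> is a formula whose free variables are
  among the first \<open>n + m\<close> ones; \<open>x\<close> is the first \<open>n\<close> of them.  Then \<open>sols M n \<phi> b\<close> is \<open>\<phi>(M^n; b)\<close>.
\<close>

definition part_fm :: "('f, 'r) lang \<Rightarrow> nat \<Rightarrow> nat \<Rightarrow> ('f, 'r) fm \<Rightarrow> bool" where
  "part_fm L n m \<phi> \<longleftrightarrow> wf_fm L \<phi> \<and> fv \<phi> \<subseteq> {..<n + m}"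

definition sols :: "('f, 'r, 'm) struct \<Rightarrow> nat \<Rightarrow> ('f, 'r) fm \<Rightarrow> 'm list \<Rightarrow> 'm list set" where
  "sols M n \<phi> b = {a \<in> tuples (dom M) n. sat M (\<lambda>i. (a @ b) ! i) \<phi>}"

definition definable_over ::
  "('f, 'r) lang \<Rightarrow> ('f, 'r, 'm) struct \<Rightarrow> 'm set \<Rightarrow> nat \<Rightarrow> 'm list set \<Rightarrow> bool" where
  "definable_over L M A n X \<longleftrightarrow>
     (\<exists>m \<phi> b. part_fm L n m \<phi> \<and> b \<in> tuples A m \<and> X = sols M n \<phi> b)"

definition Def :: "('f, 'r) lang \<Rightarrow> ('f, 'r, 'm) struct \<Rightarrow> 'm list set set" where
  "Def L M = {X. \<exists>n. definable_over L M (dom M) n X}"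

definition definable_map ::
  "('f, 'r) lang \<Rightarrow> ('f, 'r, 'm) struct \<Rightarrow> 'm list set \<Rightarrow> 'm list set \<Rightarrow> ('m list \<Rightarrow> 'm list) \<Rightarrow> bool" where
  "definable_map L M X Y p \<longleftrightarrow>
     X \<in> Def L M \<and> Y \<in> Def L M \<and> p \<in> X \<rightarrow> Y \<and> {a @ p a | a. a \<in> X} \<in> Def L M"

section \<open>Measuring semirings\<close>

record 's ordered_ring = "'s ring" +
  rle :: "'s \<Rightarrow> 's \<Rightarrow> bool"

definition rlt :: "('s, 'z) ordered_ring_scheme \<Rightarrow> 's \<Rightarrow> 's \<Rightarrow> bool" where
  "rlt S x y \<longleftrightarrow> rle S x y \<and> x \<noteq> y"

definition total_order_carrier :: "('s, 'z) ordered_ring_scheme \<Rightarrow> bool" where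
  "total_order_carrier S \<longleftrightarrow>
     linear_order_on (carrier S) {(x, y). x \<in> carrier S \<and> y \<in> carrier S \<and> rle S x y}"

locale ordered_srig = semiring S + comm_monoid S
  for S :: "('s, 'z) ordered_ring_scheme" (structure) +
  assumes total: "total_order_carrier S"
    and zero_least: "x \<in> carrier S \<Longrightarrow> rle S \<zero> x"
    and add_mono: "\<lbrakk>x \<in> carrier S; y \<in> carrier S; z \<in> carrier S; rle S x y\<rbrakk>
                    \<Longrightarrow> rle S (x \<oplus> z) (y \<oplus> z)"
    and mult_mono: "\<lbrakk>x \<in> carrier S; y \<in> carrier S; z \<in> carrier S; rle S x y\<rbrakk>
                    \<Longrightarrow> rle S (x \<otimes> z) (y \<otimes> z)"
    and mult_pos: "\<lbrakk>x \<in> carrier S; y \<in> carrier S; rlt S \<zero> x; rlt S \<zero> y\<rbrakk>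
                    \<Longrightarrow> rlt S \<zero> (x \<otimes> y)"
    and zero_neq_one: "\<zero> \<noteq> \<one>"

definition arch_equiv :: "('s, 'z) ordered_ring_scheme \<Rightarrow> 's \<Rightarrow> 's \<Rightarrow> bool" where
  "arch_equiv S a b \<longleftrightarrow> (\<exists>n :: nat. n > 0 \<and>
     (rle S a b \<and> rle S b ([n] \<cdot>\<^bsub>S\<^esub> a) \<or> rle S b a \<and> rle S a ([n] \<cdot>\<^bsub>S\<^esub> b)))"

text \<open>The quotient map \<open>d\<close>, and the order induced on the quotient.\<close>

definition dim :: "('s, 'z) ordered_ring_scheme \<Rightarrow> 's \<Rightarrow> 's set" where
  "dim S a = {b \<in> carrier S. arch_equiv S a b}"

definition dim_order :: "('s, 'z) ordered_ring_scheme \<Rightarrow> ('s set \<times> 's set) set" where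
  "dim_order S = {(dim S a, dim S b) | a b. a \<in> carrier S \<and> b \<in> carrier S \<and> rle S a b}"

locale measuring_semiring = ordered_srig S
  for S :: "('s, 'z) ordered_ring_scheme" (structure) +
  assumes measuring: "\<lbrakk>x \<in> carrier S; y \<in> carrier S; z \<in> carrier S;
      rlt S x y; dim S y = dim S z\<rbrakk> \<Longrightarrow> rlt S (x \<oplus> z) (y \<oplus> z)"

locale ordered_comm_ring = cring R
  for R :: "('s, 'z) ordered_ring_scheme" (structure) +
  assumes total: "total_order_carrier R"
    and add_mono: "\<lbrakk>x \<in> carrier R; y \<in> carrier R; z \<in> carrier R; rle R x y\<rbrakk>
                    \<Longrightarrow> rle R (x \<oplus> z) (y \<oplus> z)"
    and mult_nonneg: "\<lbrakk>x \<in> carrier R; y \<in> carrier R; rle R \<zero> x; rle R \<zero> y\<rbrakk>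
                    \<Longrightarrow> rle R \<zero> (x \<otimes> y)"

definition nonneg_part :: "('s, 'z) ordered_ring_scheme \<Rightarrow> ('s, 'z) ordered_ring_scheme" where
  "nonneg_part R = R\<lparr>carrier := {x \<in> carrier R. rle R \<zero>\<^bsub>R\<^esub> x}\<rparr>"

section \<open>Generalised measurability\<close>

definition is_measure ::
  "('f, 'r) lang \<Rightarrow> ('f, 'r, 'm) struct \<Rightarrow> 's ordered_ring \<Rightarrow> ('m list set \<Rightarrow> 's) \<Rightarrow> bool" where
  "is_measure L M S h \<longleftrightarrow>
     h \<in> Def L M \<rightarrow> carrier S \<and>
     (\<forall>X \<in> Def L M. finite X \<longrightarrow> h X = [card X] \<cdot>\<^bsub>S\<^esub> \<one>\<^bsub>S\<^esub>) \<and>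
     (\<forall>X \<in> Def L M. \<forall>Y \<in> Def L M. X \<union> Y \<in> Def L M \<and> X \<inter> Y = {} \<longrightarrow> h (X \<union> Y) = h X \<oplus>\<^bsub>S\<^esub> h Y) \<and>
     (\<forall>n m \<phi>. part_fm L n m \<phi> \<longrightarrow>
        (let F = (\<lambda>b. h (sols M n \<phi> b)) ` tuples (dom M) m in
           finite F \<and>
           (\<forall>f \<in> F. definable_over L M {} m {b \<in> tuples (dom M) m. h (sols M n \<phi> b) = f}))) \<and>
     (\<forall>X Y p. \<forall>f \<in> carrier S.
        definable_map L M X Y p \<and> (\<forall>a \<in> Y. h {x \<in> X. p x = a} = f) \<longrightarrow> h X = f \<otimes>\<^bsub>S\<^esub> h Y)"

definition measurable_by :: "('f, 'r) lang \<Rightarrow> ('f, 'r, 'm) struct \<Rightarrow> 's ordered_ring \<Rightarrow> bool" where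
  "measurable_by L M S \<longleftrightarrow> measuring_semiring S \<and> (\<exists>h. is_measure L M S h)"

text \<open>
  A quantifier over all measuring semirings would range over all types; the type argument names the
  type of which the carrier of the semiring is a subset.
\<close>

definition generalised_measurable ::
  "'s itself \<Rightarrow> ('f, 'r) lang \<Rightarrow> ('f, 'r, 'm) struct \<Rightarrow> bool" where
  "generalised_measurable TYPE('s) L M \<longleftrightarrow> (\<exists>S :: 's ordered_ring. measurable_by L M S)"

definition ring_measurable ::
  "'s itself \<Rightarrow> ('f, 'r) lang \<Rightarrow> ('f, 'r, 'm) struct \<Rightarrow> bool" where
  "ring_measurable TYPE('s) L M \<longleftrightarrow>
     (\<exists>R :: 's ordered_ring. ordered_comm_ring R \<and> measurable_by L M (nonneg_part R))"

definition dims ::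
  "('f, 'r) lang \<Rightarrow> ('f, 'r, 'm) struct \<Rightarrow> 's ordered_ring \<Rightarrow> ('m list set \<Rightarrow> 's) \<Rightarrow> 's set set" where
  "dims L M S h = (\<lambda>X. dim S (h X)) ` Def L M"

definition generalised_measurable_wo ::
  "'s itself \<Rightarrow> ('f, 'r) lang \<Rightarrow> ('f, 'r, 'm) struct \<Rightarrow> bool" where
  "generalised_measurable_wo TYPE('s) L M \<longleftrightarrow>
     (\<exists>(S :: 's ordered_ring) h. measuring_semiring S \<and> is_measure L M S h \<and>
        well_order_on (dims L M S h) (Restr (dim_order S) (dims L M S h)))"

section \<open>Strict order property and functional unimodularity\<close>

text \<open>
  An interpretable partial order is a partial order on a quotient \<open>X // E\<close> of a definable set by a
  definable equivalence relation whose preimage in \<open>X \<times> X\<close> is definable.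
\<close>

definition interpretable_partial_order ::
  "('f, 'r) lang \<Rightarrow> ('f, 'r, 'm) struct \<Rightarrow> 'm list set set \<Rightarrow> ('m list set \<times> 'm list set) set \<Rightarrow> bool" where
  "interpretable_partial_order L M P lq \<longleftrightarrow>
     (\<exists>X E. X \<in> Def L M \<and> equiv X E \<and> {a @ b | a b. (a, b) \<in> E} \<in> Def L M \<and>
        P = X // E \<and> partial_order_on P lq \<and>
        {a @ b | a b. a \<in> X \<and> b \<in> X \<and> (E `` {a}, E `` {b}) \<in> lq} \<in> Def L M)"

definition strict_order_property ::
  "'n itself \<Rightarrow> ('f, 'r) lang \<Rightarrow> ('f, 'r) fm set \<Rightarrow> bool" where
  "strict_order_property TYPE('n) L T \<longleftrightarrow>
     (\<exists>(N :: ('f, 'r, 'n) struct) P lq K. is_model L N T \<and> interpretable_partial_order L N P lq \<and>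
        K \<subseteq> P \<and> infinite K \<and> (\<forall>u \<in> K. \<forall>v \<in> K. (u, v) \<in> lq \<or> (v, u) \<in> lq))"

definition functionally_unimodular_structure ::
  "('f, 'r) lang \<Rightarrow> ('f, 'r, 'm) struct \<Rightarrow> bool" where
  "functionally_unimodular_structure L M \<longleftrightarrow>
     (\<forall>A B f\<^sub>1 f\<^sub>2 k\<^sub>1 k\<^sub>2.
        definable_map L M A B f\<^sub>1 \<and> definable_map L M A B f\<^sub>2 \<and> B \<noteq> {} \<and>
        (\<forall>b \<in> B. finite {a \<in> A. f\<^sub>1 a = b} \<and> card {a \<in> A. f\<^sub>1 a = b} = k\<^sub>1) \<and>
        (\<forall>b \<in> B. finite {a \<in> A. f\<^sub>2 a = b} \<and> card {a \<in> A. f\<^sub>2 a = b} = k\<^sub>2)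
        \<longrightarrow> k\<^sub>1 = k\<^sub>2)"

definition functionally_unimodular ::
  "'n itself \<Rightarrow> ('f, 'r) lang \<Rightarrow> ('f, 'r) fm set \<Rightarrow> bool" where
  "functionally_unimodular TYPE('n) L T \<longleftrightarrow>
     (\<forall>N :: ('f, 'r, 'n) struct. is_model L N T \<longrightarrow> functionally_unimodular_structure L N)"

section \<open>Supersimple theories\<close>

text \<open>Formulas with parameters: a pair \<open>(\<phi>, b)\<close> stands for \<open>\<phi>(x; b)\<close> with \<open>|x| = n\<close>.\<close>

definition fms_over :: "('f, 'r) lang \<Rightarrow> 'm set \<Rightarrow> nat \<Rightarrow> (('f, 'r) fm \<times> 'm list) set" where
  "fms_over L A n = {(\<phi>, b). part_fm L n (length b) \<phi> \<and> set b \<subseteq> A}"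

definition tp ::
  "('f, 'r) lang \<Rightarrow> ('f, 'r, 'm) struct \<Rightarrow> 'm set \<Rightarrow> 'm list \<Rightarrow> (('f, 'r) fm \<times> 'm list) set" where
  "tp L M A a = {(\<phi>, b) \<in> fms_over L A (length a). a \<in> sols M (length a) \<phi> b}"

definition saturated ::
  "('f, 'r) lang \<Rightarrow> 'm rel \<Rightarrow> ('f, 'r, 'm) struct \<Rightarrow> bool" where
  "saturated L \<kappa> U \<longleftrightarrow>
     (\<forall>A n \<Sigma>. A \<subseteq> dom U \<and> (card_of A, \<kappa>) \<in> ordLess \<and> \<Sigma> \<subseteq> fms_over L A n \<and>
        (\<forall>\<Sigma>\<^sub>0 \<subseteq> \<Sigma>. finite \<Sigma>\<^sub>0 \<longrightarrow> (\<exists>a \<in> tuples (dom U) n. \<forall>(\<phi>, b) \<in> \<Sigma>\<^sub>0. a \<in> sols U n \<phi> b))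
        \<longrightarrow> (\<exists>a \<in> tuples (dom U) n. \<forall>(\<phi>, b) \<in> \<Sigma>. a \<in> sols U n \<phi> b))"

text \<open>
  The following two notions are meant for a sufficiently saturated model \<open>U\<close> and small \<open>A\<close>, \<open>B\<close>.
\<close>

definition divides ::
  "('f, 'r) lang \<Rightarrow> ('f, 'r, 'm) struct \<Rightarrow> 'm set \<Rightarrow> nat \<Rightarrow> ('f, 'r) fm \<Rightarrow> 'm list \<Rightarrow> bool" where
  "divides L U A n \<phi> c \<longleftrightarrow>
     (\<exists>(k :: nat) (cs :: nat \<Rightarrow> 'm list).
        (\<forall>i. cs i \<in> tuples (dom U) (length c) \<and> tp L U A (cs i) = tp L U A c) \<and>
        (\<forall>w. finite w \<and> card w = k \<longrightarrow> \<not> (\<exists>a \<in> tuples (dom U) n. \<forall>i \<in> w. a \<in> sols U n \<phi> (cs i))))"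

definition forks ::
  "('f, 'r) lang \<Rightarrow> ('f, 'r, 'm) struct \<Rightarrow> 'm set \<Rightarrow> 'm set \<Rightarrow> 'm list \<Rightarrow> bool" where
  "forks L U A B a \<longleftrightarrow>
     (\<exists>\<Delta>. finite \<Delta> \<and> \<Delta> \<subseteq> fms_over L (dom U) (length a) \<and>
        (\<forall>(\<phi>, c) \<in> \<Delta>. divides L U A (length a) \<phi> c) \<and>
        (\<forall>a' \<in> tuples (dom U) (length a). tp L U B a' = tp L U B a
           \<longrightarrow> (\<exists>(\<phi>, c) \<in> \<Delta>. a' \<in> sols U (length a) \<phi> c)))"

text \<open>
  Supersimplicity: in every \<open>\<kappa>\<close>-saturated model, \<open>\<kappa> > |L| + \<aleph>\<^sub>0\<close>, every type of a finite tuple over a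
  set \<open>B\<close> of fewer than \<open>\<kappa>\<close> parameters does not fork over some finite subset of \<open>B\<close>.
\<close>

definition supersimple :: "'n itself \<Rightarrow> ('f, 'r) lang \<Rightarrow> ('f, 'r) fm set \<Rightarrow> bool" where
  "supersimple TYPE('n) L T \<longleftrightarrow>
     (\<forall>(U :: ('f, 'r, 'n) struct) (\<kappa> :: 'n rel) B n a.
        is_model L U T \<and> card_order_on (Field \<kappa>) \<kappa> \<and>
        (card_of {p. wf_fm L p}, \<kappa>) \<in> ordLess \<and> saturated L \<kappa> U \<and>
        B \<subseteq> dom U \<and> (card_of B, \<kappa>) \<in> ordLess \<and> a \<in> tuples (dom U) n
        \<longrightarrow> (\<exists>B\<^sub>0 \<subseteq> B. finite B\<^sub>0 \<and> \<not> forks L U B\<^sub>0 B a))"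

section \<open>Multidimensional asymptotic classes\<close>

definition pointed ::
  "('f, 'r, 'c) struct set \<Rightarrow> nat \<Rightarrow> (('f, 'r, 'c) struct \<times> 'c list) set" where
  "pointed C m = {(M, b). M \<in> C \<and> b \<in> tuples (dom M) m}"

definition is_mac ::
  "('f, 'r) lang \<Rightarrow> ('f, 'r, 'c) struct set \<Rightarrow> (('f, 'r, 'c) struct \<Rightarrow> real) set \<Rightarrow> bool" where
  "is_mac L C R \<longleftrightarrow>
     (\<forall>M \<in> C. is_structure L M \<and> finite (dom M)) \<and>
     (\<forall>h \<in> R. \<forall>M \<in> C. 0 \<le> h M) \<and>
     (\<forall>n m \<phi>. part_fm L n m \<phi> \<longrightarrow>
        (\<exists>\<P> h. finite \<P> \<and> partition_on (pointed C m) \<P> \<and>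
           (\<forall>\<pi> \<in> \<P>. h \<pi> \<in> R \<and>
              (\<exists>\<psi>. part_fm L m 0 \<psi> \<and> \<pi> = {(M, b) \<in> pointed C m. b \<in> sols M m \<psi> []}) \<and>
              (\<forall>\<epsilon> > 0. \<exists>Q. \<forall>(M, b) \<in> \<pi>. card (dom M) > Q \<longrightarrow>
                 \<bar>real (card (sols M n \<phi> b)) - h \<pi> M\<bar> \<le> \<epsilon> * h \<pi> M))))"

definition balanced ::
  "('f, 'r, 'c) struct set \<Rightarrow> nat \<Rightarrow> nat \<Rightarrow> ('f, 'r) fm \<Rightarrow> bool" where
  "balanced C n m \<delta> \<longleftrightarrow>
     (\<forall>\<epsilon> > 0. \<exists>Q. \<forall>M \<in> C. card (dom M) > Q \<longrightarrow>
        (\<forall>a \<in> tuples (dom M) m. \<forall>b \<in> tuples (dom M) m.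
           sols M n \<delta> a \<noteq> {} \<and> sols M n \<delta> b \<noteq> {} \<longrightarrow>
           \<bar>real (card (sols M n \<delta> a)) - real (card (sols M n \<delta> b))\<bar>
             < \<epsilon> * real (card (sols M n \<delta> b))))"

text \<open>
  Real polynomials in the variables \<open>X\<^sub>0, \<dots>, X\<^sub>k\<^sub>-\<^sub>1\<close>: finitely supported maps from monomials (which
  are finitely supported exponent maps) to coefficients.
\<close>

type_synonym mpoly = "(nat \<Rightarrow>\<^sub>0 nat) \<Rightarrow>\<^sub>0 real"

definition mpoly_vars :: "mpoly \<Rightarrow> nat set" where
  "mpoly_vars p = (\<Union>m \<in> Poly_Mapping.keys p. Poly_Mapping.keys m)"

definition mpoly_eval :: "mpoly \<Rightarrow> (nat \<Rightarrow> real) \<Rightarrow> real" where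
  "mpoly_eval p x = (\<Sum>m \<in> Poly_Mapping.keys p.
     Poly_Mapping.lookup p m * (\<Prod>i \<in> Poly_Mapping.keys m. x i ^ Poly_Mapping.lookup m i))"

definition mpoly_abs :: "mpoly \<Rightarrow> mpoly" where
  "mpoly_abs p = Poly_Mapping.map abs p"

text \<open>
  The data exhibiting an m.a.c. as polynomial: \<open>\<delta>\<^sub>i = delta D i\<close> with \<open>|x\<^sub>i| = xlen D i\<close> and
  \<open>|y\<^sub>i| = ylen D i\<close>, \<open>N\<^sub>i = rt D i\<close> for \<open>i < num D\<close>, and \<open>P\<^sub>h = pol D h\<close>.
\<close>

record ('f, 'r, 'c) poly_data =
  num :: nat
  xlen :: "nat \<Rightarrow> nat"
  ylen :: "nat \<Rightarrow> nat"
  delta :: "nat \<Rightarrow> ('f, 'r) fm"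
  rt :: "nat \<Rightarrow> nat"
  pol :: "(('f, 'r, 'c) struct \<Rightarrow> real) \<Rightarrow> mpoly"

definition admissible ::
  "('f, 'r, 'c) poly_data \<Rightarrow> ('f, 'r, 'c) struct \<Rightarrow> (nat \<Rightarrow> 'c list) \<Rightarrow> bool" where
  "admissible D M a \<longleftrightarrow>
     (\<forall>i < num D. a i \<in> tuples (dom M) (ylen D i) \<and> sols M (xlen D i) (delta D i) (a i) \<noteq> {})"

definition coords ::
  "('f, 'r, 'c) poly_data \<Rightarrow> ('f, 'r, 'c) struct \<Rightarrow> (nat \<Rightarrow> 'c list) \<Rightarrow> nat \<Rightarrow> real" where
  "coords D M a i = root (rt D i) (real (card (sols M (xlen D i) (delta D i) (a i))))"

definition poly_presentation ::
  "('f, 'r) lang \<Rightarrow> ('f, 'r, 'c) struct set \<Rightarrow> (('f, 'r, 'c) struct \<Rightarrow> real) set \<Rightarrow>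
   ('f, 'r, 'c) poly_data \<Rightarrow> bool" where
  "poly_presentation L C R D \<longleftrightarrow>
     (\<forall>i < num D. part_fm L (xlen D i) (ylen D i) (delta D i) \<and>
        balanced C (xlen D i) (ylen D i) (delta D i) \<and> rt D i > 0) \<and>
     (\<forall>h \<in> R. mpoly_vars (pol D h) \<subseteq> {..<num D} \<and>
        (\<forall>M \<in> C. \<exists>a. admissible D M a \<and> h M = mpoly_eval (pol D h) (coords D M a)))"

definition polynomial_mac ::
  "('f, 'r) lang \<Rightarrow> ('f, 'r, 'c) struct set \<Rightarrow> (('f, 'r, 'c) struct \<Rightarrow> real) set \<Rightarrow> bool" where
  "polynomial_mac L C R \<longleftrightarrow> is_mac L C R \<and> (\<exists>D. poly_presentation L C R D)"

text \<open>
  The monomials of the \<open>P\<^sub>h\<close> do not cancel asymptotically: up to a constant, \<open>P\<^sub>h\<close> is as large as the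
  sum of the absolute values of its terms, and so as its largest monomial.  This is automatic if the
  coefficients are nonnegative.  Without it the dimensions occurring in an ultraproduct need not be
  well-ordered, since cancellation can produce an infinite descending sequence of orders of magnitude
  already for polynomials in two variables.  For example, let \<open>Q\<^sub>1 = x^2\<close>, \<open>Q\<^sub>2 = y^2 - x^3\<close> and
  \<open>Q\<^sub>n\<^sub>+\<^sub>1 = Q\<^sub>n^2 - y Q\<^sub>n\<^sub>-\<^sub>1\<close>.  For every \<open>N\<close> and every large real \<open>x\<close> there is a real \<open>y\<close> at which
  each \<open>Q\<^sub>n\<close> with \<open>n \<le> N\<close> is within a factor 2 of \<open>x powr (3/2 + 2 powr (-n))\<close>.
\<close>

definition no_cancellation ::
  "('f, 'r, 'c) struct set \<Rightarrow> (('f, 'r, 'c) struct \<Rightarrow> real) set \<Rightarrow> ('f, 'r, 'c) poly_data \<Rightarrow> bool" where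
  "no_cancellation C R D \<longleftrightarrow>
     (\<forall>h \<in> R. \<exists>c Q. \<forall>M \<in> C. card (dom M) > Q \<longrightarrow>
        (\<exists>a. admissible D M a \<and> h M = mpoly_eval (pol D h) (coords D M a) \<and>
             mpoly_eval (mpoly_abs (pol D h)) (coords D M a) \<le> c * h M))"

section \<open>Ultraproducts\<close>

definition is_ultrafilter :: "'i filter \<Rightarrow> bool" where
  "is_ultrafilter F \<longleftrightarrow>
     F \<noteq> bot \<and> (\<forall>P. eventually P F \<or> eventually (\<lambda>i. \<not> P i) F)"

definition up_rel :: "('i \<Rightarrow> ('f, 'r, 'c) struct) \<Rightarrow> 'i filter \<Rightarrow> ('i \<Rightarrow> 'c) rel" where
  "up_rel Ms F = {(u, v). (\<forall>i. u i \<in> dom (Ms i)) \<and> (\<forall>i. v i \<in> dom (Ms i)) \<and>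
                          eventually (\<lambda>i. u i = v i) F}"

definition rep :: "('i \<Rightarrow> 'c) set \<Rightarrow> 'i \<Rightarrow> 'c" where
  "rep c = (SOME u. u \<in> c)"

definition ultraproduct ::
  "('i \<Rightarrow> ('f, 'r, 'c) struct) \<Rightarrow> 'i filter \<Rightarrow> ('f, 'r, ('i \<Rightarrow> 'c) set) struct" where
  "ultraproduct Ms F =
     \<lparr> dom = {u. \<forall>i. u i \<in> dom (Ms i)} // up_rel Ms F,
       fn = (\<lambda>f cs. up_rel Ms F `` {\<lambda>i. fn (Ms i) f (map (\<lambda>c. rep c i) cs)}),
       rl = (\<lambda>r cs. eventually (\<lambda>i. rl (Ms i) r (map (\<lambda>c. rep c i) cs)) F) \<rparr>"

end

theory Submission
  imports Defs "HOL-Library.Ramsey"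
begin

text \<open>
  The values of a measure on a definable family are finitely many, and the parameters at which a
  given value occurs form a set defined without parameters.  Hence being a measure is a collection
  of first-order facts about the formulas that define the values, and a measure can be copied to
  any elementarily equivalent structure by reading these formulas there (\<^emph>\<open>measure_transfer\<close>).  It
  thus suffices to derive the remaining properties for a structure that carries a measure itself.

  The measuring axiom enters through one consequence: the multiples of a positive element increase
  strictly (\<^emph>\<open>add_pow_less\<close>).  In particular \<^term>\<open>x \<oplus>\<^bsub>S\<^esub> x = x\<close> forces \<^term>\<open>x\<close> to be zero.  If an
  infinite chain were interpretable, Ramsey's theorem would give three initial segments whose
  pairwise differences have the same measure, which is then idempotent and so zero
  (\<^emph>\<open>no_infinite_chain\<close>).  If two maps to the same nonempty set have fibres of different finite constant
  sizes, then the measure of their common domain is two different multiples of the same nonzero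
  element (\<^emph>\<open>functionally_unimodular\<close>).  In a ring addition is cancellative, so a self-map
  that is only injective or only surjective would give the zero measure to a nonempty set
  (\<^emph>\<open>injective_iff_surjective\<close>).

  For supersimplicity, choose among the sets defined over \<^term>\<open>B\<close> that contain the tuple one of
  least dimension, say \<^term>\<open>H\<close>, and let \<^term>\<open>B\<^sub>0\<close> be the set of parameters of one definition of it.
  A formula that divides over \<^term>\<open>B\<^sub>0\<close> and meets \<^term>\<open>H\<close> in a set of the dimension of
  \<^term>\<open>H\<close> would yield infinitely many subsets of \<^term>\<open>H\<close>, all of the same measure because that
  measure is determined by the type of the parameters, such that no point lies in \<^term>\<open>k\<close> of them.
  Double counting (\<^emph>\<open>measure_double_count\<close>) bounds the total measure of any number of these sets by
  a fixed multiple of one of them, a contradiction.  Forking reduces to dividing by saturation,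
  because a finite cover of a set has a member of the same dimension (\<^emph>\<open>not_forks_over_finite\<close>).

  In an ultraproduct of finite structures, a definable set has as its size the sequence of the
  numbers of elements of its factors, up to factors that tend to one along the ultrafilter.  These
  sizes form a measuring semiring (\<^emph>\<open>growth_measuring_semiring\<close>), and all the axioms of a measure
  except the one about families hold for any finite factors; the fibre axiom is a count of pairs
  (\<^emph>\<open>msr_map\<close>).  The axiom about families is what an asymptotic class provides, unless the sizes of
  the factors are bounded along the ultrafilter, when the ultraproduct is finite (\<^emph>\<open>msr_family\<close>).  If the class is
  polynomial and the monomials do not cancel, then the size of a nonempty set has the order of
  magnitude of one monomial in finitely many fixed sequences that are at least one
  (\<^emph>\<open>polynomial_dimension\<close>).  By Dickson's lemma such orders of magnitude are well-ordered.
\<close>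

section \<open>Formulas\<close>

lemma eval_trm_cong: "(\<And>i. i \<in> fv_trm t \<Longrightarrow> e i = e' i) \<Longrightarrow> eval_trm M e t = eval_trm M e' t"
proof (induction t)
  case (Fun f ts)
  have "map (eval_trm M e) ts = map (eval_trm M e') ts"
    using Fun by (intro map_cong) auto
  then show ?case by (simp only: eval_trm.simps)
qed simp

lemma sat_cong: "(\<And>i. i \<in> fv \<phi> \<Longrightarrow> e i = e' i) \<Longrightarrow> sat M e \<phi> \<longleftrightarrow> sat M e' \<phi>"
proof (induction \<phi> arbitrary: e e')
  case (Eq s t)
  then show ?case using eval_trm_cong[of s e e' M] eval_trm_cong[of t e e' M] by simp
next
  case (Rel r ts)
  have "map (eval_trm M e) ts = map (eval_trm M e') ts"
    using Rel by (intro map_cong[OF refl] eval_trm_cong) auto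
  then show ?case by (simp only: sat.simps)
next
  case (Conj p q)
  then show ?case by (metis UnI1 UnI2 fv.simps(4) sat.simps(4))
next
  case (Ex i p)
  have "sat M (e(i := a)) p \<longleftrightarrow> sat M (e'(i := a)) p" for a
    using Ex.prems by (intro Ex.IH) auto
  then show ?case by simp
next
  case (Neg p)
  then show ?case by (metis fv.simps(3) sat.simps(3))
qed

lemma finite_fv_trm: "finite (fv_trm t)"
  by (induction t) auto

lemma finite_fv: "finite (fv \<phi>)"
  by (induction \<phi>) (auto simp: finite_fv_trm)

primrec ren_trm :: "(nat \<Rightarrow> nat) \<Rightarrow> 'f trm \<Rightarrow> 'f trm" where
  "ren_trm \<sigma> (Var i) = Var (\<sigma> i)"
| "ren_trm \<sigma> (Fun f ts) = Fun f (map (ren_trm \<sigma>) ts)"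

definition fresh :: "nat set \<Rightarrow> nat" where
  "fresh A = (LEAST j. j \<notin> A)"

text \<open>
  The map on variables need not be injective, and bound variables move away from the image of the
  free ones, so that any selection or repetition of coordinates can be performed on a formula.
\<close>

primrec ren :: "('f, 'r) fm \<Rightarrow> (nat \<Rightarrow> nat) \<Rightarrow> ('f, 'r) fm" where
  "ren (Eq s t) \<sigma> = Eq (ren_trm \<sigma> s) (ren_trm \<sigma> t)"
| "ren (Rel r ts) \<sigma> = Rel r (map (ren_trm \<sigma>) ts)"
| "ren (Neg p) \<sigma> = Neg (ren p \<sigma>)"
| "ren (Conj p q) \<sigma> = Conj (ren p \<sigma>) (ren q \<sigma>)"
| "ren (Ex i p) \<sigma> = (let j = fresh (\<sigma> ` (fv p - {i})) in Ex j (ren p (\<sigma>(i := j))))"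

lemma fresh: "finite A \<Longrightarrow> fresh A \<notin> A"
  unfolding fresh_def by (metis LeastI_ex ex_new_if_finite infinite_UNIV_nat)

lemma fv_ren_trm: "fv_trm (ren_trm \<sigma> t) = \<sigma> ` fv_trm t"
  by (induction t) auto

lemma wf_ren_trm: "wf_trm L t \<Longrightarrow> wf_trm L (ren_trm \<sigma> t)"
  by (induction t) (auto simp: list_all_iff)

lemma eval_ren_trm: "eval_trm M e (ren_trm \<sigma> t) = eval_trm M (e \<circ> \<sigma>) t"
proof (induction t)
  case (Fun f ts)
  have "map (eval_trm M e) (map (ren_trm \<sigma>) ts) = map (eval_trm M (e \<circ> \<sigma>)) ts"
    unfolding map_map o_def[of "eval_trm M e"] using Fun by (intro map_cong) (auto simp: o_def)
  then show ?case by (simp only: eval_trm.simps ren_trm.simps)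
qed simp

lemma fv_ren: "fv (ren \<phi> \<sigma>) = \<sigma> ` fv \<phi>"
proof (induction \<phi> arbitrary: \<sigma>)
  case (Ex i p)
  define j where "j = fresh (\<sigma> ` (fv p - {i}))"
  have "j \<notin> \<sigma> ` (fv p - {i})"
    unfolding j_def by (intro fresh) (simp add: finite_fv)
  then have "(\<sigma>(i := j)) ` fv p - {j} = \<sigma> ` (fv p - {i})" by auto
  then show ?case by (simp add: Let_def Ex.IH flip: j_def)
qed (auto simp: fv_ren_trm)

lemma wf_ren: "wf_fm L \<phi> \<Longrightarrow> wf_fm L (ren \<phi> \<sigma>)"
  by (induction \<phi> arbitrary: \<sigma>) (auto simp: wf_ren_trm list_all_iff Let_def)

lemma sat_ren: "sat M e (ren \<phi> \<sigma>) \<longleftrightarrow> sat M (e \<circ> \<sigma>) \<phi>"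
proof (induction \<phi> arbitrary: \<sigma> e)
  case (Rel r ts)
  have "map (eval_trm M e) (map (ren_trm \<sigma>) ts) = map (eval_trm M (e \<circ> \<sigma>)) ts"
    unfolding map_map o_def[of "eval_trm M e"] by (simp add: eval_ren_trm)
  then show ?case by (simp only: sat.simps ren.simps)
next
  case (Ex i p)
  define j where "j = fresh (\<sigma> ` (fv p - {i}))"
  have "j \<notin> \<sigma> ` (fv p - {i})"
    unfolding j_def by (intro fresh) (simp add: finite_fv)
  then have "sat M (e(j := a) \<circ> \<sigma>(i := j)) p \<longleftrightarrow> sat M ((e \<circ> \<sigma>)(i := a)) p" for a
    by (intro sat_cong) auto
  then show ?case by (simp only: ren.simps Let_def sat.simps Ex.IH flip: j_def)
qed (auto simp: eval_ren_trm)

text \<open>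
  The condition of \<^term>\<open>part_fm\<close> with the partition forgotten: moving variables between the two
  sides of a partition is what turns fibres and sections into members of definable families.
\<close>

definition frm :: "('f, 'r) lang \<Rightarrow> nat \<Rightarrow> ('f, 'r) fm \<Rightarrow> bool" where
  "frm L n \<phi> \<longleftrightarrow> wf_fm L \<phi> \<and> fv \<phi> \<subseteq> {..<n}"

abbreviation holds :: "('f, 'r, 'm) struct \<Rightarrow> ('f, 'r) fm \<Rightarrow> 'm list \<Rightarrow> bool" where
  "holds M \<phi> a \<equiv> sat M ((!) a) \<phi>"

lemma part_fm_iff: "part_fm L n m \<phi> \<longleftrightarrow> frm L (n + m) \<phi>"
  by (simp add: part_fm_def frm_def)

lemma sols_iff: "a \<in> sols M n \<phi> b \<longleftrightarrow> a \<in> tuples (dom M) n \<and> holds M \<phi> (a @ b)"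
  by (simp add: sols_def)

lemma tuples_iff: "a \<in> tuples A n \<longleftrightarrow> length a = n \<and> set a \<subseteq> A"
  by (simp add: tuples_def)

lemma tuples_append: "a \<in> tuples A n \<Longrightarrow> b \<in> tuples A m \<Longrightarrow> a @ b \<in> tuples A (n + m)"
  by (auto simp: tuples_iff)

lemma tuples_split:
  assumes "c \<in> tuples A (n + m)"
  obtains a b where "c = a @ b" "a \<in> tuples A n" "b \<in> tuples A m"
proof
  show "c = take n c @ drop n c" by simp
  show "take n c \<in> tuples A n" "drop n c \<in> tuples A m"
    using assms set_take_subset[of n c] set_drop_subset[of n c] by (auto simp: tuples_iff)
qed

lemma tuples_0 [simp]: "tuples A 0 = {[]}"
  by (auto simp: tuples_iff)

lemma tuples_mono: "A \<subseteq> B \<Longrightarrow> tuples A n \<subseteq> tuples B n"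
  by (auto simp: tuples_def)

lemma finite_tuples: "finite A \<Longrightarrow> finite (tuples A n)"
  using finite_lists_length_eq[of A n] by (simp add: tuples_def conj_commute)

lemma frm_mono: "frm L n \<phi> \<Longrightarrow> n \<le> m \<Longrightarrow> frm L m \<phi>"
  by (auto simp: frm_def)

lemma holds_cong:
  "frm L n \<phi> \<Longrightarrow> (\<And>i. i < n \<Longrightarrow> a ! i = b ! i) \<Longrightarrow> holds M \<phi> a \<longleftrightarrow> holds M \<phi> b"
  by (intro sat_cong) (auto simp: frm_def)

lemma holds_append: "frm L (length a) \<phi> \<Longrightarrow> holds M \<phi> (a @ b) \<longleftrightarrow> holds M \<phi> a"
  by (rule holds_cong) (auto simp: nth_append)

text \<open>
  All changes of variables go through lists of coordinates, so that their effect on tuples is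
  \<^term>\<open>map ((!) a) js\<close> and can be computed block by block.
\<close>

definition sub :: "nat list \<Rightarrow> ('f, 'r) fm \<Rightarrow> ('f, 'r) fm" where
  "sub js \<phi> = ren \<phi> ((!) js)"

lemma frm_sub: "frm L (length js) \<phi> \<Longrightarrow> set js \<subseteq> {..<k} \<Longrightarrow> frm L k (sub js \<phi>)"
  by (auto simp: frm_def sub_def wf_ren fv_ren subset_iff)

lemma holds_sub: "frm L (length js) \<phi> \<Longrightarrow> holds M (sub js \<phi>) a \<longleftrightarrow> holds M \<phi> (map ((!) a) js)"
  unfolding sub_def sat_ren by (intro sat_cong) (auto simp: frm_def)

text \<open>Existential quantification over the last \<^term>\<open>n\<close> of \<^term>\<open>k + n\<close> variables.\<close>

primrec exq :: "nat \<Rightarrow> nat \<Rightarrow> ('f, 'r) fm \<Rightarrow> ('f, 'r) fm" where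
  "exq k 0 \<phi> = \<phi>"
| "exq k (Suc n) \<phi> = Ex k (exq (Suc k) n \<phi>)"

lemma frm_exq: "frm L (k + n) \<phi> \<Longrightarrow> frm L k (exq k n \<phi>)"
proof (induction n arbitrary: k)
  case (Suc n)
  then have "frm L (Suc k) (exq (Suc k) n \<phi>)" by simp
  then show ?case by (auto simp: frm_def less_Suc_eq)
qed simp

lemma holds_exq:
  assumes "frm L (k + n) \<phi>" "length c = k"
  shows "holds M (exq k n \<phi>) c \<longleftrightarrow> (\<exists>x \<in> tuples (dom M) n. holds M \<phi> (c @ x))"
  using assms
proof (induction n arbitrary: k c)
  case (Suc n)
  have 1: "frm L (Suc k) (exq (Suc k) n \<phi>)"
    using Suc.prems by (intro frm_exq) simp
  have 2: "sat M (((!) c)(k := a)) (exq (Suc k) n \<phi>) \<longleftrightarrow> holds M (exq (Suc k) n \<phi>) (c @ [a])" for a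
    using 1 Suc.prems(2) by (intro sat_cong) (auto simp: frm_def nth_append less_Suc_eq)
  have "holds M (exq k (Suc n) \<phi>) c \<longleftrightarrow>
      (\<exists>a \<in> dom M. \<exists>x \<in> tuples (dom M) n. holds M \<phi> ((c @ [a]) @ x))"
    using Suc.IH[of "Suc k"] Suc.prems by (simp add: 2)
  also have "\<dots> \<longleftrightarrow> (\<exists>x \<in> tuples (dom M) (Suc n). holds M \<phi> (c @ x))"
  proof safe
    fix a x assume "a \<in> dom M" "x \<in> tuples (dom M) n" "holds M \<phi> ((c @ [a]) @ x)"
    then show "\<exists>x \<in> tuples (dom M) (Suc n). holds M \<phi> (c @ x)"
      by (intro bexI[of _ "a # x"]) (auto simp: tuples_iff)
  next
    fix x assume x: "x \<in> tuples (dom M) (Suc n)" "holds M \<phi> (c @ x)"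
    then obtain a y where "x = a # y" by (cases x) (auto simp: tuples_iff)
    with x show "\<exists>a \<in> dom M. \<exists>x \<in> tuples (dom M) n. holds M \<phi> ((c @ [a]) @ x)"
      by (intro bexI[of _ a] bexI[of _ y]) (auto simp: tuples_iff)
  qed
  finally show ?case .
qed simp

lemma frm_Neg [simp]: "frm L k (Neg \<phi>) \<longleftrightarrow> frm L k \<phi>"
  and frm_Conj [simp]: "frm L k (Conj \<phi> \<psi>) \<longleftrightarrow> frm L k \<phi> \<and> frm L k \<psi>"
  by (auto simp: frm_def)

text \<open>A contradiction without free variables, and so available at arity zero as well.\<close>

definition Fals :: "('f, 'r) fm" where
  "Fals = Ex 0 (Neg (Eq (Var 0) (Var 0)))"

lemma frm_Fals [simp]: "frm L k Fals" and sat_Fals [simp]: "\<not> sat M e Fals"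
  by (auto simp: Fals_def frm_def)

definition allq :: "nat \<Rightarrow> nat \<Rightarrow> ('f, 'r) fm \<Rightarrow> ('f, 'r) fm" where
  "allq k n \<phi> = Neg (exq k n (Neg \<phi>))"

lemma frm_allq: "frm L (k + n) \<phi> \<Longrightarrow> frm L k (allq k n \<phi>)"
  by (simp add: allq_def frm_exq)

lemma holds_allq:
  "frm L (k + n) \<phi> \<Longrightarrow> length c = k \<Longrightarrow>
    holds M (allq k n \<phi>) c \<longleftrightarrow> (\<forall>x \<in> tuples (dom M) n. holds M \<phi> (c @ x))"
  by (simp add: allq_def holds_exq)

definition Disj :: "('f, 'r) fm \<Rightarrow> ('f, 'r) fm \<Rightarrow> ('f, 'r) fm" where
  "Disj \<phi> \<psi> = Neg (Conj (Neg \<phi>) (Neg \<psi>))"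

lemma frm_Disj [simp]: "frm L k (Disj \<phi> \<psi>) \<longleftrightarrow> frm L k \<phi> \<and> frm L k \<psi>"
  and sat_Disj [simp]: "sat M e (Disj \<phi> \<psi>) \<longleftrightarrow> sat M e \<phi> \<or> sat M e \<psi>"
  by (auto simp: Disj_def)

lemma map_nth_append [simp]:
  "length a = n \<Longrightarrow> map ((!) (a @ b)) [0..<n] = a"
  "length a = n \<Longrightarrow> map ((!) (a @ b)) [n..<n + length b] = b"
  by (auto intro!: nth_equalityI simp: nth_append)

lemma map_nth_append_mid:
  "length a = n \<Longrightarrow> n + length b = m \<Longrightarrow> map ((!) (a @ b @ c)) [n..<m] = b"
  by (auto intro!: nth_equalityI simp: nth_append)

lemma Th_iff:
  assumes "is_structure L M"
  shows "p \<in> Th L M \<longleftrightarrow> frm L 0 p \<and> holds M p []"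
proof -
  obtain u where u: "u \<in> dom M" using assms by (auto simp: is_structure_def)
  have eq: "sat M e p \<longleftrightarrow> holds M p []" if "fv p = {}" for e
    using that by (intro sat_cong) auto
  show ?thesis
  proof (cases "fv p = {}")
    case True
    have "range (\<lambda>_::nat. u) \<subseteq> dom M" using u by auto
    then have "(\<forall>e. range e \<subseteq> dom M \<longrightarrow> sat M e p) \<longleftrightarrow> holds M p []"
      using eq[OF True] by blast
    then show ?thesis using True by (simp add: Th_def frm_def)
  qed (auto simp: Th_def frm_def)
qed

text \<open>
  Elementary equivalence speaks of sentences; a formula that holds of some tuple of one structure
  holds of some tuple of the other because the sentence quantifying it existentially does.
\<close>

lemma elementary_transfer:
  assumes "is_structure L M" "is_structure L N" "elementarily_equivalent L M N"
    and \<chi>: "frm L k \<chi>" and b: "b \<in> tuples (dom N) k" "holds N \<chi> b"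
  shows "\<exists>b \<in> tuples (dom M) k. holds M \<chi> b"
proof -
  let ?s = "exq 0 k \<chi>"
  have s: "frm L 0 ?s" using \<chi> by (intro frm_exq) simp
  have "holds N ?s []" using b holds_exq[of L 0 k \<chi> "[]" N] \<chi> by auto
  then have "?s \<in> Th L M"
    using s Th_iff[OF assms(2)] assms(3) by (simp add: elementarily_equivalent_def)
  then have "holds M ?s []" using Th_iff[OF assms(1)] by simp
  then show ?thesis using holds_exq[of L 0 k \<chi> "[]" M] \<chi> by auto
qed

lemma model_of_Th_elementarily_equivalent:
  assumes "is_structure L M" "is_model L N (Th L M)"
  shows "is_structure L N" "elementarily_equivalent L M N"
proof -
  show N: "is_structure L N" using assms(2) by (simp add: is_model_def)
  have sub: "Th L M \<subseteq> Th L N" using assms(2) by (simp add: is_model_def)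
  have "p \<in> Th L M" if p: "p \<in> Th L N" for p
  proof (rule ccontr)
    assume "p \<notin> Th L M"
    then have "Neg p \<in> Th L M"
      using p unfolding Th_iff[OF assms(1)] Th_iff[OF N] by simp
    then have "Neg p \<in> Th L N" using sub by blast
    then show False using p unfolding Th_iff[OF N] by simp
  qed
  then show "elementarily_equivalent L M N"
    using sub by (auto simp: elementarily_equivalent_def)
qed

section \<open>Definable sets\<close>

text \<open>
  Definability of predicates rather than sets, so that closure rules can be chained along the
  syntax of a condition without rewriting set comprehensions.
\<close>

definition dp ::
  "('f, 'r) lang \<Rightarrow> ('f, 'r, 'm) struct \<Rightarrow> 'm set \<Rightarrow> nat \<Rightarrow> ('m list \<Rightarrow> bool) \<Rightarrow> bool" where
  "dp L M A n P \<longleftrightarrow> definable_over L M A n {a \<in> tuples (dom M) n. P a}"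

lemma dp_iff:
  "dp L M A n P \<longleftrightarrow> (\<exists>m \<phi> c. frm L (n + m) \<phi> \<and> c \<in> tuples A m \<and>
     (\<forall>a \<in> tuples (dom M) n. P a \<longleftrightarrow> holds M \<phi> (a @ c)))"
  unfolding dp_def definable_over_def part_fm_iff set_eq_iff sols_iff mem_Collect_eq by blast

lemma dpI:
  "frm L (n + m) \<phi> \<Longrightarrow> c \<in> tuples A m \<Longrightarrow>
   (\<And>a. a \<in> tuples (dom M) n \<Longrightarrow> P a \<longleftrightarrow> holds M \<phi> (a @ c)) \<Longrightarrow> dp L M A n P"
  unfolding dp_iff by blast

lemma definable_over_dp:
  assumes "definable_over L M A n X"
  shows "X \<subseteq> tuples (dom M) n" "dp L M A n (\<lambda>a. a \<in> X)"
proof -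
  show X: "X \<subseteq> tuples (dom M) n" using assms by (auto simp: definable_over_def sols_iff)
  then have "{a \<in> tuples (dom M) n. a \<in> X} = X" by auto
  then show "dp L M A n (\<lambda>a. a \<in> X)" using assms by (simp add: dp_def)
qed

lemma dp_definable_over:
  assumes "dp L M A n P" "\<And>a. a \<in> X \<longleftrightarrow> a \<in> tuples (dom M) n \<and> P a"
  shows "definable_over L M A n X"
proof -
  have "X = {a \<in> tuples (dom M) n. P a}" using assms(2) by auto
  then show ?thesis using assms(1) by (simp add: dp_def)
qed

lemma dp_cong:
  "dp L M A n P \<Longrightarrow> (\<And>a. a \<in> tuples (dom M) n \<Longrightarrow> P a \<longleftrightarrow> Q a) \<Longrightarrow> dp L M A n Q"
  unfolding dp_iff by simp

lemma dp_mono: "dp L M A n P \<Longrightarrow> A \<subseteq> B \<Longrightarrow> dp L M B n P"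
  unfolding dp_iff using tuples_mono by blast

lemma dp_holds: "frm L n \<phi> \<Longrightarrow> dp L M A n (holds M \<phi>)"
  by (rule dpI[of L n 0 \<phi> "[]"]) auto

lemma dp_not: "dp L M A n P \<Longrightarrow> dp L M A n (\<lambda>a. \<not> P a)"
proof -
  assume "dp L M A n P"
  then obtain m \<phi> c where "frm L (n + m) \<phi>" "c \<in> tuples A m"
    "\<forall>a \<in> tuples (dom M) n. P a \<longleftrightarrow> holds M \<phi> (a @ c)" unfolding dp_iff by blast
  then show ?thesis by (intro dpI[of L n m "Neg \<phi>" c]) auto
qed

lemma dp_False: "dp L M A n (\<lambda>a. False)"
  by (rule dpI[of L n 0 Fals "[]"]) auto

lemma dp_conj:
  assumes "dp L M A n P" "dp L M A n Q"
  shows "dp L M A n (\<lambda>a. P a \<and> Q a)"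
proof -
  obtain m \<phi> c where 1: "frm L (n + m) \<phi>" "c \<in> tuples A m"
    "\<forall>a \<in> tuples (dom M) n. P a \<longleftrightarrow> holds M \<phi> (a @ c)" using assms(1) unfolding dp_iff by blast
  obtain m' \<phi>' c' where 2: "frm L (n + m') \<phi>'" "c' \<in> tuples A m'"
    "\<forall>a \<in> tuples (dom M) n. Q a \<longleftrightarrow> holds M \<phi>' (a @ c')" using assms(2) unfolding dp_iff by blast
  let ?js = "[0..<n] @ [n + m..<n + m + m']"
  show ?thesis
  proof (rule dpI[of L n "m + m'" "Conj \<phi> (sub ?js \<phi>')" "c @ c'"])
    show "frm L (n + (m + m')) (Conj \<phi> (sub ?js \<phi>'))"
      using 1 2 by (auto intro!: frm_sub frm_mono[OF 1(1)])
    show "c @ c' \<in> tuples A (m + m')" using 1 2 by (intro tuples_append)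
    fix a assume a: "a \<in> tuples (dom M) n"
    have l: "length a = n" "length c = m" "length c' = m'"
      using a 1 2 by (auto simp: tuples_iff)
    have "map ((!) (a @ c @ c')) ?js = a @ c'"
      using l map_nth_append(1)[of a n "c @ c'"] map_nth_append(2)[of "a @ c" "n + m" c'] by simp
    then have "holds M (sub ?js \<phi>') (a @ c @ c') \<longleftrightarrow> Q a"
      using 2 a holds_sub[of L ?js \<phi>' M] by simp
    moreover have "holds M \<phi> (a @ c @ c') \<longleftrightarrow> P a"
      using 1 a l holds_append[of L "a @ c" \<phi> M c'] by simp
    ultimately show "(P a \<and> Q a) \<longleftrightarrow> holds M (Conj \<phi> (sub ?js \<phi>')) (a @ c @ c')" by simp
  qed
qed

lemma dp_disj: "dp L M A n P \<Longrightarrow> dp L M A n Q \<Longrightarrow> dp L M A n (\<lambda>a. P a \<or> Q a)"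
  using dp_not[OF dp_conj[OF dp_not dp_not], of L M A n P Q] by simp

lemma dp_finite_disj:
  "finite I \<Longrightarrow> (\<And>i. i \<in> I \<Longrightarrow> dp L M A n (P i)) \<Longrightarrow> dp L M A n (\<lambda>a. \<exists>i \<in> I. P i a)"
  by (induction rule: finite_induct) (auto intro: dp_disj dp_False)

lemma dp_finite_conj:
  assumes "finite I" "\<And>i. i \<in> I \<Longrightarrow> dp L M A n (P i)"
  shows "dp L M A n (\<lambda>a. \<forall>i \<in> I. P i a)"
  using dp_not[OF dp_finite_disj[of I L M A n "\<lambda>i a. \<not> P i a"]] assms by (simp add: dp_not)

lemma dp_coords:
  assumes "dp L M A l P" "length js = l" "set js \<subseteq> {..<k}"
  shows "dp L M A k (\<lambda>a. P (map ((!) a) js))"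
proof -
  obtain m \<phi> c where 1: "frm L (l + m) \<phi>" "c \<in> tuples A m"
    "\<forall>a \<in> tuples (dom M) l. P a \<longleftrightarrow> holds M \<phi> (a @ c)" using assms(1) unfolding dp_iff by blast
  let ?js = "js @ [k..<k + m]"
  show ?thesis
  proof (rule dpI[of L k m "sub ?js \<phi>" c])
    show "frm L (k + m) (sub ?js \<phi>)" using 1 assms by (intro frm_sub) auto
    fix a assume a: "a \<in> tuples (dom M) k"
    have l: "length a = k" "length c = m" using a 1 by (auto simp: tuples_iff)
    have "map ((!) (a @ c)) js = map ((!) a) js"
      using assms(3) l by (simp add: nth_append subset_iff)
    then have "map ((!) (a @ c)) ?js = map ((!) a) js @ c"
      unfolding map_append using l map_nth_append(2)[of a k c] by simp
    moreover have "map ((!) a) js \<in> tuples (dom M) l"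
      using a assms(2,3) by (auto simp: tuples_iff subset_iff)
    ultimately show "P (map ((!) a) js) \<longleftrightarrow> holds M (sub ?js \<phi>) (a @ c)"
      using 1 assms(2) holds_sub[of L ?js \<phi> M "a @ c"] by (simp del: map_append)
  qed (use 1 in auto)
qed

text \<open>
  The formula has its parameters after the quantified block, which therefore has to be moved to the
  end before \<^term>\<open>exq\<close> applies.
\<close>

lemma dp_ex:
  assumes "dp L M A (n + m) P"
  shows "dp L M A n (\<lambda>a. \<exists>b \<in> tuples (dom M) m. P (a @ b))"
proof -
  obtain k \<phi> c where 1: "frm L (n + m + k) \<phi>" "c \<in> tuples A k"
    "\<forall>a \<in> tuples (dom M) (n + m). P a \<longleftrightarrow> holds M \<phi> (a @ c)" using assms(1) unfolding dp_iff by blast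
  let ?js = "[0..<n] @ [n + k..<n + k + m] @ [n..<n + k]"
  have f: "frm L (n + k + m) (sub ?js \<phi>)" using 1 by (intro frm_sub) (auto simp: ac_simps)
  show ?thesis
  proof (rule dpI[of L n k "exq (n + k) m (sub ?js \<phi>)" c])
    show "frm L (n + k) (exq (n + k) m (sub ?js \<phi>))" using f by (rule frm_exq)
    fix a assume a: "a \<in> tuples (dom M) n"
    have l: "length a = n" "length c = k" using a 1 by (auto simp: tuples_iff)
    have "holds M (sub ?js \<phi>) ((a @ c) @ b) \<longleftrightarrow> P (a @ b)" if "b \<in> tuples (dom M) m" for b
    proof -
      have lb: "length b = m" using that by (simp add: tuples_iff)
      have "map ((!) (a @ c @ b)) ?js = (a @ b) @ c"
        using l lb map_nth_append(1)[of a n "c @ b"] map_nth_append(2)[of "a @ c" "n + k" b]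
          map_nth_append_mid[of a n c "n + k" b] by simp
      then show ?thesis
        using 1 tuples_append[OF a that] holds_sub[of L ?js \<phi> M "a @ c @ b"] by (simp add: ac_simps)
    qed
    then show "(\<exists>b \<in> tuples (dom M) m. P (a @ b)) \<longleftrightarrow> holds M (exq (n + k) m (sub ?js \<phi>)) (a @ c)"
      using holds_exq[OF f, of "a @ c"] l by auto
  qed (use 1 in auto)
qed

lemma dp_section:
  assumes "dp L M A (n + m) P" "b \<in> tuples A m" "A \<subseteq> dom M"
  shows "dp L M A n (\<lambda>a. P (a @ b))"
proof -
  obtain k \<phi> c where 1: "frm L (n + m + k) \<phi>" "c \<in> tuples A k"
    "\<forall>a \<in> tuples (dom M) (n + m). P a \<longleftrightarrow> holds M \<phi> (a @ c)" using assms(1) unfolding dp_iff by blast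
  show ?thesis
  proof (rule dpI[of L n "m + k" \<phi> "b @ c"])
    show "b @ c \<in> tuples A (m + k)" using 1 assms by (intro tuples_append)
    fix a assume "a \<in> tuples (dom M) n"
    then have "a @ b \<in> tuples (dom M) (n + m)"
      using assms tuples_mono by (intro tuples_append) blast+
    then show "P (a @ b) \<longleftrightarrow> holds M \<phi> (a @ b @ c)" using 1 by simp
  qed (use 1 in \<open>simp add: ac_simps\<close>)
qed

lemma dp_take: "dp L M A n P \<Longrightarrow> dp L M A (n + m) (\<lambda>a. P (take n a))"
proof -
  assume "dp L M A n P"
  from dp_coords[OF this, of "[0..<n]" "n + m"]
  have "dp L M A (n + m) (\<lambda>a. P (map ((!) a) [0..<n]))"
    by (simp add: subset_iff)
  then show ?thesis
  proof (rule dp_cong)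
    fix a assume "a \<in> tuples (dom M) (n + m)"
    then have "map ((!) a) [0..<n] = take n a" by (auto simp: tuples_iff intro!: nth_equalityI)
    then show "P (map ((!) a) [0..<n]) \<longleftrightarrow> P (take n a)" by simp
  qed
qed

lemma dp_drop: "dp L M A m P \<Longrightarrow> dp L M A (n + m) (\<lambda>a. P (drop n a))"
proof -
  assume "dp L M A m P"
  from dp_coords[OF this, of "[n..<n + m]" "n + m"]
  have "dp L M A (n + m) (\<lambda>a. P (map ((!) a) [n..<n + m]))"
    by (simp add: subset_iff)
  then show ?thesis
  proof (rule dp_cong)
    fix a assume "a \<in> tuples (dom M) (n + m)"
    then have "map ((!) a) [n..<n + m] = drop n a" by (auto simp: tuples_iff intro!: nth_equalityI)
    then show "P (map ((!) a) [n..<n + m]) \<longleftrightarrow> P (drop n a)" by simp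
  qed
qed

lemma dp_nth_eq: "i < n \<Longrightarrow> j < n \<Longrightarrow> dp L M A n (\<lambda>a. a ! i = a ! j)"
  by (rule dpI[of L n 0 "Eq (Var i) (Var j)" "[]"]) (auto simp: frm_def)

lemma dp_eq: "dp L M A (n + n) (\<lambda>a. take n a = drop n a)"
proof (rule dp_cong)
  show "dp L M A (n + n) (\<lambda>a. \<forall>i \<in> {..<n}. a ! i = a ! (n + i))"
    by (intro dp_finite_conj dp_nth_eq) auto
  fix a assume "a \<in> tuples (dom M) (n + n)"
  then show "(\<forall>i \<in> {..<n}. a ! i = a ! (n + i)) \<longleftrightarrow> take n a = drop n a"
    by (auto simp: tuples_iff list_eq_iff_nth_eq)
qed

lemma Def_iff: "X \<in> Def L M \<longleftrightarrow> (\<exists>n. definable_over L M (dom M) n X)"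
  by (simp add: Def_def)

lemma DefI: "definable_over L M (dom M) n X \<Longrightarrow> X \<in> Def L M"
  by (auto simp: Def_def)

lemma Def_sols: "part_fm L n m \<phi> \<Longrightarrow> b \<in> tuples (dom M) m \<Longrightarrow> sols M n \<phi> b \<in> Def L M"
  by (auto simp: Def_def definable_over_def)

lemma definable_empty: "definable_over L M A n {}"
  by (rule dp_definable_over[OF dp_False]) auto

section \<open>Definable sets and maps of one structure\<close>

locale definability =
  fixes L :: "('f, 'r) lang" and M :: "('f, 'r, 'm) struct"
begin

abbreviation "T \<equiv> tuples (dom M)"
abbreviation "D \<equiv> definable_over L M (dom M)"
abbreviation "dp' \<equiv> dp L M (dom M)"

lemma D_Un: "D n X \<Longrightarrow> D n Y \<Longrightarrow> D n (X \<union> Y)"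
  by (rule dp_definable_over[OF dp_disj[OF definable_over_dp(2)[of L M "dom M" n X]
    definable_over_dp(2)[of L M "dom M" n Y]]])
    (auto dest: definable_over_dp(1))

lemma D_Int: "D n X \<Longrightarrow> D n Y \<Longrightarrow> D n (X \<inter> Y)"
  by (rule dp_definable_over[OF dp_conj[OF definable_over_dp(2)[of L M "dom M" n X]
    definable_over_dp(2)[of L M "dom M" n Y]]])
    (auto dest: definable_over_dp(1))

lemma D_Diff: "D n X \<Longrightarrow> D n Y \<Longrightarrow> D n (X - Y)"
  by (rule dp_definable_over[OF dp_conj[OF definable_over_dp(2)[of L M "dom M" n X]
    dp_not[OF definable_over_dp(2)[of L M "dom M" n Y]]]])
    (auto dest: definable_over_dp(1))

lemma D_Collect: "D n X \<Longrightarrow> dp' n P \<Longrightarrow> D n {x \<in> X. P x}"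
  by (rule dp_definable_over[OF dp_conj[OF definable_over_dp(2)[of L M "dom M" n X]]])
    (auto dest: definable_over_dp(1))

lemma D_arity: "D n X \<Longrightarrow> x \<in> X \<Longrightarrow> x \<in> T n"
  using definable_over_dp(1) by blast

lemma D_length: "D n X \<Longrightarrow> x \<in> X \<Longrightarrow> length x = n"
  using D_arity by (auto simp: tuples_iff)

lemma D_singleton: "a \<in> T n \<Longrightarrow> D n {a}"
proof (rule dp_definable_over)
  assume a: "a \<in> T n"
  show "dp' n (\<lambda>x. take n (x @ a) = drop n (x @ a))"
    by (rule dp_section[OF dp_eq a]) simp
  show "x \<in> {a} \<longleftrightarrow> x \<in> T n \<and> take n (x @ a) = drop n (x @ a)" for x
    using a by (auto simp: tuples_iff)
qed

lemma definable_mapE: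
  assumes "definable_map L M X Y p"
  obtains n m where "D n X" "D m Y" "D (n + m) {a @ p a | a. a \<in> X}" "p \<in> X \<rightarrow> Y"
proof -
  have p: "p \<in> X \<rightarrow> Y" using assms by (auto simp: definable_map_def)
  obtain n m k where D: "D n X" "D m Y" "D k {a @ p a | a. a \<in> X}"
    using assms by (auto simp: definable_map_def Def_iff)
  show thesis
  proof (cases "X = {}")
    case True
    have "D (n + m) {a @ p a | a. a \<in> X}" using definable_empty True by simp
    then show thesis using that D p by blast
  next
    case False
    then obtain a where a: "a \<in> X" by blast
    then have "length a = n" "length (p a) = m" "length (a @ p a) = k"
      using D_length[OF D(1)] D_length[OF D(2)] D_length[OF D(3), of "a @ p a"] p by auto
    then have "k = n + m" by simp
    then show thesis using that D p by blast
  qed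
qed

lemma graph_mem:
  assumes "D n X" "x \<in> T n" "G = {a @ p a | a. a \<in> X}"
  shows "x @ y \<in> G \<longleftrightarrow> x \<in> X \<and> p x = y"
proof
  assume "x @ y \<in> G"
  then obtain a where a: "a \<in> X" "x @ y = a @ p a" using assms(3) by auto
  have "length a = length x" using D_length[OF assms(1) a(1)] assms(2) by (simp add: tuples_iff)
  then show "x \<in> X \<and> p x = y" using a by simp
qed (use assms(3) in auto)

lemma fibre_eq:
  assumes "D n X" "G = {a @ p a | a. a \<in> X}"
  shows "{x \<in> T n. x @ y \<in> G} = {x \<in> X. p x = y}"
  using graph_mem[OF assms(1) _ assms(2), of _ y] D_arity[OF assms(1)] by blast

text \<open>The preimage is the projection of the part of the graph above the set.\<close>

lemma D_preimage:
  assumes "D n X" "D m Y" "D (n + m) {a @ p a | a. a \<in> X}" "p \<in> X \<rightarrow> Y" "dp' m P"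
  shows "D n {x \<in> X. P (p x)}"
proof (rule dp_definable_over)
  let ?G = "{a @ p a | a. a \<in> X}"
  show "dp' n (\<lambda>x. \<exists>y \<in> T m. x @ y \<in> ?G \<and> P (drop n (x @ y)))"
    by (rule dp_ex[OF dp_conj[OF definable_over_dp(2)[OF assms(3)] dp_drop[OF assms(5)]]])
  fix x
  have "(\<exists>y \<in> T m. x @ y \<in> ?G \<and> P (drop n (x @ y))) \<longleftrightarrow> x \<in> X \<and> P (p x)" if "x \<in> T n"
    using graph_mem[OF assms(1) that, of ?G p] that D_arity[OF assms(2)] assms(4)
    by (auto simp: tuples_iff)
  then show "x \<in> {x \<in> X. P (p x)} \<longleftrightarrow> x \<in> T n \<and> (\<exists>y \<in> T m. x @ y \<in> ?G \<and> P (drop n (x @ y)))"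
    using D_arity[OF assms(1)] by blast
qed

lemma definable_map_restrict:
  assumes "D n X" "D m Y" "D (n + m) {a @ p a | a. a \<in> X}" "p \<in> X \<rightarrow> Y" "dp' m P"
  shows "definable_map L M {x \<in> X. P (p x)} {y \<in> Y. P y} p"
proof -
  have "D (n + m) {z \<in> {a @ p a | a. a \<in> X}. P (drop n z)}"
    using assms by (intro D_Collect dp_drop)
  moreover have "{z \<in> {a @ p a | a. a \<in> X}. P (drop n z)} = {a @ p a | a. a \<in> {x \<in> X. P (p x)}}"
    using D_length[OF assms(1)] by auto
  ultimately have "D (n + m) {a @ p a | a. a \<in> {x \<in> X. P (p x)}}" by simp
  then show ?thesis
    using D_preimage[OF assms] D_Collect[OF assms(2,5)] assms(4)
    by (auto simp: definable_map_def intro: DefI)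
qed

end

section \<open>Arithmetic in ordered semirings\<close>

context ordered_srig
begin

lemma le_refl: "x \<in> carrier S \<Longrightarrow> rle S x x"
  using total by (auto simp: total_order_carrier_def order_on_defs refl_on_def)

lemma le_trans:
  assumes "rle S x y" "rle S y z" "x \<in> carrier S" "y \<in> carrier S" "z \<in> carrier S"
  shows "rle S x z"
proof -
  have "trans {(x, y). x \<in> carrier S \<and> y \<in> carrier S \<and> rle S x y}"
    using total by (simp add: total_order_carrier_def order_on_defs)
  then show ?thesis using transD[of _ x y z] assms by auto
qed

lemma le_antisym:
  assumes "rle S x y" "rle S y x" "x \<in> carrier S" "y \<in> carrier S"
  shows "x = y"
proof -
  have "antisym {(x, y). x \<in> carrier S \<and> y \<in> carrier S \<and> rle S x y}"
    using total by (simp add: total_order_carrier_def order_on_defs)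
  then show ?thesis using antisymD[of _ x y] assms by auto
qed

lemma le_linear: "x \<in> carrier S \<Longrightarrow> y \<in> carrier S \<Longrightarrow> rle S x y \<or> rle S y x"
  using total le_refl[of x] by (fastforce simp: total_order_carrier_def order_on_defs total_on_def)

lemma not_le: "x \<in> carrier S \<Longrightarrow> y \<in> carrier S \<Longrightarrow> \<not> rle S x y \<longleftrightarrow> rlt S y x"
  using le_linear[of x y] le_antisym[of x y] le_refl[of x] by (auto simp: rlt_def)

lemma add_mono2:
  assumes "rle S a b" "rle S c d"
    and "a \<in> carrier S" "b \<in> carrier S" "c \<in> carrier S" "d \<in> carrier S"
  shows "rle S (a \<oplus> c) (b \<oplus> d)"
proof -
  have "rle S (a \<oplus> c) (b \<oplus> c)" using assms by (intro add_mono)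
  moreover have "rle S (c \<oplus> b) (d \<oplus> b)" using assms by (intro add_mono)
  ultimately show ?thesis
    using le_trans[of "a \<oplus> c" "b \<oplus> c" "b \<oplus> d"] assms by (simp add: a_comm)
qed

lemma le_add: "a \<in> carrier S \<Longrightarrow> b \<in> carrier S \<Longrightarrow> rle S a (a \<oplus> b)"
  using add_mono2[of a a \<zero> b] zero_least[of b] le_refl[of a] by simp

lemma pos_iff: "x \<in> carrier S \<Longrightarrow> rlt S \<zero> x \<longleftrightarrow> x \<noteq> \<zero>"
  using zero_least[of x] by (auto simp: rlt_def)

lemma add_pow_closed [simp]: "x \<in> carrier S \<Longrightarrow> [(n::nat)] \<cdot> x \<in> carrier S"
  by (rule add.nat_pow_closed)

lemma add_pow_0 [simp]: "[(0::nat)] \<cdot> x = \<zero>"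
  by (simp add: add_pow_def nat_pow_def)

lemma add_pow_Suc: "x \<in> carrier S \<Longrightarrow> [Suc n] \<cdot> x = [n] \<cdot> x \<oplus> x"
  by (rule add.nat_pow_Suc)

lemma add_pow_1 [simp]: "x \<in> carrier S \<Longrightarrow> [Suc 0] \<cdot> x = x"
  using add_pow_Suc[of x 0] by simp

lemma add_pow_mono_left:
  assumes "x \<in> carrier S" "n \<le> m"
  shows "rle S ([(n::nat)] \<cdot> x) ([m] \<cdot> x)"
  using add.nat_pow_mult[of x n "m - n"] le_add[of "[n] \<cdot> x" "[(m - n)] \<cdot> x"] assms by simp

lemma add_pow_mono_right:
  "x \<in> carrier S \<Longrightarrow> y \<in> carrier S \<Longrightarrow> rle S x y \<Longrightarrow> rle S ([(n::nat)] \<cdot> x) ([n] \<cdot> y)"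
  by (induction n) (auto simp: add_pow_Suc le_refl intro!: add_mono2)

lemma add_pow_mult: "x \<in> carrier S \<Longrightarrow> [(n::nat)] \<cdot> ([(m::nat)] \<cdot> x) = [(n * m)] \<cdot> x"
  using add.nat_pow_pow[of x n m] by (metis mult.commute)

text \<open>
  Archimedean comparison.  It is the preorder whose classes are the fibres of \<^term>\<open>dim S\<close> and
  which induces \<^term>\<open>dim_order S\<close>; unlike these it mentions representatives only.
\<close>

definition dominated :: "'s \<Rightarrow> 's \<Rightarrow> bool" where
  "dominated a b \<longleftrightarrow> (\<exists>n::nat. rle S a ([n] \<cdot> b))"

lemma le_dominated: "a \<in> carrier S \<Longrightarrow> b \<in> carrier S \<Longrightarrow> rle S a b \<Longrightarrow> dominated a b"
  unfolding dominated_def by (intro exI[of _ 1]) simp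

lemma dominated_trans:
  assumes "dominated a b" "dominated b c" "a \<in> carrier S" "b \<in> carrier S" "c \<in> carrier S"
  shows "dominated a c"
proof -
  obtain n m :: nat where "rle S a ([n] \<cdot> b)" "rle S b ([m] \<cdot> c)"
    using assms by (auto simp: dominated_def)
  then have "rle S a ([(n * m)] \<cdot> c)"
    using add_pow_mono_right[of b "[m] \<cdot> c" n] le_trans[of a "[n] \<cdot> b" "[n] \<cdot> ([m] \<cdot> c)"] assms
    by (simp add: add_pow_mult)
  then show ?thesis by (auto simp: dominated_def)
qed

lemma arch_equiv_iff:
  assumes "a \<in> carrier S" "b \<in> carrier S"
  shows "arch_equiv S a b \<longleftrightarrow> dominated a b \<and> dominated b a"
proof
  assume "arch_equiv S a b"
  then show "dominated a b \<and> dominated b a"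
    using assms le_dominated by (auto simp: arch_equiv_def dominated_def)
next
  assume "dominated a b \<and> dominated b a"
  then obtain n m :: nat where nm: "rle S a ([n] \<cdot> b)" "rle S b ([m] \<cdot> a)"
    by (auto simp: dominated_def)
  define k where "k = Suc (max n m)"
  have "rle S a ([k] \<cdot> b)" "rle S b ([k] \<cdot> a)"
    using nm assms add_pow_mono_left[of b n k] add_pow_mono_left[of a m k]
      le_trans[of a "[n] \<cdot> b" "[k] \<cdot> b"] le_trans[of b "[m] \<cdot> a" "[k] \<cdot> a"] by (auto simp: k_def)
  moreover have "k > 0" by (simp add: k_def)
  ultimately show "arch_equiv S a b"
    using le_linear[of a b] assms unfolding arch_equiv_def by blast
qed

lemma dominated_refl: "a \<in> carrier S \<Longrightarrow> dominated a a"
  using le_dominated le_refl by blast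

lemma dim_eq_iff:
  assumes "a \<in> carrier S" "b \<in> carrier S"
  shows "dim S a = dim S b \<longleftrightarrow> dominated a b \<and> dominated b a"
proof
  assume "dim S a = dim S b"
  moreover have "b \<in> dim S b" using assms dominated_refl by (simp add: dim_def arch_equiv_iff)
  ultimately show "dominated a b \<and> dominated b a"
    unfolding dim_def using assms arch_equiv_iff by blast
next
  assume ab: "dominated a b \<and> dominated b a"
  then have "arch_equiv S a x \<longleftrightarrow> arch_equiv S b x" if "x \<in> carrier S" for x
    using that assms dominated_trans[of a b x] dominated_trans[of x a b]
      dominated_trans[of b a x] dominated_trans[of x b a] by (auto simp: arch_equiv_iff)
  then show "dim S a = dim S b" by (auto simp: dim_def)
qed

lemma dim_order_iff:
  assumes "a \<in> carrier S" "b \<in> carrier S"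
  shows "(dim S a, dim S b) \<in> dim_order S \<longleftrightarrow> dominated a b"
proof
  assume "(dim S a, dim S b) \<in> dim_order S"
  then obtain a' b' where *: "dim S a = dim S a'" "dim S b = dim S b'"
    "a' \<in> carrier S" "b' \<in> carrier S" "rle S a' b'" by (auto simp: dim_order_def)
  then have "dominated a a'" "dominated a' b'" "dominated b' b"
    using assms le_dominated by (simp_all add: dim_eq_iff)
  then show "dominated a b"
    using dominated_trans[of a a' b'] dominated_trans[of a b' b] * assms by blast
next
  assume d: "dominated a b"
  show "(dim S a, dim S b) \<in> dim_order S"
  proof (cases "rle S a b")
    case True
    then show ?thesis using assms by (auto simp: dim_order_def)
  next
    case False
    then have "dominated b a" using le_linear le_dominated assms by blast
    then have "dim S a = dim S b" using d dim_eq_iff assms by blast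
    then show ?thesis using assms le_refl by (auto simp: dim_order_def)
  qed
qed

lemma dominated_linear: "a \<in> carrier S \<Longrightarrow> b \<in> carrier S \<Longrightarrow> dominated a b \<or> dominated b a"
  using le_linear le_dominated by blast

lemma linear_dim_order:
  assumes "X \<subseteq> carrier S"
  shows "linear_order_on (dim S ` X) (Restr (dim_order S) (dim S ` X))"
proof -
  have 1: "refl_on (dim S ` X) (Restr (dim_order S) (dim S ` X))"
    using assms dim_order_iff dominated_refl by (auto simp: refl_on_def)
  have 2: "trans (Restr (dim_order S) (dim S ` X))"
  proof (rule transI)
    fix u v w assume "(u, v) \<in> Restr (dim_order S) (dim S ` X)" "(v, w) \<in> Restr (dim_order S) (dim S ` X)"
    moreover from this obtain a b c where "u = dim S a" "v = dim S b" "w = dim S c"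
      "a \<in> X" "b \<in> X" "c \<in> X" by auto
    moreover from this have "a \<in> carrier S" "b \<in> carrier S" "c \<in> carrier S" using assms by auto
    ultimately show "(u, w) \<in> Restr (dim_order S) (dim S ` X)"
      using dominated_trans[of a b c] dim_order_iff by auto
  qed
  have 3: "antisym (Restr (dim_order S) (dim S ` X))"
  proof (rule antisymI)
    fix u v assume "(u, v) \<in> Restr (dim_order S) (dim S ` X)" "(v, u) \<in> Restr (dim_order S) (dim S ` X)"
    moreover from this obtain a b where "u = dim S a" "v = dim S b" "a \<in> X" "b \<in> X" by auto
    moreover from this have "a \<in> carrier S" "b \<in> carrier S" using assms by auto
    ultimately show "u = v" using dim_eq_iff dim_order_iff by auto
  qed
  have 4: "total_on (dim S ` X) (Restr (dim_order S) (dim S ` X))"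
    using assms dim_order_iff dominated_linear by (auto simp: total_on_def subset_iff)
  show ?thesis using 1 2 3 4 by (auto simp: order_on_defs)
qed

end

context measuring_semiring
begin

text \<open>
  Positive multiples grow strictly.  This is the instance of the measuring axiom that rules out a nonzero
  element with \<^term>\<open>x \<oplus> x = x\<close>, and it underlies all arguments below that cannot cancel.
\<close>

lemma add_pow_less:
  assumes "x \<in> carrier S" "x \<noteq> \<zero>"
  shows "rlt S ([(n::nat)] \<cdot> x) ([Suc n] \<cdot> x)"
proof (induction n)
  case 0
  then show ?case using assms pos_iff[of x] by simp
next
  case (Suc n)
  have "dominated ([Suc n] \<cdot> x) x"
    unfolding dominated_def using assms by (intro exI[of _ "Suc n"]) (simp add: le_refl)
  moreover have "dominated x ([Suc n] \<cdot> x)"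
    using assms add_pow_mono_left[of x 1 "Suc n"] by (intro le_dominated) auto
  ultimately have "dim S ([Suc n] \<cdot> x) = dim S x" using assms by (simp add: dim_eq_iff)
  then have "rlt S ([n] \<cdot> x \<oplus> x) ([Suc n] \<cdot> x \<oplus> x)"
    using measuring[OF _ _ _ Suc, of x] assms by simp
  then show ?case using assms by (simp only: add_pow_Suc)
qed

lemma add_pow_less_iff:
  assumes "x \<in> carrier S" "x \<noteq> \<zero>"
  shows "rle S ([(n::nat)] \<cdot> x) ([(m::nat)] \<cdot> x) \<longleftrightarrow> n \<le> m"
proof
  show "n \<le> m \<Longrightarrow> rle S ([n] \<cdot> x) ([m] \<cdot> x)" using assms add_pow_mono_left by blast
  assume le: "rle S ([n] \<cdot> x) ([m] \<cdot> x)"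
  show "n \<le> m"
  proof (rule ccontr)
    assume "\<not> n \<le> m"
    then have "rle S ([Suc m] \<cdot> x) ([n] \<cdot> x)" using assms by (intro add_pow_mono_left) auto
    then have "rle S ([Suc m] \<cdot> x) ([m] \<cdot> x)"
      using le le_trans[of "[Suc m] \<cdot> x" "[n] \<cdot> x" "[m] \<cdot> x"] assms by simp
    then show False using add_pow_less[OF assms, of m] not_le[of "[Suc m] \<cdot> x" "[m] \<cdot> x"] assms by simp
  qed
qed

lemma add_pow_inject:
  assumes "x \<in> carrier S" "x \<noteq> \<zero>" "[(n::nat)] \<cdot> x = [(m::nat)] \<cdot> x"
  shows "n = m"
  using add_pow_less_iff[OF assms(1,2), of n m] add_pow_less_iff[OF assms(1,2), of m n] assms
    le_refl[of "[n] \<cdot> x"] by simp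

lemma idempotent_zero: "x \<in> carrier S \<Longrightarrow> x \<oplus> x = x \<Longrightarrow> x = \<zero>"
  using add_pow_inject[of x 1 2] add_pow_Suc[of x 1] by (auto simp: numeral_2_eq_2)

end

section \<open>Consequences of the measure axioms\<close>

locale measured_structure = definability L M + measuring_semiring S
  for S :: "'s ordered_ring" (structure) and L :: "('f, 'r) lang"
    and M :: "('f, 'r, 'm) struct" and h :: "'m list set \<Rightarrow> 's" +
  assumes is_structure: "is_structure L M" and is_measure: "is_measure L M S h"
begin

lemma measure_closed: "D n X \<Longrightarrow> h X \<in> carrier S"
  using is_measure DefI[of L M n X] by (auto simp: is_measure_def)

lemma measure_finite: "D n X \<Longrightarrow> finite X \<Longrightarrow> h X = [card X] \<cdot> \<one>"
  using is_measure DefI[of L M n X] by (simp add: is_measure_def)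

lemma measure_map:
  "definable_map L M X Y p \<Longrightarrow> f \<in> carrier S \<Longrightarrow> (\<And>a. a \<in> Y \<Longrightarrow> h {x \<in> X. p x = a} = f) \<Longrightarrow>
    h X = f \<otimes> h Y"
proof -
  have "\<forall>X Y p. \<forall>f \<in> carrier S.
      definable_map L M X Y p \<and> (\<forall>a \<in> Y. h {x \<in> X. p x = a} = f) \<longrightarrow> h X = f \<otimes> h Y"
    using is_measure unfolding is_measure_def by (elim conjE)
  then show "definable_map L M X Y p \<Longrightarrow> f \<in> carrier S \<Longrightarrow>
      (\<And>a. a \<in> Y \<Longrightarrow> h {x \<in> X. p x = a} = f) \<Longrightarrow> h X = f \<otimes> h Y" by blast
qed

lemma measure_family:
  assumes "part_fm L n m \<phi>"
  shows "finite ((\<lambda>b. h (sols M n \<phi> b)) ` T m)"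
    "f \<in> (\<lambda>b. h (sols M n \<phi> b)) ` T m \<Longrightarrow>
      definable_over L M {} m {b \<in> T m. h (sols M n \<phi> b) = f}"
  using is_measure assms unfolding is_measure_def Let_def by blast+

lemma measure_empty: "h {} = \<zero>"
  using measure_finite[OF definable_empty] by simp

lemma measure_Un:
  assumes "D n X" "D n Y" "X \<inter> Y = {}"
  shows "h (X \<union> Y) = h X \<oplus> h Y"
proof -
  have "\<forall>X \<in> Def L M. \<forall>Y \<in> Def L M. X \<union> Y \<in> Def L M \<and> X \<inter> Y = {} \<longrightarrow> h (X \<union> Y) = h X \<oplus> h Y"
    using is_measure unfolding is_measure_def by (elim conjE)
  then show ?thesis using assms D_Un[OF assms(1,2)] DefI by blast
qed

lemma measure_split:
  assumes "D n X" "D n Y"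
  shows "h X = h (X \<inter> Y) \<oplus> h (X - Y)"
proof -
  have "X \<inter> Y \<union> (X - Y) = X" by blast
  then show ?thesis
    using measure_Un[OF D_Int[OF assms] D_Diff[OF assms]] by auto
qed

lemma measure_mono: "D n X \<Longrightarrow> D n Y \<Longrightarrow> X \<subseteq> Y \<Longrightarrow> rle S (h X) (h Y)"
  using measure_split[of n Y X] le_add[of "h X" "h (Y - X)"] measure_closed[of n X]
    measure_closed[OF D_Diff, of n Y X] by (simp add: Int_absorb1)

text \<open>A nonempty set contains a singleton, whose measure is one.\<close>

lemma measure_pos:
  assumes "D n X" "X \<noteq> {}"
  shows "h X \<noteq> \<zero>"
proof
  assume 0: "h X = \<zero>"
  obtain a where a: "a \<in> X" using assms by blast
  then have Da: "D n {a}" using D_singleton D_arity assms by blast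
  then have "rle S \<one> \<zero>"
    using measure_mono[OF Da assms(1)] measure_finite[OF Da] a 0 by simp
  then show False
    using le_antisym[of \<one> \<zero>] zero_least[of \<one>] zero_neq_one by simp
qed

text \<open>
  When a set is cut into two parts, the part of larger measure has the dimension of the whole set.
\<close>

lemma cover_dominated:
  assumes "finite I" "\<And>i. i \<in> I \<Longrightarrow> D n (Y i)" "D n X" "X \<subseteq> (\<Union>i \<in> I. Y i)" "X \<noteq> {}"
  shows "\<exists>i \<in> I. dominated (h X) (h (X \<inter> Y i))"
  using assms
proof (induction I arbitrary: X rule: finite_induct)
  case (insert i I)
  let ?A = "X \<inter> Y i" and ?B = "X - Y i"
  have DA: "D n ?A" "D n ?B" using insert.prems by (auto intro: D_Int D_Diff)
  then have cl: "h ?A \<in> carrier S" "h ?B \<in> carrier S" by (auto intro: measure_closed)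
  have X: "h X = h ?A \<oplus> h ?B" using insert.prems by (intro measure_split) auto
  have X2: "dominated (h X) z" if "rle S (h ?A) z" "rle S (h ?B) z" "z \<in> carrier S" for z
    unfolding dominated_def X using that cl add_mono2[of "h ?A" z "h ?B" z]
    by (intro exI[of _ 2]) (simp add: numeral_2_eq_2 add_pow_Suc)
  show ?case
  proof (cases "rle S (h ?B) (h ?A)")
    case True
    then show ?thesis using X2[of "h ?A"] cl le_refl by blast
  next
    case False
    then have AB: "rle S (h ?A) (h ?B)" using le_linear cl by blast
    have "?B \<noteq> {}" using False measure_empty zero_least cl by metis
    then obtain j where j: "j \<in> I" "dominated (h ?B) (h (?B \<inter> Y j))"
      using insert.IH[of ?B] insert.prems DA by blast
    have D: "D n (X \<inter> Y j)" "D n (?B \<inter> Y j)" using j insert.prems DA by (auto intro: D_Int)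
    have "dominated (h X) (h ?B)" using X2[of "h ?B"] AB cl le_refl by blast
    moreover have "dominated (h (?B \<inter> Y j)) (h (X \<inter> Y j))"
      using D by (intro le_dominated measure_closed measure_mono) auto
    ultimately have "dominated (h X) (h (X \<inter> Y j))"
      using j dominated_trans cl D insert.prems by (meson measure_closed)
    then show ?thesis using j by blast
  qed
qed simp

text \<open>
  Double counting by induction on the number of sets: \<^term>\<open>H\<close> is split along the last set,
  inside which the remaining sets cover every point at most \<^term>\<open>k - 1\<close> times.
\<close>

lemma measure_double_count:
  assumes "D n H" "\<And>i. i < N \<Longrightarrow> D n (X i)" "\<And>i. i < N \<Longrightarrow> X i \<subseteq> H"
    "\<And>x. x \<in> H \<Longrightarrow> card {i. i < N \<and> x \<in> X i} \<le> k"
  shows "rle S (\<Oplus>i\<in>{..<N::nat}. h (X i)) ([(k::nat)] \<cdot> h H)"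
  using assms
proof (induction N arbitrary: H X k)
  case 0
  then show ?case using measure_closed[OF 0(1)] zero_least by simp
next
  case (Suc N)
  let ?Z = "X N"
  have DZ: "D n ?Z" "?Z \<subseteq> H" and DX: "\<And>i. i < N \<Longrightarrow> D n (X i)" "\<And>i. i < N \<Longrightarrow> X i \<subseteq> H"
    using Suc.prems by auto
  have D1: "\<And>i. i < N \<Longrightarrow> D n (X i \<inter> ?Z)" "\<And>i. i < N \<Longrightarrow> D n (X i - ?Z)" "D n (H - ?Z)"
    using DZ DX Suc.prems by (auto intro: D_Int D_Diff)
  note cl = measure_closed
  have fin: "finite {i. i < N \<and> P i}" for P by simp
  have sum: "(\<Oplus>i\<in>{..<N}. h (X i)) = (\<Oplus>i\<in>{..<N}. h (X i \<inter> ?Z)) \<oplus> (\<Oplus>i\<in>{..<N}. h (X i - ?Z))"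
  proof -
    have "(\<Oplus>i\<in>{..<N}. h (X i)) = (\<Oplus>i\<in>{..<N}. h (X i \<inter> ?Z) \<oplus> h (X i - ?Z))"
      using measure_split[OF DX(1) DZ(1)] cl[OF D1(1)] cl[OF D1(2)] by (intro finsum_cong') auto
    also have "\<dots> = (\<Oplus>i\<in>{..<N}. h (X i \<inter> ?Z)) \<oplus> (\<Oplus>i\<in>{..<N}. h (X i - ?Z))"
      using cl[OF D1(1)] cl[OF D1(2)] by (intro finsum_addf) auto
    finally show ?thesis .
  qed
  have B: "rle S (\<Oplus>i\<in>{..<N}. h (X i - ?Z)) ([k] \<cdot> h (H - ?Z))"
  proof (rule Suc.IH)
    fix x assume "x \<in> H - ?Z"
    then have "card {i. i < Suc N \<and> x \<in> X i} \<le> k" using Suc.prems(4) by blast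
    moreover have "{i. i < N \<and> x \<in> X i - ?Z} \<subseteq> {i. i < Suc N \<and> x \<in> X i}" by auto
    ultimately show "card {i. i < N \<and> x \<in> X i - ?Z} \<le> k"
      using card_mono[of "{i. i < Suc N \<and> x \<in> X i}" "{i. i < N \<and> x \<in> X i - ?Z}"] by simp
  qed (use D1 DX(2) in blast)+
  (* One of the k copies of the last set pays for the set itself. *)
  have A: "rle S ((\<Oplus>i\<in>{..<N}. h (X i \<inter> ?Z)) \<oplus> h ?Z) ([k] \<cdot> h ?Z)"
  proof (cases "?Z = {}")
    case True
    then have "(\<Oplus>i\<in>{..<N}. h (X i \<inter> ?Z)) = \<zero>" by (simp add: measure_empty)
    then show ?thesis using True cl[OF DZ(1)] zero_least by (simp add: measure_empty)
  next
    case False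
    have step: "card {i. i < N \<and> x \<in> X i \<inter> ?Z} < k" if "x \<in> ?Z" for x
    proof -
      have "{i. i < Suc N \<and> x \<in> X i} = insert N {i. i < N \<and> x \<in> X i \<inter> ?Z}"
        using that by (auto simp: less_Suc_eq)
      then have "card {i. i < Suc N \<and> x \<in> X i} = Suc (card {i. i < N \<and> x \<in> X i \<inter> ?Z})" by simp
      then show ?thesis using Suc.prems(4)[of x] that DZ by auto
    qed
    then obtain k' where k: "k = Suc k'" using False by (cases k) auto
    have "rle S (\<Oplus>i\<in>{..<N}. h (X i \<inter> ?Z)) ([k'] \<cdot> h ?Z)"
      using DZ D1 step k by (intro Suc.IH) (auto simp: less_Suc_eq_le)
    moreover have "(\<Oplus>i\<in>{..<N}. h (X i \<inter> ?Z)) \<in> carrier S"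
      using cl[OF D1(1)] by (intro finsum_closed) auto
    ultimately show ?thesis
      unfolding k using cl[OF DZ(1)] by (simp add: add_pow_Suc add_mono)
  qed
  have c: "(\<Oplus>i\<in>{..<N}. h (X i \<inter> ?Z)) \<in> carrier S" "(\<Oplus>i\<in>{..<N}. h (X i - ?Z)) \<in> carrier S"
    "h ?Z \<in> carrier S" "h (H - ?Z) \<in> carrier S" "(\<Oplus>i\<in>{..<N}. h (X i)) \<in> carrier S"
    using cl[OF D1(1)] cl[OF D1(2)] cl[OF DZ(1)] cl[OF D1(3)] cl[OF DX(1)]
    by (auto intro!: finsum_closed)
  have "(\<Oplus>i\<in>{..<Suc N}. h (X i)) = (\<Oplus>i\<in>{..<N}. h (X i)) \<oplus> h ?Z"
    using c cl[OF DX(1)] unfolding lessThan_Suc by (subst finsum_insert) (auto simp: a_comm Pi_def)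
  also have "\<dots> = ((\<Oplus>i\<in>{..<N}. h (X i \<inter> ?Z)) \<oplus> h ?Z) \<oplus> (\<Oplus>i\<in>{..<N}. h (X i - ?Z))"
    unfolding sum using c by (simp add: a_ac)
  finally have "rle S (\<Oplus>i\<in>{..<Suc N}. h (X i)) ([k] \<cdot> h ?Z \<oplus> [k] \<cdot> h (H - ?Z))"
    using add_mono2[OF A B] c by simp
  moreover have "h H = h ?Z \<oplus> h (H - ?Z)"
    using measure_split[OF Suc.prems(1) DZ(1)] DZ(2) by (simp add: Int_absorb1)
  ultimately show ?case using c by (simp add: add.nat_pow_distrib)
qed

text \<open>
  If \<^term>\<open>h H\<close> is at most \<^term>\<open>m\<close> times \<^term>\<open>e\<close>, then \<^term>\<open>N\<close> of the sets have total measure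
  \<^term>\<open>N\<close> times \<^term>\<open>e\<close> and, by double counting, at most \<^term>\<open>k * m\<close> times \<^term>\<open>e\<close>.  This fails
  for \<^term>\<open>N\<close> greater than \<^term>\<open>k * m\<close>.
\<close>

lemma no_sparse_family:
  assumes "D n H" "\<And>i::nat. D n (X i)" "\<And>i. X i \<subseteq> H" "\<And>i. h (X i) = e"
    "dominated (h H) e" "e \<noteq> \<zero>" "\<And>w x. finite w \<Longrightarrow> card w = k \<Longrightarrow> \<not> (\<forall>i \<in> w. x \<in> X i)"
  shows False
proof -
  have e: "e \<in> carrier S" and H: "h H \<in> carrier S"
    using measure_closed[OF assms(1)] measure_closed[OF assms(2)[of 0]] assms(4)[of 0] by simp_all
  obtain m :: nat where m: "rle S (h H) ([m] \<cdot> e)" using assms(5) by (auto simp: dominated_def)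
  define N where "N = Suc (k * m)"
  have "card {i. i < N \<and> x \<in> X i} \<le> k" for x
  proof (rule ccontr)
    assume "\<not> ?thesis"
    then obtain w where "w \<subseteq> {i. i < N \<and> x \<in> X i}" "card w = k" "finite w"
      by (meson linorder_not_le less_imp_le obtain_subset_with_card_n)
    then show False using assms(7)[of w x] by blast
  qed
  then have "rle S (\<Oplus>i\<in>{..<N}. h (X i)) ([k] \<cdot> h H)"
    using assms by (intro measure_double_count) auto
  moreover have "(\<Oplus>i\<in>{..<N}. h (X i)) = [N] \<cdot> e"
    using add.finprod_const[OF e, of "{..<N}"] by (simp add: assms(4))
  moreover have "rle S ([k] \<cdot> h H) ([(k * m)] \<cdot> e)"
    using add_pow_mono_right[OF H _ m, of k] e by (simp add: add_pow_mult)
  ultimately have "rle S ([N] \<cdot> e) ([(k * m)] \<cdot> e)"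
    using le_trans[of "[N] \<cdot> e" "[k] \<cdot> h H" "[(k * m)] \<cdot> e"] e H by simp
  then show False using add_pow_less_iff[OF e assms(6), of N "k * m"] by (simp add: N_def del: add.nat_pow_Suc)
qed

text \<open>
  The fibres of a definable set over the points of a coordinate space form a definable family: the
  coordinates of the point become parameters.
\<close>

lemma measure_fibres:
  assumes "D (n + m) G"
  shows "finite ((\<lambda>y. h {x \<in> T n. x @ y \<in> G}) ` T m)"
    and "dp' m (\<lambda>y. h {x \<in> T n. x @ y \<in> G} = f)"
proof -
  obtain k \<phi> c where \<phi>: "part_fm L (n + m) k \<phi>" and c: "c \<in> T k" and G: "G = sols M (n + m) \<phi> c"
    using assms by (auto simp: definable_over_def)
  have \<phi>': "part_fm L n (m + k) \<phi>" using \<phi> by (simp add: part_fm_iff add.assoc)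
  have eq: "sols M n \<phi> (y @ c) = {x \<in> T n. x @ y \<in> G}" if "y \<in> T m" for y
    using that by (auto simp: G sols_iff tuples_append)
  have "(\<lambda>y. h {x \<in> T n. x @ y \<in> G}) ` T m \<subseteq> (\<lambda>b. h (sols M n \<phi> b)) ` T (m + k)"
  proof
    fix v assume "v \<in> (\<lambda>y. h {x \<in> T n. x @ y \<in> G}) ` T m"
    then obtain y where "y \<in> T m" "v = h (sols M n \<phi> (y @ c))" using eq by auto
    then show "v \<in> (\<lambda>b. h (sols M n \<phi> b)) ` T (m + k)" using tuples_append[OF _ c] by blast
  qed
  then show "finite ((\<lambda>y. h {x \<in> T n. x @ y \<in> G}) ` T m)"
    using measure_family(1)[OF \<phi>'] finite_subset by blast
  have "dp L M {} (m + k) (\<lambda>b. h (sols M n \<phi> b) = f)"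
  proof (cases "f \<in> (\<lambda>b. h (sols M n \<phi> b)) ` T (m + k)")
    case True
    then show ?thesis using measure_family(2)[OF \<phi>'] by (simp add: dp_def)
  next
    case False
    then show ?thesis by (intro dp_cong[OF dp_False]) auto
  qed
  then have "dp' m (\<lambda>y. h (sols M n \<phi> (y @ c)) = f)"
    by (intro dp_section[OF dp_mono c]) auto
  then show "dp' m (\<lambda>y. h {x \<in> T n. x @ y \<in> G} = f)"
    by (rule dp_cong) (simp add: eq)
qed

text \<open>
  The axiom on fibres of constant measure implies the inequality for fibres of measure at least
  \<^term>\<open>e\<close>, because fibres take finitely many measures and so cut the map into finitely many pieces
  with constant measure on the fibres.
\<close>

lemma measure_fibres_ge:
  assumes "D n X" "D m Y" "D (n + m) {a @ p a | a. a \<in> X}" "p \<in> X \<rightarrow> Y" "e \<in> carrier S"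
    "\<And>y. y \<in> Y \<Longrightarrow> rle S e (h {x \<in> X. p x = y})"
  shows "rle S (e \<otimes> h Y) (h X)"
proof -
  let ?G = "{a @ p a | a. a \<in> X}"
  define v where "v = (\<lambda>y. h {x \<in> X. p x = y})"
  have v: "h {x \<in> T n. x @ y \<in> ?G} = v y" for y
    using fibre_eq[OF assms(1), of ?G p] by (simp add: v_def)
  have dpv: "dp' m (\<lambda>y. v y = f)" for f
    using measure_fibres(2)[OF assms(3)] unfolding v .
  have fin: "finite (v ` T m)" using measure_fibres(1)[OF assms(3)] unfolding v .
  have "rle S (e \<otimes> h {y \<in> Y. v y \<in> F}) (h {x \<in> X. v (p x) \<in> F})" if "finite F" for F
    using that
  proof (induction rule: finite_induct)
    case empty
    then show ?case using assms(5) le_refl by (simp add: measure_empty)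
  next
    case (insert f F)
    have dpF: "dp' m (\<lambda>y. v y \<in> F)"
      by (rule dp_cong[OF dp_finite_disj[OF insert.hyps(1) dpv]]) auto
    let ?Y1 = "{y \<in> Y. v y = f}" and ?Y2 = "{y \<in> Y. v y \<in> F}"
      and ?X1 = "{x \<in> X. v (p x) = f}" and ?X2 = "{x \<in> X. v (p x) \<in> F}"
    have D: "D m ?Y1" "D m ?Y2" "D n ?X1" "D n ?X2"
      using D_Collect[OF assms(2) dpv] D_Collect[OF assms(2) dpF]
        D_preimage[OF assms(1-4) dpv] D_preimage[OF assms(1-4) dpF] by auto
    note cl = D[THEN measure_closed]
    have Y: "{y \<in> Y. v y \<in> insert f F} = ?Y1 \<union> ?Y2" and X: "{x \<in> X. v (p x) \<in> insert f F} = ?X1 \<union> ?X2"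
      by auto
    have "h (?Y1 \<union> ?Y2) = h ?Y1 \<oplus> h ?Y2" "h (?X1 \<union> ?X2) = h ?X1 \<oplus> h ?X2"
      using insert.hyps(2) by (intro measure_Un[OF D(1,2)] measure_Un[OF D(3,4)]; auto)+
    moreover have "rle S (e \<otimes> h ?Y1) (h ?X1)"
    proof (cases "?Y1 = {}")
      case True
      then have "e \<otimes> h ?Y1 = \<zero>" using assms(5) by (simp only: measure_empty r_null)
      then show ?thesis using zero_least cl by simp
    next
      case False
      then obtain y where y: "y \<in> Y" "v y = f" by blast
      have "D n {x \<in> X. p x = y}"
        using D_preimage[OF assms(1-4), of "\<lambda>z. z = y"] y
          definable_over_dp(2)[OF D_singleton[OF D_arity[OF assms(2)]], of y] by simp
      then have f: "f \<in> carrier S" using y measure_closed by (auto simp: v_def)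
      have ef: "rle S e f" using assms(6) y by (auto simp: v_def)
      have "h ?X1 = f \<otimes> h ?Y1"
      proof (rule measure_map[OF definable_map_restrict[OF assms(1-4) dpv] f])
        fix a assume a: "a \<in> ?Y1"
        then have "{x \<in> ?X1. p x = a} = {x \<in> X. p x = a}" by auto
        then show "h {x \<in> ?X1. p x = a} = f" using a by (simp add: v_def)
      qed
      then show ?thesis using mult_mono[OF assms(5) f cl(1) ef] by simp
    qed
    ultimately show ?case
      unfolding Y X using add_mono2[OF _ insert.IH] cl assms(5) by (simp add: r_distr)
  qed
  from this[OF fin] have "rle S (e \<otimes> h {y \<in> Y. v y \<in> v ` T m}) (h {x \<in> X. v (p x) \<in> v ` T m})" .
  moreover have "{y \<in> Y. v y \<in> v ` T m} = Y" "{x \<in> X. v (p x) \<in> v ` T m} = X"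
    using D_arity[OF assms(2)] assms(4) by auto
  ultimately show ?thesis by simp
qed

end

text \<open>A finite set is a disjoint union of singletons, so its measure follows from additivity.\<close>

lemma (in definability) measure_of_finite:
  fixes S :: "('s, 'z) ordered_ring_scheme" (structure)
  assumes S: "measuring_semiring S"
    and add: "\<And>n X Y. D n X \<Longrightarrow> D n Y \<Longrightarrow> X \<inter> Y = {} \<Longrightarrow> h (X \<union> Y) = h X \<oplus> h Y"
    and empty: "h {} \<in> carrier S" and singleton: "\<And>n a. a \<in> T n \<Longrightarrow> h {a} = \<one>"
    and X: "D n X" "finite X"
  shows "h X = [card X] \<cdot> \<one>"
proof -
  interpret measuring_semiring S by fact
  have "A \<subseteq> X \<Longrightarrow> D n A \<and> h A = [card A] \<cdot> \<one>" if "finite A" for A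
    using that
  proof (induction rule: finite_induct)
    case empty
    have "h {} = h {} \<oplus> h {}" using add[OF definable_empty definable_empty] by simp
    then have "h {} = \<zero>" using idempotent_zero[of "h {}"] assms(3) by simp
    then show ?case using definable_empty by simp
  next
    case (insert a A)
    then have a: "a \<in> T n" using D_arity[OF X(1)] by auto
    have A: "D n A" using insert by simp
    have "D n ({a} \<union> A)" "h ({a} \<union> A) = h {a} \<oplus> h A"
      using insert(2) D_Un[OF D_singleton[OF a] A] add[OF D_singleton[OF a] A] by simp_all
    then show ?case using insert singleton[OF a] by (simp add: add_pow_Suc a_comm)
  qed
  then show ?thesis using X(2) by blast
qed

lemma (in definability) is_measureI:
  fixes S :: "'s ordered_ring" (structure)
  assumes S: "measuring_semiring S"
    and closed: "\<And>n X. D n X \<Longrightarrow> h X \<in> carrier S"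
    and Un: "\<And>n X Y. D n X \<Longrightarrow> D n Y \<Longrightarrow> X \<inter> Y = {} \<Longrightarrow> h (X \<union> Y) = h X \<oplus> h Y"
    and singleton: "\<And>n a. a \<in> T n \<Longrightarrow> h {a} = \<one>"
    and finite_values: "\<And>n m \<phi>. part_fm L n m \<phi> \<Longrightarrow> finite ((\<lambda>b. h (sols M n \<phi> b)) ` T m)"
    and definable_values: "\<And>n m \<phi> f. part_fm L n m \<phi> \<Longrightarrow> dp L M {} m (\<lambda>b. h (sols M n \<phi> b) = f)"
    and map: "\<And>X Y p f. definable_map L M X Y p \<Longrightarrow> f \<in> carrier S \<Longrightarrow>
      (\<And>a. a \<in> Y \<Longrightarrow> h {x \<in> X. p x = a} = f) \<Longrightarrow> h X = f \<otimes> h Y"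
  shows "is_measure L M S h"
  unfolding is_measure_def
proof (intro conjI)
  show "h \<in> Def L M \<rightarrow> carrier S" using closed by (auto simp: Def_iff)
  show "\<forall>X \<in> Def L M. finite X \<longrightarrow> h X = [card X] \<cdot> \<one>"
    using measure_of_finite[OF S Un closed[OF definable_empty] singleton] by (auto simp: Def_iff)
  show "\<forall>X \<in> Def L M. \<forall>Y \<in> Def L M. X \<union> Y \<in> Def L M \<and> X \<inter> Y = {} \<longrightarrow> h (X \<union> Y) = h X \<oplus> h Y"
  proof (intro ballI impI, elim conjE)
    fix X Y assume "X \<union> Y \<in> Def L M" and XY: "X \<inter> Y = {}" and "X \<in> Def L M" "Y \<in> Def L M"
    then obtain n m l where DXY: "D n X" "D m Y" "D l (X \<union> Y)" by (auto simp: Def_iff)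
    have emp: "D j {}" for j by (rule definable_empty)
    have "\<exists>j. D j X \<and> D j Y"
    proof (cases "X = {} \<or> Y = {}")
      case True
      then show ?thesis using DXY emp by blast
    next
      case False
      then have "n = l" "m = l"
        using D_length[OF DXY(1)] D_length[OF DXY(2)] D_length[OF DXY(3)] by blast+
      then show ?thesis using DXY by blast
    qed
    then show "h (X \<union> Y) = h X \<oplus> h Y" using Un XY by blast
  qed
  show "\<forall>n m \<phi>. part_fm L n m \<phi> \<longrightarrow> (let F = (\<lambda>b. h (sols M n \<phi> b)) ` T m in finite F \<and>
      (\<forall>f \<in> F. definable_over L M {} m {b \<in> T m. h (sols M n \<phi> b) = f}))"
    unfolding Let_def using finite_values definable_values[unfolded dp_def] by blast
  show "\<forall>X Y p. \<forall>f \<in> carrier S. definable_map L M X Y p \<and> (\<forall>a \<in> Y. h {x \<in> X. p x = a} = f) \<longrightarrow> h X = f \<otimes> h Y"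
    using map by blast
qed

section \<open>Orders, unimodularity and self-maps\<close>

context measured_structure
begin

lemma functionally_unimodular: "functionally_unimodular_structure L M"
  unfolding functionally_unimodular_structure_def
proof (intro allI impI, elim conjE)
  fix A B f1 f2 and k1 k2 :: nat
  assume f: "definable_map L M A B f1" "definable_map L M A B f2" and B: "B \<noteq> {}"
    and k1: "\<forall>b \<in> B. finite {a \<in> A. f1 a = b} \<and> card {a \<in> A. f1 a = b} = k1"
    and k2: "\<forall>b \<in> B. finite {a \<in> A. f2 a = b} \<and> card {a \<in> A. f2 a = b} = k2"
  have *: "h A = [k] \<cdot> h B" if f: "definable_map L M A B f"
    and k: "\<forall>b \<in> B. finite {a \<in> A. f a = b} \<and> card {a \<in> A. f a = b} = k" for f and k :: nat
  proof -
    obtain n m where D: "D n A" "D m B" "D (n + m) {a @ f a | a. a \<in> A}" "f \<in> A \<rightarrow> B"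
      using definable_mapE[OF f] .
    have "h A = ([k] \<cdot> \<one>) \<otimes> h B"
    proof (rule measure_map[OF f])
      fix b assume b: "b \<in> B"
      have "dp' m (\<lambda>y. y = b)"
        using definable_over_dp(2)[OF D_singleton[OF D_arity[OF D(2) b]]] by simp
      then have "D n {a \<in> A. f a = b}" using D_preimage[OF D] by blast
      then show "h {a \<in> A. f a = b} = [k] \<cdot> \<one>" using measure_finite k b by simp
    qed simp
    then show ?thesis using measure_closed[OF D(2)] by (simp add: add_pow_ldistr)
  qed
  obtain m where "D m B" using f(1) by (auto simp: definable_map_def Def_iff)
  then show "k1 = k2"
    using *[OF f(1) k1] *[OF f(2) k2] add_pow_inject[of "h B" k1 k2] measure_closed measure_pos B
    by auto
qed

text \<open>
  In a chain of definable sets from one family, Ramsey's theorem yields three sets whose pairwise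
  differences have the same measure \<^term>\<open>c\<close>; additivity makes \<^term>\<open>c\<close> idempotent, so
  \<^term>\<open>c\<close> is zero and the sets coincide.
\<close>

lemma no_infinite_chain:
  assumes po: "interpretable_partial_order L M P lq" and K: "K \<subseteq> P" "infinite K"
    and chain: "\<forall>u \<in> K. \<forall>v \<in> K. (u, v) \<in> lq \<or> (v, u) \<in> lq"
  shows False
proof -
  obtain X E where X: "X \<in> Def L M" "equiv X E" "P = X // E" "partial_order_on P lq"
    and le: "{a @ b | a b. a \<in> X \<and> b \<in> X \<and> (E `` {a}, E `` {b}) \<in> lq} \<in> Def L M"
    using po unfolding interpretable_partial_order_def by blast
  define W where "W = {a @ b | a b. a \<in> X \<and> b \<in> X \<and> (E `` {a}, E `` {b}) \<in> lq}"
  obtain n where n: "D n X" using X by (auto simp: Def_iff)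
  have trans: "(u, w) \<in> lq" if "(u, v) \<in> lq" "(v, w) \<in> lq" for u v w
    using that X(4) by (auto simp: order_on_defs dest: transD)
  have antisym: "u = v" if "(u, v) \<in> lq" "(v, u) \<in> lq" for u v
    using that X(4) by (auto simp: order_on_defs dest: antisymD)
  have lq_refl: "(u, u) \<in> lq" if "u \<in> K" for u using chain that by blast
  obtain r where r: "\<And>u. u \<in> K \<Longrightarrow> r u \<in> X \<and> E `` {r u} = u"
  proof -
    have "\<forall>u \<in> K. \<exists>x. x \<in> X \<and> E `` {x} = u" using K(1) X(3) by (auto simp: quotient_def)
    from bchoice[OF this] that show ?thesis by blast
  qed
  have W_mem: "x @ y \<in> W \<longleftrightarrow> x \<in> X \<and> y \<in> X \<and> (E `` {x}, E `` {y}) \<in> lq"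
    if "x \<in> T n" "y \<in> T n" for x y
  proof
    assume "x @ y \<in> W"
    then obtain a b where ab: "a \<in> X" "b \<in> X" "(E `` {a}, E `` {b}) \<in> lq" "x @ y = a @ b"
      by (auto simp: W_def)
    moreover have "length x = length a" using that ab D_length[OF n] by (simp add: tuples_iff)
    ultimately show "x \<in> X \<and> y \<in> X \<and> (E `` {x}, E `` {y}) \<in> lq" by simp
  qed (auto simp: W_def)
  obtain u0 where "u0 \<in> K" using K(2) by fastforce
  then have "r u0 @ r u0 \<in> W" using r[of u0] lq_refl[of u0] unfolding W_def by force
  moreover obtain j where j: "D j W" using le by (auto simp: Def_iff W_def)
  ultimately have "j = n + n" using D_length[OF j] D_length[OF n] r[OF \<open>u0 \<in> K\<close>] by fastforce
  then have DW: "D (n + n) W" using j by simp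
  define I where "I b = {x \<in> X. (E `` {x}, E `` {b}) \<in> lq}" for b
  (* Tuples x @ a @ b with x below b but not below a: the fibres of G are the differences of the
     initial segments I b and I a. *)
  define G where "G = {z \<in> T (n + (n + n)).
    map ((!) z) ([0..<n] @ [n + n..<n + n + n]) \<in> W \<and> \<not> map ((!) z) ([0..<n] @ [n..<n + n]) \<in> W}"
  have DG: "D (n + (n + n)) G"
    unfolding G_def dp_def[symmetric]
    by (intro dp_conj dp_not dp_coords[OF definable_over_dp(2)[OF DW]]) auto
  have fibre: "{x \<in> T n. x @ (a @ b) \<in> G} = I b - I a" if "a \<in> X" "b \<in> X" for a b
  proof -
    have ab: "a \<in> T n" "b \<in> T n" using that D_arity[OF n] by auto
    have "x @ (a @ b) \<in> G \<longleftrightarrow> x \<in> I b - I a" if x: "x \<in> T n" for x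
    proof -
      have l: "length x = n" "length a = n" "length b = n" using x ab by (auto simp: tuples_iff)
      have "map ((!) (x @ a @ b)) ([0..<n] @ [n + n..<n + n + n]) = x @ b"
        "map ((!) (x @ a @ b)) ([0..<n] @ [n..<n + n]) = x @ a"
        using l map_nth_append(2)[of "x @ a" "n + n" b] map_nth_append_mid[of x n a "n + n" b] by auto
      then show ?thesis
        using x ab W_mem[OF x ab(1)] W_mem[OF x ab(2)] \<open>a \<in> X\<close> \<open>b \<in> X\<close> tuples_append[OF x tuples_append[OF ab]]
        by (auto simp: G_def I_def)
    qed
    then show ?thesis using D_arity[OF n] by (auto simp: I_def)
  qed
  define F where "F = (\<lambda>y. h {x \<in> T n. x @ y \<in> G}) ` T (n + n)"
  have finF: "finite F" using measure_fibres(1)[OF DG] by (simp add: F_def)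
  have IF: "h (I b - I a) \<in> F" if "a \<in> X" "b \<in> X" for a b
  proof -
    have "a @ b \<in> T (n + n)" using that D_arity[OF n] by (blast intro: tuples_append)
    then show ?thesis unfolding F_def fibre[OF that, symmetric] by (rule image_eqI[OF refl])
  qed
  have DI: "D n (I b)" if "b \<in> X" for b
  proof (rule dp_definable_over)
    have b: "b \<in> T n" using that D_arity[OF n] by auto
    show "dp' n (\<lambda>x. x @ b \<in> W)" by (rule dp_section[OF definable_over_dp(2)[OF DW] b]) simp
    show "x \<in> I b \<longleftrightarrow> x \<in> T n \<and> x @ b \<in> W" for x
      using W_mem[of x b] D_arity[OF n] that b by (auto simp: I_def)
  qed
  (* Ramsey's theorem wants finitely many numbers as colours, attached to unordered pairs. *)
  obtain g :: "'s \<Rightarrow> nat" where g: "inj_on g F" "g ` F = {..<card F}"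
    using ex_bij_betw_finite_nat[OF finF] by (auto simp: bij_betw_def atLeast0LessThan)
  define lt where "lt u v \<longleftrightarrow> (u, v) \<in> lq \<and> u \<noteq> v" for u v
  define col where "col Z = g (SOME c. \<exists>u v. Z = {u, v} \<and> lt u v \<and> c = h (I (r v) - I (r u)))" for Z
  have col: "col {u, v} = g (h (I (r v) - I (r u)))" if "lt u v" for u v
  proof -
    have "(\<exists>u' v'. {u, v} = {u', v'} \<and> lt u' v' \<and> c = h (I (r v') - I (r u'))) \<longleftrightarrow>
      c = h (I (r v) - I (r u))" for c
      using that antisym unfolding lt_def doubleton_eq_iff by blast
    then show ?thesis by (simp add: col_def)
  qed
  have "\<forall>u \<in> K. \<forall>v \<in> K. u \<noteq> v \<longrightarrow> col {u, v} < card F"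
  proof (intro ballI impI)
    fix u v assume uv: "u \<in> K" "v \<in> K" "u \<noteq> v"
    have *: "col {u, v} < card F" if "lt u v" "u \<in> K" "v \<in> K" for u v
      using col[OF that(1)] IF r that g(2) by (metis imageI lessThan_iff)
    show "col {u, v} < card F"
      using chain uv *[of u v] *[of v u] by (auto simp: lt_def insert_commute)
  qed
  from Ramsey2[OF K(2) this] obtain Y t where Y: "Y \<subseteq> K" "infinite Y"
    and t: "\<forall>u \<in> Y. \<forall>v \<in> Y. u \<noteq> v \<longrightarrow> col {u, v} = t" by blast
  obtain Z where "Z \<subseteq> Y" "card Z = 3" "finite Z"
    using infinite_arbitrarily_large[OF Y(2)] by blast
  then obtain u1 u2 u3 where "u1 \<in> Y" "u2 \<in> Y" "u3 \<in> Y" "u1 \<noteq> u2" "u1 \<noteq> u3" "u2 \<noteq> u3"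
    by (auto simp: card_3_iff)
  moreover have "lt x y \<or> lt y x" if "x \<in> Y" "y \<in> Y" "x \<noteq> y" for x y
    using chain Y(1) that by (auto simp: lt_def subset_iff)
  ultimately obtain u v w where uvw: "u \<in> Y" "v \<in> Y" "w \<in> Y" "lt u v" "lt v w"
    by meson
  then have uw: "lt u w" using trans[of u v w] antisym[of u v] unfolding lt_def by metis
  have X': "r u \<in> X" "r v \<in> X" "r w \<in> X" using uvw Y r by blast+
  have E: "E `` {r u} = u" "E `` {r v} = v" "E `` {r w} = w" using uvw Y r by blast+
  let ?Iu = "I (r u)" and ?Iv = "I (r v)" and ?Iw = "I (r w)"
  have "h (?Iw - ?Iu) = h (?Iv - ?Iu)" "h (?Iw - ?Iv) = h (?Iv - ?Iu)"
    using t uvw uw col[OF uvw(4)] col[OF uvw(5)] col[OF uw] IF X' inj_onD[OF g(1)]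
    by (metis lt_def)+
  moreover have sub: "?Iu \<subseteq> ?Iv" "?Iv \<subseteq> ?Iw"
    using uvw trans by (auto simp: I_def E lt_def)
  moreover have "h (?Iw - ?Iu) = h (?Iv - ?Iu) \<oplus> h (?Iw - ?Iv)"
  proof -
    have "?Iw - ?Iu = (?Iv - ?Iu) \<union> (?Iw - ?Iv)" using sub by blast
    then show ?thesis using measure_Un[OF D_Diff D_Diff, OF DI DI DI DI, OF X'(2,1,3,2)] by auto
  qed
  ultimately have "h (?Iv - ?Iu) = \<zero>"
    using idempotent_zero[of "h (?Iv - ?Iu)"] measure_closed[OF D_Diff[OF DI DI], OF X'(2,1)] by simp
  moreover have "r v \<in> ?Iv - ?Iu"
    using X' uvw antisym lq_refl Y by (auto simp: I_def E lt_def)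
  ultimately show False using measure_pos[OF D_Diff[OF DI DI], OF X'(2,1)] by auto
qed

text \<open>
  An injection has an image of measure \<^term>\<open>h X\<close>, so adding the measure of what it misses does not
  change \<^term>\<open>h X\<close>.  Under a surjection, fibres with several points have measure at least two, so
  the measure of \<^term>\<open>X\<close> is at least \<^term>\<open>h X\<close> plus that of the set of points with several
  preimages.  Cancellation makes both sets null, and hence empty.
\<close>

lemma injective_iff_surjective:
  assumes cancel: "\<And>x z. x \<in> carrier S \<Longrightarrow> z \<in> carrier S \<Longrightarrow> rle S (x \<oplus> z) x \<Longrightarrow> z = \<zero>"
    and f: "definable_map L M X X f"
  shows "inj_on f X \<longleftrightarrow> f ` X = X"
proof -
  obtain n m where D0: "D n X" "D m X" "D (n + m) {a @ f a | a. a \<in> X}" and fX: "f \<in> X \<rightarrow> X"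
    using definable_mapE[OF f] .
  show ?thesis
  proof (cases "X = {}")
    case False
    then have "m = n" using D_length[OF D0(1)] D_length[OF D0(2)] by blast
    then have D: "D n X" "D n X" "D (n + n) {a @ f a | a. a \<in> X}" using D0 by auto
    let ?G = "{a @ f a | a. a \<in> X}"
    have hX: "h X \<in> carrier S" using measure_closed D by blast
    have gm: "x @ y \<in> ?G \<longleftrightarrow> x \<in> X \<and> f x = y" if "x \<in> T n" for x y
      using graph_mem[OF D(1) that refl] .
    have single: "dp' n (\<lambda>z. z = y)" if "y \<in> X" for y
      using definable_over_dp(2)[OF D_singleton[OF D_arity[OF D(1) that]]] by simp
    have Dfib: "D n {x \<in> X. f x = y}" if "y \<in> X" for y
      using D_preimage[OF D fX single[OF that]] .
    show ?thesis
    proof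
      assume inj: "inj_on f X"
      have "dp' n (\<lambda>y. \<exists>x \<in> T n. map ((!) (y @ x)) ([n..<n + n] @ [0..<n]) \<in> ?G)"
        by (intro dp_ex dp_coords[OF definable_over_dp(2)[OF D(3)]]) auto
      then have Df: "D n (f ` X)"
      proof (rule dp_definable_over)
        fix y
        have eq: "map ((!) (y @ x)) ([n..<n + n] @ [0..<n]) = x @ y" if "x \<in> T n" "y \<in> T n" for x
          using that map_nth_append[of y n x] by (simp add: tuples_iff)
        have "(\<exists>x \<in> T n. map ((!) (y @ x)) ([n..<n + n] @ [0..<n]) \<in> ?G) \<longleftrightarrow> y \<in> f ` X"
          if "y \<in> T n"
        proof -
          have "(\<exists>x \<in> T n. map ((!) (y @ x)) ([n..<n + n] @ [0..<n]) \<in> ?G) \<longleftrightarrow>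
              (\<exists>x \<in> T n. x \<in> X \<and> f x = y)"
            using that by (intro bex_cong refl) (simp only: eq gm)
          then show ?thesis using D_arity[OF D(1)] by blast
        qed
        moreover have "y \<in> f ` X \<Longrightarrow> y \<in> T n" using fX D_arity[OF D(1)] by blast
        ultimately show "y \<in> f ` X \<longleftrightarrow>
            y \<in> T n \<and> (\<exists>x \<in> T n. map ((!) (y @ x)) ([n..<n + n] @ [0..<n]) \<in> ?G)"
          by blast
      qed
      have "definable_map L M X (f ` X) f"
        using D Df by (auto simp: definable_map_def intro: DefI)
      then have "h X = \<one> \<otimes> h (f ` X)"
      proof (rule measure_map)
        fix y assume "y \<in> f ` X"
        then obtain x where x: "x \<in> X" "y = f x" by blast
        then have "{a \<in> X. f a = y} = {x}" using inj by (auto dest: inj_onD)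
        then show "h {a \<in> X. f a = y} = \<one>"
          using measure_finite[OF D_singleton[OF D_arity[OF D(1) x(1)]]] by simp
      qed simp
      moreover have "h X = h (f ` X) \<oplus> h (X - f ` X)"
        using measure_split[OF D(1) Df] fX by (simp add: Int_absorb1 image_subset_iff_funcset)
      moreover have "h (X - f ` X) \<in> carrier S" "h (f ` X) \<in> carrier S"
        using measure_closed D_Diff[OF D(1) Df] Df by auto
      ultimately have "h (X - f ` X) = \<zero>"
        using cancel[of "h (f ` X)" "h (X - f ` X)"] le_refl[of "h (f ` X)"] by simp
      then have "X - f ` X = {}" using measure_pos[OF D_Diff[OF D(1) Df]] by blast
      then show "f ` X = X" using fX by auto
    next
      assume surj: "f ` X = X"
      (* The points with several preimages. *)
      define P where "P y \<longleftrightarrow> (\<exists>x \<in> T n. \<exists>x' \<in> T n. x \<noteq> x' \<and> x @ y \<in> ?G \<and> x' @ y \<in> ?G)" for y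
      have "dp' n (\<lambda>y. \<exists>x \<in> T n. \<exists>x' \<in> T n.
        \<not> (\<lambda>w. take n w = drop n w) (map ((!) ((y @ x) @ x')) [n..<n + n + n]) \<and>
          map ((!) ((y @ x) @ x')) ([n..<n + n] @ [0..<n]) \<in> ?G \<and>
          map ((!) ((y @ x) @ x')) ([n + n..<n + n + n] @ [0..<n]) \<in> ?G)"
        by (intro dp_ex dp_conj dp_not dp_coords[OF definable_over_dp(2)[OF D(3)]] dp_coords[OF dp_eq]) auto
      then have dpP: "dp' n P"
      proof (rule dp_cong)
        fix y assume y: "y \<in> T n"
        have eq: "map ((!) ((y @ x) @ x')) [n..<n + n + n] = x @ x'"
          "map ((!) ((y @ x) @ x')) [n..<n + n] = x"
          "map ((!) ((y @ x) @ x')) [n + n..<n + n + n] = x'"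
          "map ((!) ((y @ x) @ x')) [0..<n] = y" "take n (x @ x') = x" "drop n (x @ x') = x'"
          if "x \<in> T n" "x' \<in> T n" for x x'
          using that y map_nth_append(2)[of y n "x @ x'"] map_nth_append_mid[of y n x "n + n" x']
            map_nth_append(2)[of "y @ x" "n + n" x'] map_nth_append(1)[of y n "x @ x'"]
          by (auto simp: tuples_iff add.assoc)
        show "(\<exists>x \<in> T n. \<exists>x' \<in> T n.
          \<not> (\<lambda>w. take n w = drop n w) (map ((!) ((y @ x) @ x')) [n..<n + n + n]) \<and>
            map ((!) ((y @ x) @ x')) ([n..<n + n] @ [0..<n]) \<in> ?G \<and>
            map ((!) ((y @ x) @ x')) ([n + n..<n + n + n] @ [0..<n]) \<in> ?G) \<longleftrightarrow> P y"
          unfolding P_def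
        proof (intro bex_cong refl)
          fix x x' assume x: "x \<in> T n" "x' \<in> T n"
          show "(\<not> (\<lambda>w. take n w = drop n w) (map ((!) ((y @ x) @ x')) [n..<n + n + n]) \<and>
            map ((!) ((y @ x) @ x')) ([n..<n + n] @ [0..<n]) \<in> ?G \<and>
            map ((!) ((y @ x) @ x')) ([n + n..<n + n + n] @ [0..<n]) \<in> ?G) \<longleftrightarrow>
            (x \<noteq> x' \<and> x @ y \<in> ?G \<and> x' @ y \<in> ?G)"
            unfolding map_append eq[OF x] by (rule refl)
        qed
      qed
      have P: "P y \<longleftrightarrow> (\<exists>x \<in> X. \<exists>x' \<in> X. x \<noteq> x' \<and> f x = y \<and> f x' = y)" for y
      proof -
        have "P y \<longleftrightarrow> (\<exists>x \<in> T n. \<exists>x' \<in> T n. x \<noteq> x' \<and> (x \<in> X \<and> f x = y) \<and> (x' \<in> X \<and> f x' = y))"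
          unfolding P_def by (intro bex_cong refl) (simp only: gm)
        then show ?thesis using D_arity[OF D(1)] by blast
      qed
      let ?Y1 = "{y \<in> X. \<not> P y}" and ?Y2 = "{y \<in> X. P y}"
        and ?X1 = "{x \<in> X. \<not> P (f x)}" and ?X2 = "{x \<in> X. P (f x)}"
      have DY: "D n ?Y1" "D n ?Y2" and DX: "D n ?X1" "D n ?X2"
        using D_Collect[OF D(1) dp_not[OF dpP]] D_Collect[OF D(1) dpP]
          D_preimage[OF D fX dp_not[OF dpP]] D_preimage[OF D fX dpP] by auto
      note cl = DY[THEN measure_closed] DX[THEN measure_closed]
      have split: "h X = h ?Y1 \<oplus> h ?Y2" "h X = h ?X1 \<oplus> h ?X2"
      proof -
        have "?Y1 \<union> ?Y2 = X" "?X1 \<union> ?X2 = X" by auto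
        then show "h X = h ?Y1 \<oplus> h ?Y2" "h X = h ?X1 \<oplus> h ?X2"
          using measure_Un[OF DY] measure_Un[OF DX] by auto
      qed
      have fib: "{x \<in> {x \<in> X. Q (f x)}. f x = y} = {x \<in> X. f x = y}" if "Q y" for Q y
        using that by auto
      have maps: "definable_map L M ?X1 ?Y1 f" "definable_map L M ?X2 ?Y2 f"
        using definable_map_restrict[OF D fX dp_not[OF dpP]] definable_map_restrict[OF D fX dpP] .
      have one: "h ?X1 = \<one> \<otimes> h ?Y1"
      proof (rule measure_map[OF maps(1)])
        fix y assume y: "y \<in> ?Y1"
        have "y \<in> f ` X" unfolding surj using y by simp
        then obtain x where x: "x \<in> X" "f x = y" by blast
        have "\<not> (\<exists>x \<in> X. \<exists>x' \<in> X. x \<noteq> x' \<and> f x = y \<and> f x' = y)" using y P[of y] by simp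
        then have "a = x" if "a \<in> X" "f a = y" for a using x that by blast
        then have "{x \<in> X. f x = y} = {x}" using x by blast
        then show "h {x \<in> ?X1. f x = y} = \<one>"
          using fib[of "\<lambda>y. \<not> P y" y] y measure_finite[OF D_singleton[OF D_arity[OF D(1) x(1)]]] by simp
      qed simp
      have two: "rle S (([(2::nat)] \<cdot> \<one>) \<otimes> h ?Y2) (h ?X2)"
      proof -
        obtain n1 m1 where D1: "D n1 ?X2" "D m1 ?Y2" "D (n1 + m1) {a @ f a | a. a \<in> ?X2}" "f \<in> ?X2 \<rightarrow> ?Y2"
          using definable_mapE[OF maps(2)] .
        show ?thesis
        proof (rule measure_fibres_ge[OF D1])
          fix y assume y: "y \<in> ?Y2"
          then obtain x x' where x: "x \<in> X" "x' \<in> X" "x \<noteq> x'" "f x = y" "f x' = y" using P by blast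
          have D2: "D n {x, x'}"
            using D_Un[OF D_singleton D_singleton, of x n x'] x D_arity[OF D(1)] by (simp add: insert_commute)
          then have "rle S (h {x, x'}) (h {x \<in> X. f x = y})"
            using x y Dfib by (intro measure_mono) auto
          then show "rle S ([(2::nat)] \<cdot> \<one>) (h {x \<in> ?X2. f x = y})"
            using fib[of P y] y measure_finite[OF D2] x by (simp add: numeral_2_eq_2)
        qed simp
      qed
      have "([(2::nat)] \<cdot> \<one>) \<otimes> h ?Y2 = h ?Y2 \<oplus> h ?Y2"
        using cl by (simp add: numeral_2_eq_2 l_distr)
      then have "rle S (h ?Y1 \<oplus> (h ?Y2 \<oplus> h ?Y2)) (h X)"
        using add_mono2[OF le_refl[of "h ?Y1"] two] one cl split(2) by simp
      then have "rle S (h X \<oplus> h ?Y2) (h X)"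
        using split(1) cl by (simp add: a_assoc)
      then have "h ?Y2 = \<zero>" using cancel hX cl by blast
      then have "?Y2 = {}" using measure_pos[OF DY(2)] by blast
      then show "inj_on f X" using P fX by (auto simp: inj_on_def)
    qed
  qed simp
qed

end

lemma ordered_comm_ring_cancel:
  assumes "ordered_comm_ring R" "measuring_semiring (nonneg_part R)"
    and x: "x \<in> carrier (nonneg_part R)" and z: "z \<in> carrier (nonneg_part R)"
    and le: "rle (nonneg_part R) (x \<oplus>\<^bsub>nonneg_part R\<^esub> z) x"
  shows "z = \<zero>\<^bsub>nonneg_part R\<^esub>"
proof -
  interpret R: ordered_comm_ring R by fact
  interpret P: measuring_semiring "nonneg_part R" by fact
  have xz: "x \<in> carrier R" "z \<in> carrier R" using x z by (auto simp: nonneg_part_def)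
  have "rle R (x \<oplus>\<^bsub>R\<^esub> z) x" using le by (simp add: nonneg_part_def)
  then have "rle R ((x \<oplus>\<^bsub>R\<^esub> z) \<oplus>\<^bsub>R\<^esub> \<ominus>\<^bsub>R\<^esub> x) (x \<oplus>\<^bsub>R\<^esub> \<ominus>\<^bsub>R\<^esub> x)"
    using xz by (intro R.add_mono) auto
  moreover have "(x \<oplus>\<^bsub>R\<^esub> z) \<oplus>\<^bsub>R\<^esub> \<ominus>\<^bsub>R\<^esub> x = z" using xz R.a_comm[of x z] by (simp add: R.a_assoc R.r_neg)
  ultimately have "rle R z \<zero>\<^bsub>R\<^esub>" using xz by (simp add: R.r_neg)
  then have "rle (nonneg_part R) z \<zero>\<^bsub>nonneg_part R\<^esub>" by (simp add: nonneg_part_def)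
  then show ?thesis using P.le_antisym[of z] P.zero_least[of z] z by simp
qed

section \<open>Forking\<close>

context measured_structure
begin

lemma tp_mem: "(\<phi>, b) \<in> tp L M A a \<longleftrightarrow> part_fm L (length a) (length b) \<phi> \<and> set b \<subseteq> A \<and> a \<in> sols M (length a) \<phi> b"
  by (auto simp: tp_def fms_over_def)

text \<open>
  The instances of a formula that divides over \<^term>\<open>A\<close>, intersected with a set defined over
  \<^term>\<open>A\<close>, are \<^term>\<open>k\<close>-inconsistent and of equal measure, because the measure is part of the type
  of the parameters.  So they cannot have the dimension of that set.
\<close>

lemma dominated_dividing_False:
  assumes \<phi>: "part_fm L n (length c) \<phi>" and c: "set c \<subseteq> dom M" and div: "divides L M A n \<phi> c"
    and H: "definable_over L M A n H" "A \<subseteq> dom M" and ne: "H \<noteq> {}"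
    and dom: "dominated (h H) (h (H \<inter> sols M n \<phi> c))"
  shows False
proof -
  obtain k cs where "\<forall>i::nat. cs i \<in> T (length c) \<and> tp L M A (cs i) = tp L M A c"
    and "\<forall>w. finite w \<and> card w = k \<longrightarrow> \<not> (\<exists>a \<in> T n. \<forall>i \<in> w. a \<in> sols M n \<phi> (cs i))"
    using div unfolding divides_def by (elim exE conjE)
  then have cs: "\<And>i. cs i \<in> T (length c)" "\<And>i. tp L M A (cs i) = tp L M A c"
    and inc: "\<And>w. finite w \<Longrightarrow> card w = k \<Longrightarrow> \<not> (\<exists>a \<in> T n. \<forall>i \<in> w. a \<in> sols M n \<phi> (cs i))"
    by simp_all
  have DH: "D n H" using dp_mono[OF definable_over_dp(2)[OF H(1)] H(2)]
    by (rule dp_definable_over) (use definable_over_dp(1)[OF H(1)] in auto)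
  obtain m \<psi> b where \<psi>: "part_fm L n m \<psi>" "b \<in> tuples A m" "H = sols M n \<psi> b"
    using H(1) by (auto simp: definable_over_def)
  let ?l = "length c" and ?js = "[0..<n] @ [n + length c..<n + length c + m]"
  define \<theta> where "\<theta> = Conj \<phi> (sub ?js \<psi>)"
  have \<theta>: "part_fm L n (?l + m) \<theta>"
    using \<phi> \<psi>(1) by (auto simp: \<theta>_def part_fm_iff intro!: frm_sub elim: frm_mono)
  have sols: "sols M n \<theta> (c' @ b) = H \<inter> sols M n \<phi> c'" if "c' \<in> T ?l" for c'
  proof -
    have l: "length c' = ?l" "length b = m" using that \<psi>(2) by (auto simp: tuples_iff)
    have "x \<in> sols M n \<theta> (c' @ b) \<longleftrightarrow> x \<in> H \<inter> sols M n \<phi> c'" if x: "x \<in> T n" for x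
    proof -
      have lx: "length x = n" using x by (simp add: tuples_iff)
      have "map ((!) (x @ c' @ b)) ?js = x @ b"
        using l lx map_nth_append(1)[of x n "c' @ b"] map_nth_append(2)[of "x @ c'" "n + ?l" b] by simp
      moreover have "holds M \<phi> (x @ c' @ b) \<longleftrightarrow> holds M \<phi> (x @ c')"
        using holds_append[of L "x @ c'" \<phi> M b] \<phi> l lx by (simp add: part_fm_iff)
      moreover have "frm L (length ?js) \<psi>" using \<psi>(1) by (simp add: part_fm_iff)
      ultimately show ?thesis
        using x \<psi>(3) holds_sub[of L ?js \<psi> M "x @ c' @ b"] by (auto simp: \<theta>_def sols_iff)
    qed
    then show ?thesis by (auto simp: sols_iff)
  qed
  define e where "e = h (H \<inter> sols M n \<phi> c)"
  have cT: "c \<in> T ?l" using c by (simp add: tuples_iff)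
  have bM: "b \<in> T m" using \<psi>(2) H(2) tuples_mono by blast
  (* The measure of a set is part of the type of its parameters over A. *)
  have e: "h (H \<inter> sols M n \<phi> (cs i)) = e" for i
  proof -
    have "e \<in> (\<lambda>b. h (sols M n \<theta> b)) ` T (?l + m)"
      using sols[OF cT] tuples_append[OF cT bM] by (auto simp: e_def intro!: image_eqI[of _ _ "c @ b"])
    then have "dp L M {} (?l + m) (\<lambda>z. h (sols M n \<theta> z) = e)"
      using measure_family(2)[OF \<theta>] by (simp add: dp_def)
    then have "dp L M A ?l (\<lambda>z. h (sols M n \<theta> (z @ b)) = e)"
      using \<psi>(2) H(2) by (intro dp_section[OF dp_mono]) auto
    then obtain k \<chi> d where \<chi>: "frm L (?l + k) \<chi>" "d \<in> tuples A k"
      and eq: "\<forall>z \<in> T ?l. h (sols M n \<theta> (z @ b)) = e \<longleftrightarrow> holds M \<chi> (z @ d)" unfolding dp_iff by blast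
    have "(\<chi>, d) \<in> tp L M A c"
      using \<chi> eq cT sols[OF cT] by (auto simp: tp_mem part_fm_iff tuples_iff sols_iff e_def)
    then have "(\<chi>, d) \<in> tp L M A (cs i)" using cs(2) by simp
    then have "holds M \<chi> (cs i @ d)" using cs(1)[of i] by (auto simp: tp_mem sols_iff)
    then show ?thesis using eq cs(1)[of i] sols[OF cs(1)] by auto
  qed
  have DX: "D n (H \<inter> sols M n \<phi> (cs i))" for i
  proof -
    have "D n (sols M n \<phi> (cs i))" unfolding definable_over_def using \<phi> cs(1) by blast
    then show ?thesis using DH D_Int by blast
  qed
  show False
  proof (rule no_sparse_family[OF DH DX _ e, where k = k])
    show "dominated (h H) e" using dom by (simp add: e_def)
    show "e \<noteq> \<zero>"
    proof
      assume "e = \<zero>"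
      then obtain k :: nat where "rle S (h H) ([k] \<cdot> \<zero>)" using dom by (auto simp: dominated_def e_def)
      then have "rle S (h H) \<zero>" by simp
      then have "h H = \<zero>" using le_antisym[of "h H" \<zero>] zero_least measure_closed[OF DH] by simp
      then show False using measure_pos[OF DH ne] by simp
    qed
    fix w :: "nat set" and x assume w: "finite w" "card w = k"
    show "\<not> (\<forall>i \<in> w. x \<in> H \<inter> sols M n \<phi> (cs i))"
    proof
      assume x: "\<forall>i \<in> w. x \<in> H \<inter> sols M n \<phi> (cs i)"
      show False
      proof (cases "w = {}")
        case True
        obtain y where "y \<in> H" using ne by blast
        then have "y \<in> T n" using D_arity[OF DH] by blast
        then show False using inc[OF w] True by blast
      next
        case False
        then have "x \<in> T n" using x by (auto simp: sols_iff)
        then show False using inc[OF w] x by blast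
      qed
    qed
  qed auto
qed

text \<open>
  Take a set of least dimension among those defined over \<^term>\<open>B\<close> and containing \<^term>\<open>a\<close>, and let
  \<^term>\<open>B\<^sub>0\<close> collect the parameters of one definition.  If the type forked over \<^term>\<open>B\<^sub>0\<close>, then by
  saturation a finite disjunction of dividing formulas would cover a subset that is defined over
  \<^term>\<open>B\<close> and contains \<^term>\<open>a\<close>, hence is of the same dimension; then one disjunct would meet the
  set in the full dimension.
\<close>

lemma not_forks_over_finite:
  fixes \<kappa> :: "'m rel"
  assumes wo: "well_order_on (dims L M S h) (Restr (dim_order S) (dims L M S h))"
    and \<kappa>: "card_order_on (Field \<kappa>) \<kappa>" "infinite (Field \<kappa>)" and sat: "saturated L \<kappa> M"
    and B: "B \<subseteq> dom M" "(card_of B, \<kappa>) \<in> ordLess" and a: "a \<in> T n"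
  shows "\<exists>B\<^sub>0 \<subseteq> B. finite B\<^sub>0 \<and> \<not> forks L M B\<^sub>0 B a"
proof -
  define \<X> where "\<X> = {X. definable_over L M B n X \<and> a \<in> X}"
  have D\<X>: "D n X" if "X \<in> \<X>" for X
  proof (rule dp_definable_over)
    show "dp' n (\<lambda>a. a \<in> X)" using dp_mono[OF definable_over_dp(2) B(1)] that by (auto simp: \<X>_def)
    show "x \<in> X \<longleftrightarrow> x \<in> T n \<and> x \<in> X" for x using that definable_over_dp(1)[of L M B n X] by (auto simp: \<X>_def)
  qed
  have Int\<X>: "X \<inter> Y \<in> \<X>" if "X \<in> \<X>" "Y \<in> \<X>" for X Y
  proof -
    have "dp L M B n (\<lambda>x. x \<in> X \<and> x \<in> Y)"
      using that definable_over_dp(2) by (intro dp_conj) (auto simp: \<X>_def)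
    then have "definable_over L M B n (X \<inter> Y)"
      by (rule dp_definable_over) (use that definable_over_dp(1)[of L M B n X] in \<open>auto simp: \<X>_def\<close>)
    then show ?thesis using that by (auto simp: \<X>_def)
  qed
  have T\<X>: "T n \<in> \<X>"
    using a dp_not[OF dp_False, of L M B n] by (auto simp: \<X>_def dp_def)
  have "\<exists>H \<in> \<X>. \<forall>X \<in> \<X>. dominated (h H) (h X)"
  proof -
    let ?r = "Restr (dim_order S) (dims L M S h)"
    have wf: "wf (?r - Id)" using wo by (simp add: well_order_on_def)
    have ne: "(\<lambda>X. dim S (h X)) (T n) \<in> (\<lambda>X. dim S (h X)) ` \<X>" using T\<X> by blast
    obtain \<delta> where \<delta>: "\<delta> \<in> (\<lambda>X. dim S (h X)) ` \<X>"
      and min: "\<And>y. (y, \<delta>) \<in> ?r - Id \<Longrightarrow> y \<notin> (\<lambda>X. dim S (h X)) ` \<X>"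
      using wfE_min[OF wf ne] by blast
    obtain H where H: "H \<in> \<X>" "\<delta> = dim S (h H)" using \<delta> by blast
    have "dominated (h H) (h X)" if X: "X \<in> \<X>" for X
    proof (rule ccontr)
      assume nd: "\<not> dominated (h H) (h X)"
      have cl: "h H \<in> carrier S" "h X \<in> carrier S" using measure_closed D\<X> X H by blast+
      then have "dominated (h X) (h H)" using dominated_linear nd by blast
      moreover have "dim S (h X) \<noteq> dim S (h H)" using nd cl dim_eq_iff by blast
      moreover have "dim S (h X) \<in> dims L M S h" "dim S (h H) \<in> dims L M S h"
        using D\<X>[OF X] D\<X>[OF H(1)] by (auto simp: dims_def intro: DefI)
      ultimately have "(dim S (h X), \<delta>) \<in> ?r - Id" using cl H by (simp add: dim_order_iff)
      then show False using min X by blast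
    qed
    then show ?thesis using H by blast
  qed
  then obtain H where H: "H \<in> \<X>" and least: "\<And>X. X \<in> \<X> \<Longrightarrow> dominated (h H) (h X)" by blast
  obtain m \<phi> b where \<phi>: "part_fm L n m \<phi>" "b \<in> tuples B m" "H = sols M n \<phi> b"
    using H by (auto simp: \<X>_def definable_over_def)
  have DB: "definable_over L M (set b) n H"
    unfolding definable_over_def using \<phi> by (intro exI[of _ m] exI[of _ \<phi>] exI[of _ b]) (auto simp: tuples_iff)
  have bB: "set b \<subseteq> B" using \<phi>(2) by (simp add: tuples_iff)
  have la: "length a = n" using a by (simp add: tuples_iff)
  have "\<not> forks L M (set b) B a"
  proof
    assume "forks L M (set b) B a"
    then obtain \<Delta> where \<Delta>: "finite \<Delta>" "\<Delta> \<subseteq> fms_over L (dom M) n"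
      and "\<forall>(\<phi>, c) \<in> \<Delta>. divides L M (set b) n \<phi> c"
      and "\<forall>a' \<in> T n. tp L M B a' = tp L M B a \<longrightarrow> (\<exists>(\<phi>, c) \<in> \<Delta>. a' \<in> sols M n \<phi> c)"
      unfolding forks_def la by (elim exE conjE)
    then have div: "\<And>\<phi> c. (\<phi>, c) \<in> \<Delta> \<Longrightarrow> divides L M (set b) n \<phi> c"
      and cov: "\<And>a'. a' \<in> T n \<Longrightarrow> tp L M B a' = tp L M B a \<Longrightarrow> \<exists>(\<phi>, c) \<in> \<Delta>. a' \<in> sols M n \<phi> c"
      by auto
    (* A realisation would have the type of a over B and avoid the dividing formulas. *)
    define \<Sigma> where "\<Sigma> = tp L M B a \<union> (\<lambda>(\<phi>, c). (Neg \<phi>, c)) ` \<Delta>"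
    define A where "A = B \<union> (\<Union>(\<phi>, c) \<in> \<Delta>. set c)"
    have neg: "x \<in> sols M n (Neg \<phi>) c \<longleftrightarrow> x \<in> T n \<and> x \<notin> sols M n \<phi> c" for x \<phi> c
      by (auto simp: sols_iff)
    have 1: "A \<subseteq> dom M" using B \<Delta> by (auto simp: A_def fms_over_def)
    have 2: "(card_of A, \<kappa>) \<in> ordLess"
    proof -
      have fin: "finite (\<Union>(\<phi>, c) \<in> \<Delta>. set c)" using \<Delta>(1) by auto
      have \<kappa>': "Card_order \<kappa>" using \<kappa>(1) by (simp add: card_order_on_Card_order)
      have f: "(card_of (\<Union>(\<phi>, c) \<in> \<Delta>. set c), \<kappa>) \<in> ordLess"
        by (rule finite_ordLess_infinite[OF card_of_Well_order])
          (use \<kappa>' \<kappa>(2) fin in \<open>auto simp: card_order_on_well_order_on Field_card_of\<close>)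
      have "(card_of (B \<union> (\<Union>(\<phi>, c) \<in> \<Delta>. set c)), \<kappa>) \<in> ordLess"
        by (rule card_of_Un_ordLess_infinite_Field[OF \<kappa>(2) _ B(2) f]) (rule \<kappa>')
      then show ?thesis by (simp add: A_def)
    qed
    have 3: "\<Sigma> \<subseteq> fms_over L A n"
      using \<Delta> la by (auto simp: \<Sigma>_def tp_def fms_over_def A_def part_fm_iff)
    have unreal: "\<not> (\<exists>x \<in> T n. \<forall>(\<phi>, b) \<in> \<Sigma>. x \<in> sols M n \<phi> b)"
    proof
      assume "\<exists>x \<in> T n. \<forall>(\<phi>, b) \<in> \<Sigma>. x \<in> sols M n \<phi> b"
      then obtain x where x: "x \<in> T n" "\<And>\<phi> b. (\<phi>, b) \<in> \<Sigma> \<Longrightarrow> x \<in> sols M n \<phi> b" by blast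
      have lx: "length x = n" using x by (simp add: tuples_iff)
      have "(\<phi>, c) \<in> tp L M B x \<longleftrightarrow> (\<phi>, c) \<in> tp L M B a" for \<phi> c
      proof
        assume "(\<phi>, c) \<in> tp L M B a"
        then show "(\<phi>, c) \<in> tp L M B x" using x(2)[of \<phi> c] la lx by (auto simp: tp_mem \<Sigma>_def)
      next
        assume *: "(\<phi>, c) \<in> tp L M B x"
        show "(\<phi>, c) \<in> tp L M B a"
        proof (rule ccontr)
          assume "(\<phi>, c) \<notin> tp L M B a"
          then have "(Neg \<phi>, c) \<in> tp L M B a"
            using * la lx a by (auto simp: tp_mem part_fm_iff neg)
          then have "x \<in> sols M n (Neg \<phi>) c" using x(2) by (simp add: \<Sigma>_def)
          then show False using * lx by (auto simp: tp_mem neg)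
        qed
      qed
      then have "tp L M B x = tp L M B a" by auto
      then obtain \<phi> c where "(\<phi>, c) \<in> \<Delta>" "x \<in> sols M n \<phi> c" using cov x by blast
      moreover from this have "x \<in> sols M n (Neg \<phi>) c" using x(2)[of "Neg \<phi>" c] by (force simp: \<Sigma>_def)
      ultimately show False by (simp add: neg)
    qed
    have "\<not> (\<forall>\<Sigma>\<^sub>0 \<subseteq> \<Sigma>. finite \<Sigma>\<^sub>0 \<longrightarrow> (\<exists>a \<in> T n. \<forall>(\<phi>, b) \<in> \<Sigma>\<^sub>0. a \<in> sols M n \<phi> b))"
      (is "\<not> ?fs")
    proof
      assume fs: ?fs
      have "\<exists>x \<in> T n. \<forall>(\<phi>, b) \<in> \<Sigma>. x \<in> sols M n \<phi> b"
        by (rule mp[OF sat[unfolded saturated_def, THEN spec[of _ A], THEN spec[of _ n], THEN spec[of _ \<Sigma>]]])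
          (intro conjI 1 2 3 fs)
      then show False using unreal by (rule notE[rotated])
    qed
    then have "\<exists>\<Sigma>\<^sub>0. \<Sigma>\<^sub>0 \<subseteq> \<Sigma> \<and> finite \<Sigma>\<^sub>0 \<and> \<not> (\<exists>a \<in> T n. \<forall>(\<phi>, b) \<in> \<Sigma>\<^sub>0. a \<in> sols M n \<phi> b)"
      by (simp only: not_all not_imp)
    then obtain \<Sigma>0 where \<Sigma>0: "\<Sigma>0 \<subseteq> \<Sigma>" "finite \<Sigma>0"
      and "\<not> (\<exists>a \<in> T n. \<forall>(\<phi>, b) \<in> \<Sigma>0. a \<in> sols M n \<phi> b)"
      by (elim exE conjE)
    then have uns: "\<And>x. x \<in> T n \<Longrightarrow> \<exists>(\<phi>, b) \<in> \<Sigma>0. x \<notin> sols M n \<phi> b"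
      by fastforce
    have "\<Inter> ((\<lambda>(\<phi>, c). sols M n \<phi> c) ` Q) \<inter> H \<in> \<X>" if "finite Q" "Q \<subseteq> tp L M B a" for Q
      using that
    proof (induction Q rule: finite_induct)
      case (insert q Q)
      obtain \<phi> c where q: "q = (\<phi>, c)" by (cases q)
      have "(\<phi>, c) \<in> tp L M B a" using insert.prems q by blast
      then have "sols M n \<phi> c \<in> \<X>"
        unfolding \<X>_def definable_over_def using la by (auto simp: tp_mem tuples_iff)
      then have "sols M n \<phi> c \<inter> (\<Inter> ((\<lambda>(\<phi>, c). sols M n \<phi> c) ` Q) \<inter> H) \<in> \<X>"
        using insert Int\<X> by auto
      then show ?case by (simp add: q Int_assoc)
    qed (use H in simp)
    from this[of "\<Sigma>0 \<inter> tp L M B a"]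
    have X: "\<Inter> ((\<lambda>(\<phi>, c). sols M n \<phi> c) ` (\<Sigma>0 \<inter> tp L M B a)) \<inter> H \<in> \<X>" (is "?X \<in> \<X>")
      using \<Sigma>0 by auto
    have Xcov: "?X \<subseteq> (\<Union>(\<phi>, c) \<in> \<Delta>. sols M n \<phi> c)"
    proof
      fix x assume x: "x \<in> ?X"
      then have xT: "x \<in> T n" using D_arity[OF D\<X>[OF X]] by blast
      obtain \<phi> c where \<phi>c: "(\<phi>, c) \<in> \<Sigma>0" "x \<notin> sols M n \<phi> c" using uns[OF xT] by blast
      then have "(\<phi>, c) \<notin> tp L M B a" using x by blast
      then obtain \<phi>' where "(\<phi>', c) \<in> \<Delta>" "\<phi> = Neg \<phi>'" using \<phi>c \<Sigma>0 by (auto simp: \<Sigma>_def)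
      then show "x \<in> (\<Union>(\<phi>, c) \<in> \<Delta>. sols M n \<phi> c)" using \<phi>c xT by (force simp: neg)
    qed
    have D\<Delta>: "D n (case q of (\<phi>, c) \<Rightarrow> sols M n \<phi> c)" if "q \<in> \<Delta>" for q
      using that \<Delta>(2) by (fastforce simp: fms_over_def definable_over_def tuples_iff)
    have "a \<in> ?X" using X by (simp only: \<X>_def mem_Collect_eq)
    then have "?X \<noteq> {}" by blast
    then obtain q where q: "q \<in> \<Delta>" "dominated (h ?X) (h (?X \<inter> (case q of (\<phi>, c) \<Rightarrow> sols M n \<phi> c)))"
      using cover_dominated[OF \<Delta>(1) D\<Delta> D\<X>[OF X] Xcov] by blast
    obtain \<phi> c where qc: "q = (\<phi>, c)" by (cases q)
    let ?Y = "?X \<inter> sols M n \<phi> c" and ?Z = "H \<inter> sols M n \<phi> c"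
    have Dc: "D n (sols M n \<phi> c)" using D\<Delta>[OF q(1)] qc by simp
    have D: "D n ?X" "D n ?Y" "D n ?Z" "D n H"
      using D_Int[OF D\<X>[OF X] Dc] D_Int[OF D\<X>[OF H] Dc] D\<X> X H by blast+
    note cl = D[THEN measure_closed]
    have "dominated (h ?Y) (h ?Z)"
      by (intro le_dominated measure_mono[OF D(2,3)] cl) auto
    then have "dominated (h H) (h ?Z)"
      using least[OF X] q(2) qc dominated_trans[of "h H" "h ?X" "h ?Y"] dominated_trans[of "h H" "h ?Y" "h ?Z"] cl
      by simp
    moreover have "H \<noteq> {}" using H by (auto simp: \<X>_def)
    moreover have "part_fm L n (length c) \<phi>" "set c \<subseteq> dom M"
      using q(1) qc \<Delta>(2) by (auto simp: fms_over_def)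
    moreover have "divides L M (set b) n \<phi> c" using div q(1) qc by simp
    moreover have "set b \<subseteq> dom M" using bB B(1) by blast
    ultimately show False using dominated_dividing_False DB by blast
  qed
  then show ?thesis using bB by blast
qed

end

section \<open>Transfer to elementarily equivalent structures\<close>

definition Imp :: "('f, 'r) fm \<Rightarrow> ('f, 'r) fm \<Rightarrow> ('f, 'r) fm" where
  "Imp \<phi> \<psi> = Neg (Conj \<phi> (Neg \<psi>))"

definition Iff :: "('f, 'r) fm \<Rightarrow> ('f, 'r) fm \<Rightarrow> ('f, 'r) fm" where
  "Iff \<phi> \<psi> = Conj (Imp \<phi> \<psi>) (Imp \<psi> \<phi>)"

lemma frm_Imp [simp]: "frm L k (Imp \<phi> \<psi>) \<longleftrightarrow> frm L k \<phi> \<and> frm L k \<psi>"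
  and sat_Imp [simp]: "sat M e (Imp \<phi> \<psi>) \<longleftrightarrow> (sat M e \<phi> \<longrightarrow> sat M e \<psi>)"
  by (auto simp: Imp_def)

lemma frm_Iff [simp]: "frm L k (Iff \<phi> \<psi>) \<longleftrightarrow> frm L k \<phi> \<and> frm L k \<psi>"
  and sat_Iff [simp]: "sat M e (Iff \<phi> \<psi>) \<longleftrightarrow> (sat M e \<phi> \<longleftrightarrow> sat M e \<psi>)"
  by (auto simp: Iff_def)

text \<open>The tuple equality \<^term>\<open>x = a\<close> as a formula in \<^term>\<open>x @ a\<close>, with \<^term>\<open>j\<close> of \<^term>\<open>n\<close> entries compared.\<close>

primrec eqf :: "nat \<Rightarrow> nat \<Rightarrow> ('f, 'r) fm" where
  "eqf n 0 = Neg Fals"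
| "eqf n (Suc j) = Conj (Eq (Var j) (Var (n + j))) (eqf n j)"

lemma frm_eqf: "j \<le> n \<Longrightarrow> frm L (n + n) (eqf n j)"
  by (induction j) (auto simp: frm_def Fals_def)

lemma holds_eqf: "length x = n \<Longrightarrow> length a = n \<Longrightarrow> holds M (eqf n n) (x @ a) \<longleftrightarrow> x = a"
proof -
  assume l: "length x = n" "length a = n"
  have "j \<le> n \<Longrightarrow> holds M (eqf n j) (x @ a) \<longleftrightarrow> (\<forall>i<j. x ! i = a ! i)" for j
    using l by (induction j) (auto simp: nth_append less_Suc_eq)
  then show ?thesis using l by (auto simp: list_eq_iff_nth_eq)
qed

lemma block_0: "length c = k \<Longrightarrow> map ((!) (c @ z)) [0..<k] = c"
  by (rule map_nth_append(1))

lemma block_1: "length c = k \<Longrightarrow> length x = n \<Longrightarrow> map ((!) (c @ x @ z)) [k..<k + n] = x"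
  by (rule map_nth_append_mid) auto

lemma block_2:
  "length c = k \<Longrightarrow> length x = n \<Longrightarrow> length y = m \<Longrightarrow> map ((!) (c @ x @ y)) [k + n..<k + n + m] = y"
  using map_nth_append_mid[of "c @ x" "k + n" y "k + n + m" "[]"] by simp

text \<open>Parameters first, as quantification over the solutions requires.\<close>

definition swp :: "nat \<Rightarrow> nat \<Rightarrow> ('f, 'r) fm \<Rightarrow> ('f, 'r) fm" where
  "swp k n \<phi> = sub ([k..<k + n] @ [0..<k]) \<phi>"

lemma frm_swp: "frm L (n + k) \<phi> \<Longrightarrow> frm L (k + n) (swp k n \<phi>)"
  unfolding swp_def by (intro frm_sub) auto

lemma holds_swp:
  assumes "frm L (n + k) \<phi>" "length c = k" "length x = n"
  shows "holds M (swp k n \<phi>) (c @ x) \<longleftrightarrow> holds M \<phi> (x @ c)"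
  using holds_sub[of L "[k..<k + n] @ [0..<k]" \<phi> M "c @ x"] assms block_0[of c k x] block_1[of c k x n "[]"]
  by (simp add: swp_def)

lemma sols_append: "part_fm L n m \<phi> \<Longrightarrow> b \<in> tuples (dom M) m \<Longrightarrow> sols M n \<phi> (b @ c) = sols M n \<phi> b"
  unfolding set_eq_iff sols_iff
proof (intro allI conj_cong refl)
  fix x assume "part_fm L n m \<phi>" "b \<in> tuples (dom M) m" "x \<in> tuples (dom M) n"
  then show "holds M \<phi> (x @ b @ c) \<longleftrightarrow> holds M \<phi> (x @ b)"
    using holds_append[of L "x @ b" \<phi> M c] by (simp add: part_fm_iff tuples_iff)
qed

text \<open>
  Finitely many definable sets have definitions with one common tuple of parameters.  The first
  formula is kept so that the lemma can be iterated.
\<close>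

lemma common_parameters:
  assumes "part_fm L n m \<phi>" "b \<in> tuples (dom M) m" "definable_over L M (dom M) n' Y"
  obtains k c \<psi> where "part_fm L n (m + k) \<phi>" "c \<in> tuples (dom M) k" "sols M n \<phi> (b @ c) = sols M n \<phi> b"
    "part_fm L n' (m + k) \<psi>" "sols M n' \<psi> (b @ c) = Y"
proof -
  obtain k \<theta> c where \<theta>: "part_fm L n' k \<theta>" "c \<in> tuples (dom M) k" "Y = sols M n' \<theta> c"
    using assms(3) by (auto simp: definable_over_def)
  let ?js = "[0..<n'] @ [n' + m..<n' + m + k]"
  have "part_fm L n' (m + k) (sub ?js \<theta>)"
    using \<theta>(1) by (auto simp: part_fm_iff intro!: frm_sub)
  moreover have "sols M n' (sub ?js \<theta>) (b @ c) = Y"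
    unfolding \<theta>(3) set_eq_iff sols_iff
  proof (intro allI conj_cong refl)
    fix x assume "x \<in> tuples (dom M) n'"
    then have l: "length x = n'" "length b = m" "length c = k" using assms(2) \<theta>(2) by (auto simp: tuples_iff)
    have "map ((!) (x @ b @ c)) ?js = x @ c" using l block_0[of x n' "b @ c"] block_2[of x n' b m c k] by simp
    then show "holds M (sub ?js \<theta>) (x @ b @ c) \<longleftrightarrow> holds M \<theta> (x @ c)"
      using holds_sub[of L ?js \<theta> M "x @ b @ c"] \<theta>(1) by (simp add: part_fm_iff)
  qed
  moreover have "part_fm L n (m + k) \<phi>" using assms(1) by (auto simp: part_fm_iff elim: frm_mono)
  ultimately show thesis using that \<theta>(2) sols_append[OF assms(1,2)] by blast
qed

locale elementary_transfer = measured_structure S L M h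
  for S :: "'s ordered_ring" (structure) and L :: "('f, 'r) lang"
    and M :: "('f, 'r, 'm) struct" and h :: "'m list set \<Rightarrow> 's" +
  fixes N :: "('f, 'r, 'n) struct"
  assumes is_structure': "is_structure L N" and equivalent: "elementarily_equivalent L M N"
begin

interpretation N: definability L N .

abbreviation "TN \<equiv> tuples (dom N)"
abbreviation "DN \<equiv> definable_over L N (dom N)"

lemma reflect: "frm L k \<chi> \<Longrightarrow> c \<in> TN k \<Longrightarrow> holds N \<chi> c \<Longrightarrow> \<exists>c \<in> T k. holds M \<chi> c"
  using elementary_transfer[OF is_structure is_structure' equivalent] by blast

lemma transfer_all: "frm L k \<chi> \<Longrightarrow> (\<And>c. c \<in> T k \<Longrightarrow> holds M \<chi> c) \<Longrightarrow> c \<in> TN k \<Longrightarrow> holds N \<chi> c"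
  using reflect[of k "Neg \<chi>" c] by auto

text \<open>
  A formula for the parameters at which the family takes the value \<^term>\<open>f\<close>; it is contradictory if
  \<^term>\<open>f\<close> is not a value of the family.
\<close>

definition val_fm :: "nat \<Rightarrow> nat \<Rightarrow> ('f, 'r) fm \<Rightarrow> 's \<Rightarrow> ('f, 'r) fm" where
  "val_fm n m \<phi> f = (SOME \<psi>. frm L m \<psi> \<and> (\<forall>b \<in> T m. holds M \<psi> b \<longleftrightarrow> h (sols M n \<phi> b) = f))"

lemma val_fm:
  assumes "part_fm L n m \<phi>"
  shows "frm L m (val_fm n m \<phi> f)" "b \<in> T m \<Longrightarrow> holds M (val_fm n m \<phi> f) b \<longleftrightarrow> h (sols M n \<phi> b) = f"
proof -
  have "\<exists>\<psi>. frm L m \<psi> \<and> (\<forall>b \<in> T m. holds M \<psi> b \<longleftrightarrow> h (sols M n \<phi> b) = f)"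
  proof (cases "f \<in> (\<lambda>b. h (sols M n \<phi> b)) ` T m")
    case True
    then have "dp L M {} m (\<lambda>b. h (sols M n \<phi> b) = f)"
      using measure_family(2)[OF assms] by (simp add: dp_def)
    then obtain k \<psi> c where \<psi>: "frm L (m + k) \<psi>" "c \<in> tuples {} k"
      "\<forall>b \<in> T m. h (sols M n \<phi> b) = f \<longleftrightarrow> holds M \<psi> (b @ c)" unfolding dp_iff by blast
    moreover have "c = []" "k = 0" using \<psi>(2) by (auto simp: tuples_iff)
    ultimately show ?thesis by auto
  next
    case False
    then show ?thesis by (intro exI[of _ Fals]) auto
  qed
  then have "frm L m (val_fm n m \<phi> f) \<and>
      (\<forall>b \<in> T m. holds M (val_fm n m \<phi> f) b \<longleftrightarrow> h (sols M n \<phi> b) = f)"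
    unfolding val_fm_def by (rule someI_ex)
  then show "frm L m (val_fm n m \<phi> f)"
    "b \<in> T m \<Longrightarrow> holds M (val_fm n m \<phi> f) b \<longleftrightarrow> h (sols M n \<phi> b) = f" by auto
qed

text \<open>In \<^term>\<open>M\<close> some value is taken at every parameter, and a family has only finitely many values.\<close>

lemma val_fm_exists:
  assumes \<phi>: "part_fm L n m \<phi>" and b: "b \<in> TN m"
  shows "\<exists>f \<in> (\<lambda>b. h (sols M n \<phi> b)) ` T m. holds N (val_fm n m \<phi> f) b"
proof -
  let ?F = "(\<lambda>b. h (sols M n \<phi> b)) ` T m"
  have "\<exists>\<chi>. frm L m \<chi> \<and> (\<forall>c. holds M \<chi> c \<longleftrightarrow> (\<exists>f \<in> F. holds M (val_fm n m \<phi> f) c)) \<and>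
      (\<forall>c. holds N \<chi> c \<longleftrightarrow> (\<exists>f \<in> F. holds N (val_fm n m \<phi> f) c))" if "finite F" for F
    using that
  proof (induction rule: finite_induct)
    case (insert f F)
    then obtain \<chi> where "frm L m \<chi>" "\<forall>c. holds M \<chi> c \<longleftrightarrow> (\<exists>f \<in> F. holds M (val_fm n m \<phi> f) c)"
      "\<forall>c. holds N \<chi> c \<longleftrightarrow> (\<exists>f \<in> F. holds N (val_fm n m \<phi> f) c)" by blast
    then show ?case using val_fm(1)[OF \<phi>] by (intro exI[of _ "Disj (val_fm n m \<phi> f) \<chi>"]) auto
  qed (auto intro: exI[of _ Fals])
  from this[OF measure_family(1)[OF \<phi>]] obtain \<chi> where \<chi>: "frm L m \<chi>"
    "\<forall>c. holds M \<chi> c \<longleftrightarrow> (\<exists>f \<in> ?F. holds M (val_fm n m \<phi> f) c)"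
    "\<forall>c. holds N \<chi> c \<longleftrightarrow> (\<exists>f \<in> ?F. holds N (val_fm n m \<phi> f) c)" by blast
  have "holds N \<chi> b" by (rule transfer_all[OF \<chi>(1) _ b]) (use \<chi>(2) val_fm(2)[OF \<phi>] in blast)
  then show ?thesis using \<chi>(3) by blast
qed

lemma val_fm_unique:
  assumes \<phi>: "part_fm L n m \<phi>" and b: "b \<in> TN m"
    and "holds N (val_fm n m \<phi> f) b" "holds N (val_fm n m \<phi> g) b"
  shows "f = g"
proof -
  have "\<exists>c \<in> T m. holds M (Conj (val_fm n m \<phi> f) (val_fm n m \<phi> g)) c"
    using assms val_fm(1)[OF \<phi>] by (intro reflect) auto
  then show ?thesis using val_fm(2)[OF \<phi>] by auto
qed

text \<open>
  The transferred value depends on the set only, not on the formula and the parameters that define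
  it: in \<^term>\<open>M\<close> this is a first-order statement about both tuples of parameters.
\<close>

lemma val_fm_cong:
  assumes \<phi>: "part_fm L n m \<phi>" and b: "b \<in> TN m" and \<phi>': "part_fm L n m' \<phi>'" and b': "b' \<in> TN m'"
    and eq: "sols N n \<phi> b = sols N n \<phi>' b'" and val: "holds N (val_fm n m \<phi> f) b"
  shows "holds N (val_fm n m' \<phi>' f) b'"
proof -
  let ?k = "m + m'"
  let ?A = "sub ([?k..<?k + n] @ [0..<m]) \<phi>" and ?B = "sub ([?k..<?k + n] @ [m..<?k]) \<phi>'"
  let ?V = "val_fm n m \<phi> f" and ?V' = "sub [m..<m + m'] (val_fm n m' \<phi>' f)"
  let ?\<chi> = "Imp (Conj (allq ?k n (Iff ?A ?B)) ?V) ?V'"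
  have fA: "frm L (?k + n) ?A" "frm L (?k + n) ?B"
    using \<phi> \<phi>' by (auto simp: part_fm_iff ac_simps intro!: frm_sub)
  have f: "frm L ?k ?\<chi>"
    using fA frm_mono[OF val_fm(1)[OF \<phi>], of ?k] val_fm(1)[OF \<phi>']
    by (auto intro!: frm_allq frm_sub)
  have h1: "holds K ?A ((c @ c') @ x) \<longleftrightarrow> holds K \<phi> (x @ c)" "holds K ?B ((c @ c') @ x) \<longleftrightarrow> holds K \<phi>' (x @ c')"
    if "c \<in> tuples (dom K) m" "c' \<in> tuples (dom K) m'" "x \<in> tuples (dom K) n"
    for K :: "('f, 'r, 'k) struct" and c c' x
  proof -
    have l: "length c = m" "length c' = m'" "length x = n" using that by (auto simp: tuples_iff)
    then have "map ((!) ((c @ c') @ x)) ([?k..<?k + n] @ [0..<m]) = x @ c"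
      "map ((!) ((c @ c') @ x)) ([?k..<?k + n] @ [m..<?k]) = x @ c'"
      using block_0[of c m "c' @ x"] block_1[of c m c' m' x] block_2[of c m c' m' x n] by auto
    moreover have "frm L (length ([?k..<?k + n] @ [0..<m])) \<phi>" "frm L (length ([?k..<?k + n] @ [m..<?k])) \<phi>'"
      using \<phi> \<phi>' by (simp_all add: part_fm_iff)
    ultimately show "holds K ?A ((c @ c') @ x) \<longleftrightarrow> holds K \<phi> (x @ c)"
      "holds K ?B ((c @ c') @ x) \<longleftrightarrow> holds K \<phi>' (x @ c')"
      using holds_sub[of L "[?k..<?k + n] @ [0..<m]" \<phi> K] holds_sub[of L "[?k..<?k + n] @ [m..<?k]" \<phi>' K]
      by metis+
  qed
  have h2: "holds K (allq ?k n (Iff ?A ?B)) (c @ c') \<longleftrightarrow> sols K n \<phi> c = sols K n \<phi>' c'"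
    if "c \<in> tuples (dom K) m" "c' \<in> tuples (dom K) m'" for K :: "('f, 'r, 'k) struct" and c c'
  proof -
    have "holds K (allq ?k n (Iff ?A ?B)) (c @ c') \<longleftrightarrow>
        (\<forall>x \<in> tuples (dom K) n. holds K (Iff ?A ?B) ((c @ c') @ x))"
      using fA that by (intro holds_allq) (auto simp: tuples_iff)
    also have "\<dots> \<longleftrightarrow> (\<forall>x \<in> tuples (dom K) n. holds K \<phi> (x @ c) \<longleftrightarrow> holds K \<phi>' (x @ c'))"
      unfolding sat_Iff by (intro ball_cong refl) (simp only: h1[OF that])
    also have "\<dots> \<longleftrightarrow> sols K n \<phi> c = sols K n \<phi>' c'" by (auto simp: set_eq_iff sols_iff)
    finally show ?thesis .
  qed
  have h3: "holds K ?V (c @ c') \<longleftrightarrow> holds K ?V c" "holds K ?V' (c @ c') \<longleftrightarrow> holds K (val_fm n m' \<phi>' f) c'"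
    if "c \<in> tuples (dom K) m" "c' \<in> tuples (dom K) m'" for K :: "('f, 'r, 'k) struct" and c c'
  proof -
    have l: "length c = m" "length c' = m'" using that by (auto simp: tuples_iff)
    then show "holds K ?V (c @ c') \<longleftrightarrow> holds K ?V c" using val_fm(1)[OF \<phi>] holds_append by blast
    show "holds K ?V' (c @ c') \<longleftrightarrow> holds K (val_fm n m' \<phi>' f) c'"
      using holds_sub[of L "[m..<m + m']" "val_fm n m' \<phi>' f" K "c @ c'"] val_fm(1)[OF \<phi>'] l
        block_1[of c m c' m' "[]"] by simp
  qed
  have "holds N ?\<chi> (b @ b')"
  proof (rule transfer_all[OF f _ tuples_append[OF b b']])
    fix d assume "d \<in> T ?k"
    then obtain c c' where d: "d = c @ c'" and c: "c \<in> T m" "c' \<in> T m'" by (rule tuples_split)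
    show "holds M ?\<chi> d"
      unfolding d sat_Imp sat.simps h2[OF c] h3[OF c] val_fm(2)[OF \<phi> c(1)] val_fm(2)[OF \<phi>' c(2)] by auto
  qed
  then show ?thesis
    unfolding sat_Imp sat.simps h2[OF b b'] h3[OF b b'] using eq val by blast
qed

text \<open>The empty set has definitions of all arities, which the previous lemma does not compare.\<close>

lemma val_fm_empty:
  assumes \<phi>: "part_fm L n m \<phi>" and b: "b \<in> TN m" and "sols N n \<phi> b = {}" "holds N (val_fm n m \<phi> f) b"
  shows "f = \<zero>"
proof -
  have \<phi>': "frm L (m + n) (swp m n \<phi>)" using \<phi> by (simp add: part_fm_iff frm_swp)
  have *: "holds K (exq m n (swp m n \<phi>)) c \<longleftrightarrow> sols K n \<phi> c \<noteq> {}" if "c \<in> tuples (dom K) m"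
    for K :: "('f, 'r, 'k) struct" and c
  proof -
    have "holds K (exq m n (swp m n \<phi>)) c \<longleftrightarrow> (\<exists>x \<in> tuples (dom K) n. holds K (swp m n \<phi>) (c @ x))"
      using that by (intro holds_exq[OF \<phi>']) (simp add: tuples_iff)
    also have "\<dots> \<longleftrightarrow> (\<exists>x \<in> tuples (dom K) n. holds K \<phi> (x @ c))"
      using that \<phi> by (intro bex_cong refl holds_swp) (auto simp: tuples_iff part_fm_iff)
    also have "\<dots> \<longleftrightarrow> sols K n \<phi> c \<noteq> {}" by (auto simp: set_eq_iff sols_iff)
    finally show ?thesis .
  qed
  have "\<exists>c \<in> T m. holds M (Conj (Neg (exq m n (swp m n \<phi>))) (val_fm n m \<phi> f)) c"
    using assms val_fm(1)[OF \<phi>] \<phi>' *[OF b] by (intro reflect) (auto intro: frm_exq)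
  then show ?thesis using *[of _ M] val_fm(2)[OF \<phi>] measure_empty by auto
qed

definition h' :: "'n list set \<Rightarrow> 's" where
  "h' X = (THE f. \<exists>n m \<phi> b. part_fm L n m \<phi> \<and> b \<in> TN m \<and> X = sols N n \<phi> b \<and> holds N (val_fm n m \<phi> f) b)"

lemma transferred_iff:
  assumes \<phi>: "part_fm L n m \<phi>" and b: "b \<in> TN m"
  shows "h' (sols N n \<phi> b) = f \<longleftrightarrow> holds N (val_fm n m \<phi> f) b"
proof -
  obtain g where g: "holds N (val_fm n m \<phi> g) b" using val_fm_exists[OF assms] by blast
  have "h' (sols N n \<phi> b) = g"
    unfolding h'_def
  proof (rule the_equality)
    show "\<exists>n' m' \<phi>' b'. part_fm L n' m' \<phi>' \<and> b' \<in> TN m' \<and> sols N n \<phi> b = sols N n' \<phi>' b' \<and>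
        holds N (val_fm n' m' \<phi>' g) b'" using \<phi> b g by blast
    fix f assume "\<exists>n' m' \<phi>' b'. part_fm L n' m' \<phi>' \<and> b' \<in> TN m' \<and> sols N n \<phi> b = sols N n' \<phi>' b' \<and>
        holds N (val_fm n' m' \<phi>' f) b'"
    then obtain n' m' \<phi>' b' where *: "part_fm L n' m' \<phi>'" "b' \<in> TN m'" "sols N n \<phi> b = sols N n' \<phi>' b'"
        "holds N (val_fm n' m' \<phi>' f) b'" by blast
    show "f = g"
    proof (cases "sols N n \<phi> b = {}")
      case True
      then show ?thesis using val_fm_empty[OF \<phi> b _ g] val_fm_empty[OF *(1,2) _ *(4)] *(3) by simp
    next
      case False
      then obtain x where "x \<in> sols N n \<phi> b" by blast
      then have "length x = n" "length x = n'" using *(3) by (auto simp: sols_iff tuples_iff)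
      then have "n' = n" by simp
      then show ?thesis
        using val_fm_cong[OF *(1,2) _ b _ *(4)] \<phi> *(3) val_fm_unique[OF \<phi> b _ g] by simp
    qed
  qed
  then show ?thesis using g val_fm_unique[OF \<phi> b _ g] by blast
qed

lemma transferred_val: "part_fm L n m \<phi> \<Longrightarrow> b \<in> TN m \<Longrightarrow> holds N (val_fm n m \<phi> (h' (sols N n \<phi> b))) b"
  using transferred_iff by blast

lemma transferred_range:
  "part_fm L n m \<phi> \<Longrightarrow> b \<in> TN m \<Longrightarrow> h' (sols N n \<phi> b) \<in> (\<lambda>b. h (sols M n \<phi> b)) ` T m"
  using val_fm_exists[of n m \<phi> b] transferred_iff[of n m \<phi> b] by blast

lemma transferred_values: "h' ` Def L N \<subseteq> h ` Def L M"
proof safe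
  fix X assume "X \<in> Def L N"
  then obtain n m \<phi> b where "part_fm L n m \<phi>" "b \<in> TN m" "X = sols N n \<phi> b"
    by (auto simp: Def_iff definable_over_def)
  moreover from this obtain c where "c \<in> T m" "h' X = h (sols M n \<phi> c)" using transferred_range by blast
  ultimately show "h' X \<in> h ` Def L M" using Def_sols by blast
qed

lemma transferred_closed: "DN n X \<Longrightarrow> h' X \<in> carrier S"
  using transferred_values measure_closed DefI[of L N n X] by (fastforce simp: Def_iff)

lemma transferred_singleton:
  assumes a: "a \<in> TN n"
  shows "h' {a} = \<one>"
proof -
  have \<phi>: "part_fm L n n (eqf n n)" by (simp add: part_fm_iff frm_eqf)
  have sols: "sols K n (eqf n n) a = {a}" if "a \<in> tuples (dom K) n" for K :: "('f, 'r, 'k) struct" and a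
    using that by (auto simp: sols_iff tuples_iff holds_eqf)
  have "holds N (val_fm n n (eqf n n) \<one>) a"
  proof (rule transfer_all[OF val_fm(1)[OF \<phi>] _ a])
    fix c assume c: "c \<in> T n"
    have "h {c} = \<one>" using measure_finite[OF D_singleton[OF c]] by simp
    then show "holds M (val_fm n n (eqf n n) \<one>) c" using c val_fm(2)[OF \<phi> c] sols[OF c] by simp
  qed
  then show ?thesis using transferred_iff[OF \<phi> a] sols[OF a] by simp
qed

lemma transferred_Un:
  assumes "DN n X" "DN n Y" "X \<inter> Y = {}"
  shows "h' (X \<union> Y) = h' X \<oplus> h' Y"
proof -
  obtain m \<phi> b where 1: "part_fm L n m \<phi>" "b \<in> TN m" "X = sols N n \<phi> b"
    using assms(1) by (auto simp: definable_over_def)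
  obtain k c \<psi> where 2: "part_fm L n (m + k) \<phi>" "c \<in> TN k" "sols N n \<phi> (b @ c) = X"
    "part_fm L n (m + k) \<psi>" "sols N n \<psi> (b @ c) = Y"
    using common_parameters[OF 1(1,2) assms(2)] 1(3) by metis
  have bc: "b @ c \<in> TN (m + k)" using 1 2 tuples_append by blast
  let ?l = "m + k" and ?\<theta> = "Disj \<phi> \<psi>"
  have \<theta>: "part_fm L n ?l ?\<theta>" using 2 by (simp add: part_fm_iff)
  have sols\<theta>: "sols K n ?\<theta> d = sols K n \<phi> d \<union> sols K n \<psi> d" for K :: "('f, 'r, 'k) struct" and d
    by (auto simp: sols_iff)
  let ?A = "swp ?l n \<phi>" and ?B = "swp ?l n \<psi>"
  let ?\<chi> = "Conj (allq ?l n (Neg (Conj ?A ?B))) (Conj (val_fm n ?l \<phi> (h' X))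
    (Conj (val_fm n ?l \<psi> (h' Y)) (val_fm n ?l ?\<theta> (h' (X \<union> Y)))))"
  have fA: "frm L (?l + n) ?A" "frm L (?l + n) ?B" using 2 by (simp_all add: part_fm_iff frm_swp)
  have \<chi>: "frm L ?l ?\<chi>"
    using fA val_fm(1)[OF 2(1)] val_fm(1)[OF 2(4)] val_fm(1)[OF \<theta>] by (auto intro!: frm_allq)
  have dis: "holds K (allq ?l n (Neg (Conj ?A ?B))) d \<longleftrightarrow> sols K n \<phi> d \<inter> sols K n \<psi> d = {}"
    if "d \<in> tuples (dom K) ?l" for K :: "('f, 'r, 'k) struct" and d
  proof -
    have ld: "length d = ?l" using that by (simp add: tuples_iff)
    have "holds K (allq ?l n (Neg (Conj ?A ?B))) d \<longleftrightarrow>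
        (\<forall>x \<in> tuples (dom K) n. holds K (Neg (Conj ?A ?B)) (d @ x))"
      using fA ld by (intro holds_allq) auto
    also have "\<dots> \<longleftrightarrow> (\<forall>x \<in> tuples (dom K) n. \<not> (holds K \<phi> (x @ d) \<and> holds K \<psi> (x @ d)))"
    proof (intro ball_cong refl)
      fix x assume "x \<in> tuples (dom K) n"
      then have lx: "length x = n" by (simp add: tuples_iff)
      show "holds K (Neg (Conj ?A ?B)) (d @ x) \<longleftrightarrow> \<not> (holds K \<phi> (x @ d) \<and> holds K \<psi> (x @ d))"
        using holds_swp[OF 2(1)[unfolded part_fm_iff] ld lx] holds_swp[OF 2(4)[unfolded part_fm_iff] ld lx]
        by simp
    qed
    also have "\<dots> \<longleftrightarrow> sols K n \<phi> d \<inter> sols K n \<psi> d = {}" by (auto simp: sols_iff)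
    finally show ?thesis .
  qed
  have "\<exists>d \<in> T ?l. holds M ?\<chi> d"
  proof (rule reflect[OF \<chi> bc])
    show "holds N ?\<chi> (b @ c)"
      using dis[OF bc] 2 assms(3) transferred_val[OF 2(1) bc] transferred_val[OF 2(4) bc]
        transferred_val[OF \<theta> bc] by (simp add: sols\<theta>)
  qed
  then obtain d where d: "d \<in> T ?l" "holds M ?\<chi> d" by blast
  have Dd: "D n (sols M n \<phi> d)" "D n (sols M n \<psi> d)"
    using d(1) 2 by (auto simp: definable_over_def)
  have "h (sols M n \<phi> d) = h' X" "h (sols M n \<psi> d) = h' Y" "h (sols M n ?\<theta> d) = h' (X \<union> Y)"
    "sols M n \<phi> d \<inter> sols M n \<psi> d = {}"
    using d val_fm(2)[OF 2(1) d(1)] val_fm(2)[OF 2(4) d(1)] val_fm(2)[OF \<theta> d(1)] dis[OF d(1)] by simp_all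
  then show ?thesis using measure_Un[OF Dd] by (simp add: sols\<theta>)
qed

text \<open>
  The statement that the graph formula defines a function between the two sets, that all its fibres
  have measure \<^term>\<open>f\<close> and that the two sets have the given measures is first-order in the common
  parameters.  So it holds of some parameters in \<^term>\<open>M\<close>, where the axiom on maps applies.
\<close>

lemma transferred_map:
  assumes p: "definable_map L N X Y p" and f: "f \<in> carrier S"
    and fib: "\<And>a. a \<in> Y \<Longrightarrow> h' {x \<in> X. p x = a} = f"
  shows "h' X = f \<otimes> h' Y"
proof -
  let ?GN = "{a @ p a | a. a \<in> X}"
  obtain n m where D: "DN n X" "DN m Y" "DN (n + m) ?GN" and pXY: "p \<in> X \<rightarrow> Y"
    using N.definable_mapE[OF p] .
  obtain k1 \<phi> b where 1: "part_fm L n k1 \<phi>" "b \<in> TN k1" "X = sols N n \<phi> b"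
    using D(1) by (auto simp: definable_over_def)
  obtain k2 c \<psi> where 2: "part_fm L n (k1 + k2) \<phi>" "c \<in> TN k2" "sols N n \<phi> (b @ c) = sols N n \<phi> b"
    "part_fm L m (k1 + k2) \<psi>" "sols N m \<psi> (b @ c) = Y"
    by (rule common_parameters[OF 1(1,2) D(2)])
  have bc: "b @ c \<in> TN (k1 + k2)" using 1 2 tuples_append by blast
  obtain k3 d \<gamma> where 3: "part_fm L m (k1 + k2 + k3) \<psi>" "d \<in> TN k3" "sols N m \<psi> ((b @ c) @ d) = sols N m \<psi> (b @ c)"
    "part_fm L (n + m) (k1 + k2 + k3) \<gamma>" "sols N (n + m) \<gamma> ((b @ c) @ d) = ?GN"
    by (rule common_parameters[OF 2(4) bc D(3)])
  define k where "k = k1 + k2 + k3"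
  define u where "u = (b @ c) @ d"
  have u: "u \<in> TN k" using bc 3 tuples_append unfolding u_def k_def by blast
  have \<phi>: "part_fm L n k \<phi>" "sols N n \<phi> u = X"
    using 1(3) 2 sols_append[OF 2(1) bc, of d] by (auto simp: k_def u_def part_fm_iff elim: frm_mono)
  have \<psi>: "part_fm L m k \<psi>" "sols N m \<psi> u = Y" and \<gamma>: "part_fm L (n + m) k \<gamma>" "sols N (n + m) \<gamma> u = ?GN"
    using 2(5) 3 by (simp_all add: k_def u_def)
  have \<gamma>': "part_fm L n (m + k) \<gamma>" using \<gamma>(1) by (simp add: part_fm_iff add.assoc)
  let ?\<gamma>xy = "sub ([k..<k + n + m] @ [0..<k]) \<gamma>" and ?\<gamma>xz = "sub ([k..<k + n] @ [k + n + m..<k + n + m + m] @ [0..<k]) \<gamma>"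
  let ?\<phi>x = "sub ([k..<k + n] @ [0..<k]) \<phi>" and ?\<psi>y = "sub ([k + n..<k + n + m] @ [0..<k]) \<psi>"
  let ?eq = "sub [k + n..<k + n + m + m] (eqf m m)"
  let ?v = "val_fm n (m + k) \<gamma> f"
  (* The graph has exactly one point above each element of the domain; its points lie above the
     domain and the codomain; the fibres have measure f. *)
  let ?\<chi>1 = "allq k n (Imp ?\<phi>x (exq (k + n) m (allq (k + n + m) m (Iff ?\<gamma>xz ?eq))))"
  let ?\<chi>2 = "allq k n (allq (k + n) m (Imp ?\<gamma>xy (Conj ?\<phi>x ?\<psi>y)))"
  let ?\<chi>3 = "allq k m (Imp (swp k m \<psi>) (sub ([k..<k + m] @ [0..<k]) ?v))"
  let ?\<chi> = "Conj ?\<chi>1 (Conj ?\<chi>2 (Conj ?\<chi>3 (Conj (val_fm n k \<phi> (h' X)) (val_fm m k \<psi> (h' Y)))))"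
  have fs: "frm L (k + n + m) ?\<gamma>xy" "frm L (k + n + m + m) ?\<gamma>xz" "frm L (k + n) ?\<phi>x" "frm L (k + n + m) ?\<phi>x"
    "frm L (k + n + m) ?\<psi>y" "frm L (k + n + m + m) ?eq"
    "frm L (k + m) (swp k m \<psi>)" "frm L (k + m) (sub ([k..<k + m] @ [0..<k]) ?v)"
    using \<phi>(1) \<psi>(1) \<gamma>(1) val_fm(1)[OF \<gamma>'] frm_eqf[of m m L]
    by (auto simp: part_fm_iff ac_simps intro!: frm_sub frm_swp)
  have f1: "frm L (k + n + m + m) (Iff ?\<gamma>xz ?eq)" "frm L (k + n + m) (allq (k + n + m) m (Iff ?\<gamma>xz ?eq))"
    "frm L (k + n) (Imp ?\<phi>x (exq (k + n) m (allq (k + n + m) m (Iff ?\<gamma>xz ?eq))))"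
    and f2: "frm L (k + n + m) (Imp ?\<gamma>xy (Conj ?\<phi>x ?\<psi>y))" "frm L (k + n) (allq (k + n) m (Imp ?\<gamma>xy (Conj ?\<phi>x ?\<psi>y)))"
    and f3: "frm L (k + m) (Imp (swp k m \<psi>) (sub ([k..<k + m] @ [0..<k]) ?v))"
    using fs by (auto intro!: frm_allq frm_exq)
  have \<chi>: "frm L k ?\<chi>"
    using f1 f2 f3 val_fm(1)[OF \<phi>(1)] val_fm(1)[OF \<psi>(1)] by (auto intro!: frm_allq)
  have s: "holds K ?\<gamma>xy (w @ x @ y) \<longleftrightarrow> x @ y \<in> sols K (n + m) \<gamma> w"
    "holds K ?\<gamma>xz (w @ x @ y @ z) \<longleftrightarrow> x @ z \<in> sols K (n + m) \<gamma> w"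
    "holds K ?\<phi>x (w @ x) \<longleftrightarrow> x \<in> sols K n \<phi> w"
    "holds K ?\<phi>x (w @ x @ y) \<longleftrightarrow> x \<in> sols K n \<phi> w"
    "holds K ?\<psi>y (w @ x @ y) \<longleftrightarrow> y \<in> sols K m \<psi> w"
    "holds K ?eq (w @ x @ y @ z) \<longleftrightarrow> y = z"
    "holds K (swp k m \<psi>) (w @ y) \<longleftrightarrow> y \<in> sols K m \<psi> w"
    "holds K (sub ([k..<k + m] @ [0..<k]) ?v) (w @ y) \<longleftrightarrow> holds K ?v (y @ w)"
    if w: "w \<in> tuples (dom K) k" "x \<in> tuples (dom K) n" "y \<in> tuples (dom K) m" "z \<in> tuples (dom K) m"
    for K :: "('f, 'r, 'k) struct" and w x y z
  proof -
    have l: "length w = k" "length x = n" "length y = m" "length z = m" using w by (auto simp: tuples_iff)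
    have xy: "x @ y \<in> tuples (dom K) (n + m)" "x @ z \<in> tuples (dom K) (n + m)"
      using w tuples_append by blast+
    have "map ((!) (w @ x @ y)) [k..<k + n + m] = x @ y" using block_1[of w k "x @ y" "n + m" "[]"] l by (simp add: add.assoc)
    then show "holds K ?\<gamma>xy (w @ x @ y) \<longleftrightarrow> x @ y \<in> sols K (n + m) \<gamma> w"
      using holds_sub[of L "[k..<k + n + m] @ [0..<k]" \<gamma> K "w @ x @ y"] \<gamma>(1) l xy
      by (simp add: part_fm_iff sols_iff add.assoc)
    have "map ((!) (w @ x @ y @ z)) [k + n + m..<k + n + m + m] = z"
      using block_2[of "w @ x" "k + n" y m z m] l by simp
    moreover have "map ((!) (w @ x @ y @ z)) [k..<k + n] = x" using block_1[of w k x n "y @ z"] l by simp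
    ultimately show "holds K ?\<gamma>xz (w @ x @ y @ z) \<longleftrightarrow> x @ z \<in> sols K (n + m) \<gamma> w"
      using holds_sub[of L "[k..<k + n] @ [k + n + m..<k + n + m + m] @ [0..<k]" \<gamma> K "w @ x @ y @ z"] \<gamma>(1) l xy
      by (simp add: part_fm_iff sols_iff add.assoc)
    show "holds K ?\<phi>x (w @ x) \<longleftrightarrow> x \<in> sols K n \<phi> w"
      using holds_sub[of L "[k..<k + n] @ [0..<k]" \<phi> K "w @ x"] \<phi>(1) l w(2) block_1[of w k x n "[]"]
      by (simp add: part_fm_iff sols_iff)
    show "holds K ?\<phi>x (w @ x @ y) \<longleftrightarrow> x \<in> sols K n \<phi> w"
      using holds_sub[of L "[k..<k + n] @ [0..<k]" \<phi> K "w @ x @ y"] \<phi>(1) l w(2) block_1[of w k x n y]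
      by (simp add: part_fm_iff sols_iff)
    show "holds K ?\<psi>y (w @ x @ y) \<longleftrightarrow> y \<in> sols K m \<psi> w"
      using holds_sub[of L "[k + n..<k + n + m] @ [0..<k]" \<psi> K "w @ x @ y"] \<psi>(1) l w(3) block_2[of w k x n y m]
      by (simp add: part_fm_iff sols_iff)
    have "map ((!) (w @ x @ y @ z)) [k + n..<k + n + m + m] = y @ z"
      using block_2[of w k x n "y @ z" "m + m"] l by (simp add: add.assoc)
    then show "holds K ?eq (w @ x @ y @ z) \<longleftrightarrow> y = z"
      using holds_sub[of L "[k + n..<k + n + m + m]" "eqf m m" K "w @ x @ y @ z"] frm_eqf[of m m L]
        holds_eqf[of y m z K] l by (simp add: add.assoc)
    show "holds K (swp k m \<psi>) (w @ y) \<longleftrightarrow> y \<in> sols K m \<psi> w"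
      using holds_swp[of L m k \<psi> w y K] \<psi>(1) l w(3) by (simp add: part_fm_iff sols_iff)
    show "holds K (sub ([k..<k + m] @ [0..<k]) ?v) (w @ y) \<longleftrightarrow> holds K ?v (y @ w)"
      using holds_sub[of L "[k..<k + m] @ [0..<k]" ?v K "w @ y"] val_fm(1)[OF \<gamma>'] l block_1[of w k y m "[]"]
      by simp
  qed
  have \<chi>1: "holds K ?\<chi>1 w \<longleftrightarrow> (\<forall>x \<in> sols K n \<phi> w. \<exists>y \<in> tuples (dom K) m. \<forall>z \<in> tuples (dom K) m.
      x @ z \<in> sols K (n + m) \<gamma> w \<longleftrightarrow> y = z)" if w: "w \<in> tuples (dom K) k" "dom K \<noteq> {}" for K :: "('f, 'r, 'k) struct" and w
  proof -
    have lw: "length w = k" using w by (simp add: tuples_iff)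
    have "holds K (allq (k + n + m) m (Iff ?\<gamma>xz ?eq)) ((w @ x) @ y) \<longleftrightarrow>
        (\<forall>z \<in> tuples (dom K) m. x @ z \<in> sols K (n + m) \<gamma> w \<longleftrightarrow> y = z)"
      if "x \<in> tuples (dom K) n" "y \<in> tuples (dom K) m" for x y
      using that w s(2,6)[OF w(1) that] lw by (subst holds_allq[OF f1(1)]) (auto simp: tuples_iff)
    then have "holds K (exq (k + n) m (allq (k + n + m) m (Iff ?\<gamma>xz ?eq))) (w @ x) \<longleftrightarrow>
        (\<exists>y \<in> tuples (dom K) m. \<forall>z \<in> tuples (dom K) m. x @ z \<in> sols K (n + m) \<gamma> w \<longleftrightarrow> y = z)"
      if "x \<in> tuples (dom K) n" for x
      using that lw by (subst holds_exq[OF f1(2)]) (auto simp: tuples_iff)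
    moreover obtain y0 where "y0 \<in> tuples (dom K) m"
      using w(2) by (metis (no_types) ex_in_conv length_replicate set_replicate_conv_if empty_subsetI insert_subset tuples_iff)
    ultimately show ?thesis
      using lw s(3)[OF w(1)] by (subst holds_allq[OF f1(3)]) (auto simp: sols_iff)
  qed
  have \<chi>2: "holds K ?\<chi>2 w \<longleftrightarrow> (\<forall>x \<in> tuples (dom K) n. \<forall>y \<in> tuples (dom K) m. x @ y \<in> sols K (n + m) \<gamma> w \<longrightarrow>
      x \<in> sols K n \<phi> w \<and> y \<in> sols K m \<psi> w)" if w: "w \<in> tuples (dom K) k" for K :: "('f, 'r, 'k) struct" and w
  proof -
    have lw: "length w = k" using w by (simp add: tuples_iff)
    have "holds K (allq (k + n) m (Imp ?\<gamma>xy (Conj ?\<phi>x ?\<psi>y))) (w @ x) \<longleftrightarrow>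
        (\<forall>y \<in> tuples (dom K) m. x @ y \<in> sols K (n + m) \<gamma> w \<longrightarrow> x \<in> sols K n \<phi> w \<and> y \<in> sols K m \<psi> w)"
      if "x \<in> tuples (dom K) n" for x
      using that w s(1,4,5)[OF w that] lw by (subst holds_allq[OF f2(1)]) (auto simp: tuples_iff)
    then show ?thesis using lw by (subst holds_allq[OF f2(2)]) auto
  qed
  have \<chi>3: "holds K ?\<chi>3 w \<longleftrightarrow> (\<forall>y \<in> sols K m \<psi> w. holds K ?v (y @ w))"
    if w: "w \<in> tuples (dom K) k" "dom K \<noteq> {}" for K :: "('f, 'r, 'k) struct" and w
  proof -
    have lw: "length w = k" using w by (simp add: tuples_iff)
    moreover obtain x0 where "x0 \<in> tuples (dom K) n"
      using w(2) by (metis (no_types) ex_in_conv length_replicate set_replicate_conv_if empty_subsetI insert_subset tuples_iff)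
    ultimately show ?thesis
      using s(7,8)[OF w(1)] by (subst holds_allq[OF f3]) (auto simp: sols_iff)
  qed
  have \<gamma>fib: "sols K n \<gamma> (y @ w) = {x \<in> tuples (dom K) n. x @ y \<in> sols K (n + m) \<gamma> w}"
    if "y \<in> tuples (dom K) m" "w \<in> tuples (dom K) k" for K :: "('f, 'r, 'k) struct" and y w
    using that by (auto simp: sols_iff tuples_append)
  have neN: "dom N \<noteq> {}" "dom M \<noteq> {}" using is_structure is_structure' by (auto simp: is_structure_def)
  have gm: "x @ y \<in> ?GN \<longleftrightarrow> x \<in> X \<and> p x = y" if "x \<in> TN n" for x y
    using N.graph_mem[OF D(1) that refl] .
  have "holds N ?\<chi> u"
  proof -
    have "holds N ?\<chi>1 u"
      unfolding \<chi>1[OF u neN(1)] \<phi> \<gamma>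
    proof
      fix x assume x: "x \<in> X"
      then have "x \<in> TN n" "p x \<in> TN m" using N.D_arity[OF D(1)] N.D_arity[OF D(2)] pXY by auto
      then show "\<exists>y \<in> TN m. \<forall>z \<in> TN m. x @ z \<in> ?GN \<longleftrightarrow> y = z" using gm x by (intro bexI[of _ "p x"]) simp_all
    qed
    moreover have "holds N ?\<chi>2 u"
      unfolding \<chi>2[OF u] \<phi> \<gamma> \<psi>
    proof (intro ballI impI)
      fix x y assume "x \<in> TN n" and xy: "x @ y \<in> ?GN"
      then have "x \<in> X \<and> p x = y" using gm[of x y] by (simp only:)
      then show "x \<in> X \<and> y \<in> Y" using pXY by auto
    qed
    moreover have "holds N ?\<chi>3 u"
      unfolding \<chi>3[OF u neN(1)] \<psi>
    proof
      fix y assume y: "y \<in> Y"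
      have yT: "y \<in> TN m" using y N.D_arity[OF D(2)] by blast
      have "sols N n \<gamma> (y @ u) = {x \<in> X. p x = y}"
        unfolding \<gamma>fib[OF yT u] \<gamma>(2) using N.fibre_eq[OF D(1) refl] .
      then show "holds N ?v (y @ u)"
        using transferred_iff[OF \<gamma>' tuples_append[OF yT u], of f] fib[OF y] by simp
    qed
    moreover have "holds N (val_fm n k \<phi> (h' X)) u" "holds N (val_fm m k \<psi> (h' Y)) u"
      using transferred_val[OF \<phi>(1) u] transferred_val[OF \<psi>(1) u] \<phi> \<psi> by simp_all
    ultimately show ?thesis by simp
  qed
  then obtain w where w: "w \<in> T k" and w\<chi>: "holds M ?\<chi> w" using reflect[OF \<chi> u] by blast
  define X' Y' G where "X' = sols M n \<phi> w" and "Y' = sols M m \<psi> w" and "G = sols M (n + m) \<gamma> w"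
  have DM: "D n X'" "D m Y'" "D (n + m) G"
    unfolding X'_def Y'_def G_def definable_over_def using \<phi> \<psi> \<gamma> w by blast+
  have c1: "\<forall>x \<in> X'. \<exists>y \<in> T m. \<forall>z \<in> T m. x @ z \<in> G \<longleftrightarrow> y = z"
    and c2: "\<forall>x \<in> T n. \<forall>y \<in> T m. x @ y \<in> G \<longrightarrow> x \<in> X' \<and> y \<in> Y'"
    and c3: "\<forall>y \<in> Y'. holds M ?v (y @ w)"
    and hX: "h X' = h' X" and hY: "h Y' = h' Y"
    using w\<chi> \<chi>1[OF w neN(2)] \<chi>2[OF w] \<chi>3[OF w neN(2)] val_fm(2)[OF \<phi>(1) w] val_fm(2)[OF \<psi>(1) w]
    by (simp_all add: X'_def Y'_def G_def)
  from c1 have "\<forall>x \<in> X'. \<exists>y. y \<in> T m \<and> (\<forall>z \<in> T m. x @ z \<in> G \<longleftrightarrow> y = z)" by blast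
  from bchoice[OF this] obtain q where q: "\<forall>x \<in> X'. q x \<in> T m \<and> (\<forall>z \<in> T m. x @ z \<in> G \<longleftrightarrow> q x = z)"
    by blast
  have Gq: "x @ y \<in> G \<longleftrightarrow> x \<in> X' \<and> q x = y" if "x \<in> T n" "y \<in> T m" for x y
    using that c2 q by blast
  have G: "G = {a @ q a | a. a \<in> X'}"
  proof
    show "G \<subseteq> {a @ q a | a. a \<in> X'}"
    proof
      fix g assume g: "g \<in> G"
      obtain x y where "g = x @ y" "x \<in> T n" "y \<in> T m" using D_arity[OF DM(3) g] by (rule tuples_split)
      then show "g \<in> {a @ q a | a. a \<in> X'}" using Gq g by auto
    qed
    show "{a @ q a | a. a \<in> X'} \<subseteq> G" using q by auto
  qed
  have "q \<in> X' \<rightarrow> Y'"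
  proof
    fix x assume x: "x \<in> X'"
    then show "q x \<in> Y'" using c2 Gq[of x "q x"] q D_arity[OF DM(1)] by blast
  qed
  then have "definable_map L M X' Y' q" using DM unfolding G by (auto simp: definable_map_def intro: DefI)
  then have "h X' = f \<otimes> h Y'"
  proof (rule measure_map[OF _ f])
    fix y assume y: "y \<in> Y'"
    then have yT: "y \<in> T m" using D_arity[OF DM(2)] by blast
    have "sols M n \<gamma> (y @ w) = {x \<in> X'. q x = y}"
      unfolding \<gamma>fib[OF yT w] G_def[symmetric] using Gq yT D_arity[OF DM(1)] by blast
    then show "h {x \<in> X'. q x = y} = f"
      using c3 y val_fm(2)[OF \<gamma>' tuples_append[OF yT w], of f] by simp
  qed
  then show ?thesis by (simp add: hX hY)
qed

lemma transferred_is_measure: "is_measure L N S h'"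
proof (rule N.is_measureI[OF measuring_semiring_axioms transferred_closed transferred_Un
      transferred_singleton _ _ transferred_map])
  fix n m \<phi> assume \<phi>: "part_fm L n m \<phi>"
  have "(\<lambda>b. h' (sols N n \<phi> b)) ` TN m \<subseteq> (\<lambda>b. h (sols M n \<phi> b)) ` T m"
    using transferred_range[OF \<phi>] by blast
  then show "finite ((\<lambda>b. h' (sols N n \<phi> b)) ` TN m)" using measure_family(1)[OF \<phi>] finite_subset by blast
  show "dp L N {} m (\<lambda>b. h' (sols N n \<phi> b) = f)" for f
    by (rule dp_cong[OF dp_holds[OF val_fm(1)[OF \<phi>]]]) (simp add: transferred_iff[OF \<phi>])
qed

end

lemma measure_transfer:
  assumes "is_structure L M" "is_structure L N" "elementarily_equivalent L M N"
    "measuring_semiring S" "is_measure L M S h"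
  obtains h' where "is_measure L N S h'" "h' ` Def L N \<subseteq> h ` Def L M"
proof -
  interpret measuring_semiring S by fact
  interpret elementary_transfer S L M h N by unfold_locales (use assms in auto)
  show thesis using that transferred_is_measure transferred_values by blast
qed

section \<open>Growth rates along an ultrafilter\<close>

text \<open>
  Nonnegative real functions are compared up to a factor that is infinitely close to one along the
  filter.  This preorder is compatible with addition and multiplication, and its classes are the
  possible sizes of definable sets in ultraproducts of finite structures.
\<close>

definition apx_le :: "'i filter \<Rightarrow> ('i \<Rightarrow> real) \<Rightarrow> ('i \<Rightarrow> real) \<Rightarrow> bool" where
  "apx_le F u v \<longleftrightarrow> (\<forall>\<epsilon> > 0. \<forall>\<^sub>F i in F. u i \<le> (1 + \<epsilon>) * v i)"

definition cls :: "'i filter \<Rightarrow> ('i \<Rightarrow> real) \<Rightarrow> ('i \<Rightarrow> real) set" where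
  "cls F u = {v. (\<forall>i. 0 \<le> v i) \<and> apx_le F u v \<and> apx_le F v u}"

definition some_rep :: "('i \<Rightarrow> real) set \<Rightarrow> 'i \<Rightarrow> real" where
  "some_rep A = (SOME u. u \<in> A)"

text \<open>
  The elements are the classes themselves, and the operations act on arbitrary representatives.
\<close>

definition growth_semiring :: "'i filter \<Rightarrow> ('i \<Rightarrow> real) set ordered_ring" where
  "growth_semiring F =
     \<lparr> carrier = cls F ` {u. \<forall>i. 0 \<le> u i},
       mult = (\<lambda>A B. cls F (\<lambda>i. some_rep A i * some_rep B i)),
       one = cls F (\<lambda>_. 1),
       zero = cls F (\<lambda>_. 0),
       add = (\<lambda>A B. cls F (\<lambda>i. some_rep A i + some_rep B i)),
       rle = (\<lambda>A B. apx_le F (some_rep A) (some_rep B)) \<rparr>"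

lemma apx_leD: "apx_le F u v \<Longrightarrow> \<epsilon> > 0 \<Longrightarrow> \<forall>\<^sub>F i in F. u i \<le> (1 + \<epsilon>) * v i"
  by (simp add: apx_le_def)

lemma eventually_le_apx_le:
  assumes "\<forall>\<^sub>F i in F. u i \<le> v i" "\<And>i. 0 \<le> v i"
  shows "apx_le F u v"
  unfolding apx_le_def
proof (intro allI impI)
  fix \<epsilon> :: real assume "\<epsilon> > 0"
  from assms(1) show "\<forall>\<^sub>F i in F. u i \<le> (1 + \<epsilon>) * v i"
  proof eventually_elim
    case (elim i)
    have "0 \<le> \<epsilon> * v i" using \<open>\<epsilon> > 0\<close> assms(2) by simp
    then show ?case using elim by (simp add: distrib_right)
  qed
qed

lemma apx_le_refl: "(\<And>i. 0 \<le> u i) \<Longrightarrow> apx_le F u u"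
  by (intro eventually_le_apx_le) auto

lemma apx_le_trans:
  assumes "apx_le F u v" "apx_le F v w" "\<And>i. 0 \<le> w i"
  shows "apx_le F u w"
  unfolding apx_le_def
proof (intro allI impI)
  fix \<delta> :: real assume \<delta>: "\<delta> > 0"
  (* The square of 1 + \<epsilon> is at most 1 + 3 * \<epsilon> for \<epsilon> up to one. *)
  define \<epsilon> where "\<epsilon> = min 1 (\<delta> / 3)"
  have \<epsilon>: "\<epsilon> > 0" "\<epsilon> \<le> 1" "3 * \<epsilon> \<le> \<delta>" using \<delta> by (auto simp: \<epsilon>_def)
  have "\<epsilon> * \<epsilon> \<le> \<epsilon>" using \<epsilon> mult_left_mono[of \<epsilon> 1 \<epsilon>] by simp
  moreover have "(1 + \<epsilon>) * (1 + \<epsilon>) = 1 + 2 * \<epsilon> + \<epsilon> * \<epsilon>" by (simp add: algebra_simps)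
  ultimately have *: "(1 + \<epsilon>) * (1 + \<epsilon>) \<le> 1 + \<delta>" using \<epsilon>(3) by linarith
  from apx_leD[OF assms(1) \<epsilon>(1)] apx_leD[OF assms(2) \<epsilon>(1)]
  show "\<forall>\<^sub>F i in F. u i \<le> (1 + \<delta>) * w i"
  proof eventually_elim
    case (elim i)
    have "(1 + \<epsilon>) * v i \<le> (1 + \<epsilon>) * ((1 + \<epsilon>) * w i)" using elim \<epsilon> by (intro mult_left_mono) auto
    also have "\<dots> \<le> (1 + \<delta>) * w i" using mult_right_mono[OF *, of "w i"] assms(3) by (simp add: mult.assoc)
    finally show ?case using elim by simp
  qed
qed

lemma apx_le_add:
  assumes "apx_le F u v" "\<And>i. 0 \<le> w i"
  shows "apx_le F (\<lambda>i. u i + w i) (\<lambda>i. v i + w i)"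
  unfolding apx_le_def
proof (intro allI impI)
  fix \<epsilon> :: real assume \<epsilon>: "\<epsilon> > 0"
  from apx_leD[OF assms(1) this] show "\<forall>\<^sub>F i in F. u i + w i \<le> (1 + \<epsilon>) * (v i + w i)"
  proof eventually_elim
    case (elim i)
    have "0 \<le> \<epsilon> * w i" using \<epsilon> assms(2) by simp
    then show ?case using elim by (simp add: algebra_simps)
  qed
qed

lemma apx_le_mult:
  assumes "apx_le F u v" "\<And>i. 0 \<le> w i"
  shows "apx_le F (\<lambda>i. u i * w i) (\<lambda>i. v i * w i)"
  unfolding apx_le_def
proof (intro allI impI)
  fix \<epsilon> :: real assume "\<epsilon> > 0"
  from apx_leD[OF assms(1) this] show "\<forall>\<^sub>F i in F. u i * w i \<le> (1 + \<epsilon>) * (v i * w i)"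
  proof eventually_elim
    case (elim i)
    then show ?case using mult_right_mono[OF elim assms(2)[of i]] by (simp add: mult.assoc)
  qed
qed

lemma apx_le_add2:
  assumes "apx_le F u v" "apx_le F u' v'"
    "\<And>i. 0 \<le> u i" "\<And>i. 0 \<le> u' i" "\<And>i. 0 \<le> v i" "\<And>i. 0 \<le> v' i"
  shows "apx_le F (\<lambda>i. u i + u' i) (\<lambda>i. v i + v' i)"
proof -
  have "apx_le F (\<lambda>i. u' i + v i) (\<lambda>i. v' i + v i)" using assms by (intro apx_le_add)
  then have *: "apx_le F (\<lambda>i. v i + u' i) (\<lambda>i. v i + v' i)" by (simp add: add.commute)
  show ?thesis using apx_le_trans[OF apx_le_add[OF assms(1), of u'] *] assms by simp
qed

lemma apx_le_mult2:
  assumes "apx_le F u v" "apx_le F u' v'"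
    "\<And>i. 0 \<le> u i" "\<And>i. 0 \<le> u' i" "\<And>i. 0 \<le> v i" "\<And>i. 0 \<le> v' i"
  shows "apx_le F (\<lambda>i. u i * u' i) (\<lambda>i. v i * v' i)"
proof -
  have "apx_le F (\<lambda>i. u' i * v i) (\<lambda>i. v' i * v i)" using assms by (intro apx_le_mult)
  then have *: "apx_le F (\<lambda>i. v i * u' i) (\<lambda>i. v i * v' i)" by (simp add: mult.commute)
  show ?thesis using apx_le_trans[OF apx_le_mult[OF assms(1), of u'] *] assms by simp
qed

lemma cls_eq_iff:
  assumes "\<And>i. 0 \<le> u i" "\<And>i. 0 \<le> v i"
  shows "cls F u = cls F v \<longleftrightarrow> apx_le F u v \<and> apx_le F v u"
proof
  assume "cls F u = cls F v"
  moreover have "v \<in> cls F v" using assms by (simp add: cls_def apx_le_refl)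
  ultimately have "v \<in> cls F u" by simp
  then show "apx_le F u v \<and> apx_le F v u" by (simp add: cls_def)
next
  assume uv: "apx_le F u v \<and> apx_le F v u"
  have "w \<in> cls F u \<longleftrightarrow> w \<in> cls F v" for w
    using uv assms apx_le_trans[of F v u w] apx_le_trans[of F w u v] apx_le_trans[of F u v w]
      apx_le_trans[of F w v u] by (auto simp: cls_def)
  then show "cls F u = cls F v" by blast
qed

lemma eventually_eq_cls:
  assumes "\<forall>\<^sub>F i in F. u i = v i" "\<And>i. 0 \<le> u i" "\<And>i. 0 \<le> v i"
  shows "cls F u = cls F v"
proof -
  have "\<forall>\<^sub>F i in F. u i \<le> v i" "\<forall>\<^sub>F i in F. v i \<le> u i" using assms(1) by (auto elim: eventually_mono)
  then show ?thesis using assms(2,3) by (simp add: cls_eq_iff eventually_le_apx_le)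
qed

lemma some_rep_cls:
  assumes "\<And>i. 0 \<le> u i"
  shows "0 \<le> some_rep (cls F u) i" "apx_le F u (some_rep (cls F u))" "apx_le F (some_rep (cls F u)) u"
proof -
  have "u \<in> cls F u" using assms by (simp add: cls_def apx_le_refl)
  then have "some_rep (cls F u) \<in> cls F u" unfolding some_rep_def by (rule someI[where P = "\<lambda>w. w \<in> cls F u"])
  then show "0 \<le> some_rep (cls F u) i" "apx_le F u (some_rep (cls F u))" "apx_le F (some_rep (cls F u)) u"
    by (auto simp: cls_def)
qed

context
  fixes F :: "'i filter" and S :: "('i \<Rightarrow> real) set ordered_ring" (structure)
  defines "S \<equiv> growth_semiring F"
begin

lemma growth_add:
  assumes "\<And>i. 0 \<le> u i" "\<And>i. 0 \<le> v i"
  shows "cls F u \<oplus> cls F v = cls F (\<lambda>i. u i + v i)"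
  unfolding S_def growth_semiring_def
  using assms some_rep_cls[of u] some_rep_cls[of v]
  by (auto simp: cls_eq_iff intro!: apx_le_add2)

lemma growth_mult:
  assumes "\<And>i. 0 \<le> u i" "\<And>i. 0 \<le> v i"
  shows "cls F u \<otimes> cls F v = cls F (\<lambda>i. u i * v i)"
  unfolding S_def growth_semiring_def
  using assms some_rep_cls[of u] some_rep_cls[of v]
  by (auto simp: cls_eq_iff intro!: apx_le_mult2)

lemma growth_le:
  assumes "\<And>i. 0 \<le> u i" "\<And>i. 0 \<le> v i"
  shows "rle S (cls F u) (cls F v) \<longleftrightarrow> apx_le F u v"
proof -
  have "rle S (cls F u) (cls F v) \<longleftrightarrow> apx_le F (some_rep (cls F u)) (some_rep (cls F v))"
    by (simp add: S_def growth_semiring_def)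
  also have "\<dots> \<longleftrightarrow> apx_le F u v"
    using some_rep_cls[of u F] some_rep_cls[of v F] assms
      apx_le_trans[of F "some_rep (cls F u)" u v] apx_le_trans[of F "some_rep (cls F u)" v "some_rep (cls F v)"]
      apx_le_trans[of F u "some_rep (cls F u)" "some_rep (cls F v)"] apx_le_trans[of F u "some_rep (cls F v)" v]
    by blast
  finally show ?thesis .
qed

lemma growth_zero: "\<zero> = cls F (\<lambda>_. 0)" and growth_one: "\<one> = cls F (\<lambda>_. 1)"
  by (simp_all add: S_def growth_semiring_def)

lemma growth_carrier: "(\<And>i. 0 \<le> u i) \<Longrightarrow> cls F u \<in> carrier S"
  by (simp add: S_def growth_semiring_def)

lemma growth_carrierE:
  assumes "x \<in> carrier S"
  obtains u where "\<And>i. 0 \<le> u i" "x = cls F u"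
  using assms by (auto simp: S_def growth_semiring_def)

lemma growth_semiring: "semiring S" "comm_monoid S"
proof -
  show "semiring S"
  proof (intro semiring.intro abelian_monoidI monoidI semiring_axioms.intro)
    fix x y assume xy: "x \<in> carrier S" "y \<in> carrier S"
    obtain u v where u: "\<And>i. 0 \<le> u i" "x = cls F u" and v: "\<And>i. 0 \<le> v i" "y = cls F v"
      using xy by (metis growth_carrierE)
    show "x \<oplus> y \<in> carrier S" "x \<otimes> y \<in> carrier S" using u v by (simp_all add: growth_add growth_mult growth_carrier)
    show "x \<oplus> y = y \<oplus> x" using u v by (simp add: growth_add add.commute)
  next
    fix x y z assume xyz: "x \<in> carrier S" "y \<in> carrier S" "z \<in> carrier S"
    obtain u v w where u: "\<And>i. 0 \<le> u i" "x = cls F u" and v: "\<And>i. 0 \<le> v i" "y = cls F v"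
      and w: "\<And>i. 0 \<le> w i" "z = cls F w"
      using xyz by (metis growth_carrierE)
    show "x \<oplus> y \<oplus> z = x \<oplus> (y \<oplus> z)" "x \<otimes> y \<otimes> z = x \<otimes> (y \<otimes> z)"
      "(x \<oplus> y) \<otimes> z = x \<otimes> z \<oplus> y \<otimes> z" "z \<otimes> (x \<oplus> y) = z \<otimes> x \<oplus> z \<otimes> y"
      using u v w by (simp_all add: growth_add growth_mult add.assoc mult.assoc distrib_left distrib_right)
  next
    fix x assume x: "x \<in> carrier S"
    obtain u where u: "\<And>i. 0 \<le> u i" "x = cls F u" using x by (metis growth_carrierE)
    show "\<zero> \<oplus> x = x" "\<one> \<otimes> x = x" "x \<otimes> \<one> = x" "\<zero> \<otimes> x = \<zero>" "x \<otimes> \<zero> = \<zero>"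
      using u by (simp_all add: growth_add growth_mult growth_zero growth_one)
  qed (simp_all add: growth_zero growth_one growth_carrier)
  then interpret semiring S .
  show "comm_monoid S"
  proof (rule monoid_comm_monoidI)
    fix x y assume xy: "x \<in> carrier S" "y \<in> carrier S"
    obtain u v where u: "\<And>i. 0 \<le> u i" "x = cls F u" and v: "\<And>i. 0 \<le> v i" "y = cls F v"
      using xy by (metis growth_carrierE)
    show "x \<otimes> y = y \<otimes> x" using u v by (simp add: growth_mult mult.commute)
  qed
qed

lemma growth_nat_mult:
  assumes "\<And>i. 0 \<le> u i"
  shows "[n] \<cdot> cls F u = cls F (\<lambda>i. real n * u i)"
proof -
  interpret semiring S by (rule growth_semiring)
  show ?thesis
  proof (induction n)
    case 0
    then show ?case by (simp add: add_pow_def nat_pow_def growth_zero)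
  next
    case (Suc n)
    have "[Suc n] \<cdot> cls F u = [n] \<cdot> cls F u \<oplus> cls F u" by (rule add.nat_pow_Suc)
    also have "\<dots> = cls F (\<lambda>i. real (Suc n) * u i)"
      using assms by (simp only: Suc.IH) (simp add: growth_add algebra_simps)
    finally show ?case .
  qed
qed

text \<open>Archimedean comparison of classes is comparison of functions up to a constant factor.\<close>

lemma growth_arch_le:
  assumes F: "F \<noteq> bot" and "\<And>i. 0 \<le> u i" "\<And>i. 0 \<le> v i"
  shows "(\<exists>n::nat. rle S (cls F u) ([n] \<cdot> cls F v)) \<longleftrightarrow> (\<exists>C. \<forall>\<^sub>F i in F. u i \<le> C * v i)"
proof
  assume "\<exists>n::nat. rle S (cls F u) ([n] \<cdot> cls F v)"
  then obtain n :: nat where "rle S (cls F u) ([n] \<cdot> cls F v)" by blast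
  then have "apx_le F u (\<lambda>i. real n * v i)" using assms by (simp add: growth_nat_mult growth_le)
  from apx_leD[OF this, of 1] have "\<forall>\<^sub>F i in F. u i \<le> (2 * real n) * v i" by (simp add: mult.assoc)
  then show "\<exists>C. \<forall>\<^sub>F i in F. u i \<le> C * v i" by blast
next
  assume "\<exists>C. \<forall>\<^sub>F i in F. u i \<le> C * v i"
  then obtain C where C: "\<forall>\<^sub>F i in F. u i \<le> C * v i" by blast
  obtain n :: nat where n: "C \<le> real n" using real_arch_simple by blast
  from C have "\<forall>\<^sub>F i in F. u i \<le> real n * v i"
  proof eventually_elim
    case (elim i)
    then show ?case using mult_right_mono[OF n, of "v i"] assms(3) by (meson order_trans)
  qed
  then have "apx_le F u (\<lambda>i. real n * v i)" using assms by (intro eventually_le_apx_le) auto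
  then show "\<exists>n::nat. rle S (cls F u) ([n] \<cdot> cls F v)"
    using assms by (intro exI[of _ n]) (simp add: growth_nat_mult growth_le)
qed

end

lemma ultrafilter_not: "is_ultrafilter F \<Longrightarrow> (\<forall>\<^sub>F i in F. \<not> P i) \<longleftrightarrow> \<not> (\<forall>\<^sub>F i in F. P i)"
proof -
  assume F: "is_ultrafilter F"
  have "\<not> ((\<forall>\<^sub>F i in F. \<not> P i) \<and> (\<forall>\<^sub>F i in F. P i))"
  proof
    assume "(\<forall>\<^sub>F i in F. \<not> P i) \<and> (\<forall>\<^sub>F i in F. P i)"
    then have "\<forall>\<^sub>F i in F. False" by (auto elim: eventually_elim2)
    then show False using F by (simp add: is_ultrafilter_def)
  qed
  then show ?thesis using F by (auto simp: is_ultrafilter_def)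
qed

lemma ultrafilter_disj:
  "is_ultrafilter F \<Longrightarrow> (\<forall>\<^sub>F i in F. P i \<or> Q i) \<longleftrightarrow> (\<forall>\<^sub>F i in F. P i) \<or> (\<forall>\<^sub>F i in F. Q i)"
proof
  assume F: "is_ultrafilter F" and PQ: "\<forall>\<^sub>F i in F. P i \<or> Q i"
  show "(\<forall>\<^sub>F i in F. P i) \<or> (\<forall>\<^sub>F i in F. Q i)"
  proof (rule disjCI)
    assume "\<not> (\<forall>\<^sub>F i in F. Q i)"
    then have "\<forall>\<^sub>F i in F. \<not> Q i" using ultrafilter_not[OF F] by blast
    with PQ show "\<forall>\<^sub>F i in F. P i" by eventually_elim blast
  qed
qed (auto elim: eventually_mono)

lemma ultrafilter_bex:
  assumes F: "is_ultrafilter F" and "finite I" "\<forall>\<^sub>F i in F. \<exists>x \<in> I. P x i"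
  shows "\<exists>x \<in> I. \<forall>\<^sub>F i in F. P x i"
  using assms(2,3)
proof (induction I rule: finite_induct)
  case empty
  then show ?case using F by (simp add: is_ultrafilter_def)
next
  case (insert a I)
  then show ?case using ultrafilter_disj[OF F, of "P a" "\<lambda>i. \<exists>x \<in> I. P x i"] by auto
qed

lemma apx_le_linear:
  assumes F: "is_ultrafilter F" and "\<not> apx_le F u v" "\<And>i. 0 \<le> u i" "\<And>i. 0 \<le> v i"
  obtains \<epsilon> where "\<epsilon> > 0" "\<forall>\<^sub>F i in F. (1 + \<epsilon>) * v i < u i"
proof -
  obtain \<epsilon> where "\<epsilon> > 0" "\<not> (\<forall>\<^sub>F i in F. u i \<le> (1 + \<epsilon>) * v i)" using assms by (auto simp: apx_le_def)
  then have "\<forall>\<^sub>F i in F. \<not> u i \<le> (1 + \<epsilon>) * v i" using ultrafilter_not[OF F] by blast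
  then have "\<forall>\<^sub>F i in F. (1 + \<epsilon>) * v i < u i" by eventually_elim simp
  then show thesis using that \<open>\<epsilon> > 0\<close> by blast
qed

text \<open>
  If \<^term>\<open>y\<close> exceeds \<^term>\<open>x\<close> by a factor bounded away from one and \<^term>\<open>z\<close> is at most a
  bounded multiple of \<^term>\<open>y\<close>, then adding \<^term>\<open>z\<close> leaves such a factor: this is the measuring
  axiom.
\<close>

lemma apx_le_add_cancel:
  assumes F: "is_ultrafilter F" and z: "\<forall>\<^sub>F i in F. z i \<le> C * y i"
    and nn: "\<And>i. 0 \<le> x i" "\<And>i. 0 \<le> y i" "\<And>i. 0 \<le> z i"
    and le: "apx_le F (\<lambda>i. y i + z i) (\<lambda>i. x i + z i)"
  shows "apx_le F y x"
proof (rule ccontr)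
  assume "\<not> apx_le F y x"
  then obtain \<epsilon> where \<epsilon>: "\<epsilon> > 0" "\<forall>\<^sub>F i in F. (1 + \<epsilon>) * x i < y i"
    using apx_le_linear[OF F, of y x] nn by blast
  define C' where "C' = max C 0"
  (* Chosen such that \<eta> * (1 + \<epsilon>) * (C' + 1) is only half of \<epsilon>. *)
  define \<eta> where "\<eta> = (\<epsilon> / 2) / ((1 + \<epsilon>) * (C' + 1))"
  have C': "C' \<ge> 0" by (simp add: C'_def)
  have \<eta>: "\<eta> > 0" using \<epsilon> C' by (simp add: \<eta>_def)
  have "\<forall>\<^sub>F i in F. False"
    using \<epsilon>(2) z apx_leD[OF le \<eta>]
  proof eventually_elim
    case (elim i)
    have y: "y i > 0" using elim(1) nn(1)[of i] \<epsilon>(1) by (smt (verit) mult_nonneg_nonneg)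
    have zi: "z i \<le> C' * y i"
      using elim(2) mult_right_mono[of C C' "y i"] y order_trans by (fastforce simp: C'_def)
    have "x i \<le> y i / (1 + \<epsilon>)" using elim(1) \<epsilon>(1) by (simp add: field_simps)
    then have "(1 + \<eta>) * x i \<le> (1 + \<eta>) * (y i / (1 + \<epsilon>))" using \<eta> by (intro mult_left_mono) auto
    moreover have "\<eta> * z i \<le> \<eta> * (C' * y i)" using zi \<eta> by (intro mult_left_mono) auto
    ultimately have "y i \<le> (1 + \<eta>) * (y i / (1 + \<epsilon>)) + \<eta> * (C' * y i)"
      using elim(3) by (simp add: algebra_simps)
    also have "\<dots> = y i * ((1 + \<eta>) / (1 + \<epsilon>) + \<eta> * C')" by (simp add: algebra_simps)
    finally have "1 \<le> (1 + \<eta>) / (1 + \<epsilon>) + \<eta> * C'" using y by simp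
    then have "1 + \<epsilon> \<le> (1 + \<eta>) + \<eta> * C' * (1 + \<epsilon>)" using \<epsilon>(1) by (simp add: field_simps)
    also have "\<dots> \<le> 1 + \<eta> * (1 + \<epsilon>) * (C' + 1)"
      using \<eta> \<epsilon>(1) C' by (simp add: algebra_simps)
    also have "\<dots> = 1 + \<epsilon> / 2"
    proof -
      have "(1 + \<epsilon>) * (C' + 1) \<noteq> 0" using \<epsilon>(1) C' by auto
      from nonzero_eq_divide_eq[OF this, of \<eta> "\<epsilon> / 2"]
      have "\<eta> * ((1 + \<epsilon>) * (C' + 1)) = \<epsilon> / 2" unfolding \<eta>_def by blast
      then show ?thesis by (simp only: mult.assoc)
    qed
    finally show False using \<epsilon>(1) by simp
  qed
  then show False using F by (simp add: is_ultrafilter_def)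
qed

lemma growth_measuring_semiring:
  assumes F: "is_ultrafilter F"
  shows "measuring_semiring (growth_semiring F)"
proof -
  let ?S = "growth_semiring F"
  have bot: "F \<noteq> bot" using F by (simp add: is_ultrafilter_def)
  interpret semiring ?S by (rule growth_semiring)
  interpret comm_monoid ?S by (rule growth_semiring)
  note simps = growth_add growth_mult growth_le growth_zero growth_one
  have le_refl: "rle ?S x x" if "x \<in> carrier ?S" for x
    using that by (auto elim!: growth_carrierE simp: growth_le apx_le_refl)
  have ord: "ordered_srig ?S"
  proof unfold_locales
    have 1: "rle ?S x z" if le: "rle ?S x y" "rle ?S y z"
      and xyz: "x \<in> carrier ?S" "y \<in> carrier ?S" "z \<in> carrier ?S" for x y z
    proof -
      obtain u v w where "\<And>i. 0 \<le> u i" "x = cls F u" "\<And>i. 0 \<le> v i" "y = cls F v"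
        "\<And>i. 0 \<le> w i" "z = cls F w" using xyz by (metis growth_carrierE)
      then show ?thesis using le apx_le_trans[of F u v w] by (simp add: growth_le)
    qed
    have 2: "x = y" if le: "rle ?S x y" "rle ?S y x" and xy: "x \<in> carrier ?S" "y \<in> carrier ?S" for x y
    proof -
      obtain u v where "\<And>i. 0 \<le> u i" "x = cls F u" "\<And>i. 0 \<le> v i" "y = cls F v"
        using xy by (metis growth_carrierE)
      then show ?thesis using le by (simp add: growth_le cls_eq_iff)
    qed
    have 3: "rle ?S x y \<or> rle ?S y x" if xy: "x \<in> carrier ?S" "y \<in> carrier ?S" for x y
    proof -
      obtain u v where u: "\<And>i. 0 \<le> u i" "x = cls F u" and v: "\<And>i. 0 \<le> v i" "y = cls F v"
        using xy by (metis growth_carrierE)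
      have "apx_le F v u" if nle: "\<not> apx_le F u v"
      proof -
        obtain \<epsilon> where "\<epsilon> > 0" "\<forall>\<^sub>F i in F. (1 + \<epsilon>) * v i < u i" using apx_le_linear[OF F nle] u(1) v(1) by blast
        from this(2) have "\<forall>\<^sub>F i in F. v i \<le> u i"
        proof eventually_elim
          case (elim i)
          then show ?case using mult_nonneg_nonneg[of \<epsilon> "v i"] \<open>\<epsilon> > 0\<close> v(1)[of i]
            distrib_right[of 1 \<epsilon> "v i"] by linarith
        qed
        then show ?thesis using u(1) by (intro eventually_le_apx_le)
      qed
      then show ?thesis using u v by (auto simp: growth_le)
    qed
    show "total_order_carrier ?S"
      unfolding total_order_carrier_def order_on_defs
    proof (intro conjI)
      let ?r = "{(x, y). x \<in> carrier ?S \<and> y \<in> carrier ?S \<and> rle ?S x y}"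
      show "?r \<subseteq> carrier ?S \<times> carrier ?S" by auto
      show "refl_on (carrier ?S) ?r" using le_refl by (auto simp: refl_on_def)
      show "trans ?r" by (rule transI) (use 1 in blast)
      show "antisym ?r" by (rule antisymI) (use 2 in blast)
      show "total_on (carrier ?S) ?r" using 3 by (auto simp: total_on_def)
    qed
  next
    fix x assume "x \<in> carrier ?S"
    then show "rle ?S \<zero>\<^bsub>?S\<^esub> x"
      by (elim growth_carrierE) (simp add: growth_zero growth_le eventually_le_apx_le)
  next
    fix x y z assume xyz: "x \<in> carrier ?S" "y \<in> carrier ?S" "z \<in> carrier ?S" "rle ?S x y"
    obtain u v w where u: "\<And>i. 0 \<le> u i" "x = cls F u" and v: "\<And>i. 0 \<le> v i" "y = cls F v"
      and w: "\<And>i. 0 \<le> w i" "z = cls F w" using xyz by (metis growth_carrierE)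
    show "rle ?S (x \<oplus>\<^bsub>?S\<^esub> z) (y \<oplus>\<^bsub>?S\<^esub> z)" "rle ?S (x \<otimes>\<^bsub>?S\<^esub> z) (y \<otimes>\<^bsub>?S\<^esub> z)"
      using u v w xyz(4) by (simp_all add: growth_add growth_mult growth_le apx_le_add apx_le_mult)
  next
    fix x y assume xy: "x \<in> carrier ?S" "y \<in> carrier ?S" "rlt ?S \<zero>\<^bsub>?S\<^esub> x" "rlt ?S \<zero>\<^bsub>?S\<^esub> y"
    obtain u v where u: "\<And>i. 0 \<le> u i" "x = cls F u" and v: "\<And>i. 0 \<le> v i" "y = cls F v"
      using xy by (metis growth_carrierE)
    have zero: "cls F w = \<zero>\<^bsub>?S\<^esub> \<longleftrightarrow> (\<forall>\<^sub>F i in F. w i \<le> 0)" if w: "\<And>i. 0 \<le> w i" for w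
    proof -
      have "apx_le F (\<lambda>_. 0) w" using w by (intro eventually_le_apx_le) auto
      moreover have "apx_le F w (\<lambda>_. 0) \<longleftrightarrow> (\<forall>\<^sub>F i in F. w i \<le> 0)"
        by (auto simp: apx_le_def intro: exI[of _ 1])
      ultimately show ?thesis using w by (simp add: growth_zero cls_eq_iff)
    qed
    have "\<not> (\<forall>\<^sub>F i in F. u i \<le> 0)" "\<not> (\<forall>\<^sub>F i in F. v i \<le> 0)"
      using xy u v zero[of u] zero[of v] by (auto simp: rlt_def)
    then have "\<forall>\<^sub>F i in F. \<not> u i \<le> 0" "\<forall>\<^sub>F i in F. \<not> v i \<le> 0" using ultrafilter_not[OF F] by blast+
    then have "\<forall>\<^sub>F i in F. \<not> u i * v i \<le> 0"
    proof eventually_elim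
      case (elim i)
      then show ?case using mult_pos_pos[of "u i" "v i"] by linarith
    qed
    then have "\<not> (\<forall>\<^sub>F i in F. u i * v i \<le> 0)" using ultrafilter_not[OF F] by blast
    then show "rlt ?S \<zero>\<^bsub>?S\<^esub> (x \<otimes>\<^bsub>?S\<^esub> y)"
      using zero[of "\<lambda>i. u i * v i"] u v unfolding rlt_def
      by (auto simp: growth_mult growth_zero growth_le intro!: eventually_le_apx_le)
  next
    have "\<not> apx_le F (\<lambda>_. 1) (\<lambda>_. 0)" using bot by (auto simp: apx_le_def intro: exI[of _ 1])
    then show "\<zero>\<^bsub>?S\<^esub> \<noteq> \<one>\<^bsub>?S\<^esub>" by (simp add: growth_zero growth_one cls_eq_iff)
  qed
  then interpret ordered_srig ?S .
  show ?thesis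
  proof unfold_locales
    fix x y z assume xyz: "x \<in> carrier ?S" "y \<in> carrier ?S" "z \<in> carrier ?S"
      and lt: "rlt ?S x y" and d: "dim ?S y = dim ?S z"
    obtain u v w where u: "\<And>i. 0 \<le> u i" "x = cls F u" and v: "\<And>i. 0 \<le> v i" "y = cls F v"
      and w: "\<And>i. 0 \<le> w i" "z = cls F w" using xyz by (metis growth_carrierE)
    have "\<exists>n::nat. rle ?S z ([n] \<cdot>\<^bsub>?S\<^esub> y)" using d xyz by (simp add: dim_eq_iff dominated_def)
    then obtain C where C: "\<forall>\<^sub>F i in F. w i \<le> C * v i"
      using growth_arch_le[OF bot, of w v] u v w by auto
    have "\<not> apx_le F v u" using lt u v le_antisym[of x y] xyz by (auto simp: rlt_def growth_le)
    then have "\<not> apx_le F (\<lambda>i. v i + w i) (\<lambda>i. u i + w i)"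
      using apx_le_add_cancel[OF F C, of u] u(1) v(1) w(1) by blast
    then show "rlt ?S (x \<oplus>\<^bsub>?S\<^esub> z) (y \<oplus>\<^bsub>?S\<^esub> z)"
      using not_le[of "y \<oplus>\<^bsub>?S\<^esub> z" "x \<oplus>\<^bsub>?S\<^esub> z"] xyz u v w
      by (simp add: growth_add growth_le growth_carrier)
  qed
qed

section \<open>Ultraproducts\<close>

locale ultra =
  fixes L :: "('f, 'r) lang" and Ms :: "'i \<Rightarrow> ('f, 'r, 'c) struct" and F :: "'i filter"
  assumes ultrafilter: "is_ultrafilter F" and structures: "\<And>i. is_structure L (Ms i)"
begin

abbreviation "U \<equiv> ultraproduct Ms F"
abbreviation "TU \<equiv> tuples (dom U)"

definition sections :: "('i \<Rightarrow> 'c) set" where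
  "sections = {u. \<forall>i. u i \<in> dom (Ms i)}"

definition cl :: "('i \<Rightarrow> 'c) \<Rightarrow> ('i \<Rightarrow> 'c) set" where
  "cl u = up_rel Ms F `` {u}"

text \<open>The coordinates at \<^term>\<open>i\<close> of a tuple of the ultraproduct.\<close>

definition pt :: "('i \<Rightarrow> 'c) set list \<Rightarrow> 'i \<Rightarrow> 'c list" where
  "pt a i = map (\<lambda>c. rep c i) a"

lemma F_nontrivial: "F \<noteq> bot"
  using ultrafilter by (simp add: is_ultrafilter_def)

lemma equiv_up_rel: "equiv sections (up_rel Ms F)"
proof (rule equivI)
  show "up_rel Ms F \<subseteq> sections \<times> sections" by (auto simp: up_rel_def sections_def)
  show "refl_on sections (up_rel Ms F)" by (auto simp: up_rel_def sections_def refl_on_def)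
  show "sym (up_rel Ms F)" by (auto simp: up_rel_def intro!: symI elim: eventually_mono)
  show "trans (up_rel Ms F)"
  proof (rule transI)
    fix u v w assume uv: "(u, v) \<in> up_rel Ms F" "(v, w) \<in> up_rel Ms F"
    then have "\<forall>\<^sub>F i in F. u i = v i" "\<forall>\<^sub>F i in F. v i = w i" by (auto simp: up_rel_def)
    then have "\<forall>\<^sub>F i in F. u i = w i" by eventually_elim simp
    then show "(u, w) \<in> up_rel Ms F" using uv by (simp add: up_rel_def)
  qed
qed

lemma dom_U: "dom U = sections // up_rel Ms F"
  by (simp add: ultraproduct_def sections_def)

lemma cl_in: "u \<in> sections \<Longrightarrow> cl u \<in> dom U"
  unfolding dom_U cl_def by (rule quotientI)

lemma rep_in:
  assumes "c \<in> dom U"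
  shows "rep c \<in> sections" "cl (rep c) = c"
proof -
  obtain u where u: "u \<in> sections" "c = up_rel Ms F `` {u}" using assms unfolding dom_U by (rule quotientE)
  then have "u \<in> c" using equiv_class_self[OF equiv_up_rel] by simp
  then have "rep c \<in> c" unfolding rep_def by (rule someI[where P = "\<lambda>u. u \<in> c"])
  then have *: "(u, rep c) \<in> up_rel Ms F" using u by simp
  then show "rep c \<in> sections" by (auto simp: up_rel_def sections_def)
  show "cl (rep c) = c" unfolding cl_def u(2) using equiv_class_eq[OF equiv_up_rel *] u(2) by simp
qed

lemma rep_dom: "c \<in> dom U \<Longrightarrow> rep c i \<in> dom (Ms i)"
  using rep_in(1) by (auto simp: sections_def)

lemma cl_eq_iff: "u \<in> sections \<Longrightarrow> v \<in> sections \<Longrightarrow> cl u = cl v \<longleftrightarrow> (\<forall>\<^sub>F i in F. u i = v i)"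
  unfolding cl_def using eq_equiv_class_iff[OF equiv_up_rel, of u v] by (auto simp: up_rel_def sections_def)

lemma rep_cl: "u \<in> sections \<Longrightarrow> \<forall>\<^sub>F i in F. rep (cl u) i = u i"
  using cl_eq_iff[of "rep (cl u)" u] rep_in[OF cl_in, of u] by simp

lemma eq_iff: "c \<in> dom U \<Longrightarrow> d \<in> dom U \<Longrightarrow> c = d \<longleftrightarrow> (\<forall>\<^sub>F i in F. rep c i = rep d i)"
  using cl_eq_iff[of "rep c" "rep d"] rep_in by metis

lemma is_structure_U: "is_structure L U"
  unfolding is_structure_def
proof (intro conjI allI impI ballI)
  have "\<exists>u. u \<in> dom (Ms i)" for i using structures[of i] by (auto simp: is_structure_def)
  then obtain u where "\<forall>i. u i \<in> dom (Ms i)" by metis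
  then have "cl u \<in> dom U" by (intro cl_in) (simp add: sections_def)
  then show "dom U \<noteq> {}" by blast
  fix f n xs assume "fun_ar L f = Some n" and xs: "xs \<in> TU n"
  then have "(\<lambda>i. fn (Ms i) f (map (\<lambda>c. rep c i) xs)) \<in> sections"
    using structures rep_dom unfolding sections_def is_structure_def by (fastforce simp: tuples_iff)
  then have "cl (\<lambda>i. fn (Ms i) f (map (\<lambda>c. rep c i) xs)) \<in> dom U" by (rule cl_in)
  then show "fn U f xs \<in> dom U" by (simp add: ultraproduct_def cl_def)
qed

lemma eval_trm_U:
  assumes "wf_trm L t" "\<And>j. j \<in> fv_trm t \<Longrightarrow> e j \<in> dom U"
  shows "eval_trm U e t \<in> dom U \<and>
    (\<forall>\<^sub>F i in F. rep (eval_trm U e t) i = eval_trm (Ms i) (\<lambda>j. rep (e j) i) t)"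
  using assms
proof (induction t)
  case (Fun f ts)
  let ?cs = "map (eval_trm U e) ts"
  have IH: "eval_trm U e t \<in> dom U"
    "\<forall>\<^sub>F i in F. rep (eval_trm U e t) i = eval_trm (Ms i) (\<lambda>j. rep (e j) i) t" if "t \<in> set ts" for t
    using Fun.IH[OF that] Fun.prems that by (auto simp: list_all_iff)
  have cs: "?cs \<in> TU (length ts)" using IH(1) by (auto simp: tuples_iff)
  have ar: "fun_ar L f = Some (length ts)" using Fun.prems by simp
  let ?w = "\<lambda>i. fn (Ms i) f (map (\<lambda>c. rep c i) ?cs)"
  have w: "?w \<in> sections"
    unfolding sections_def
  proof safe
    fix i
    have "map (\<lambda>c. rep c i) ?cs \<in> tuples (dom (Ms i)) (length ts)"
      using cs rep_dom by (fastforce simp: tuples_iff)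
    then show "?w i \<in> dom (Ms i)" using structures ar unfolding is_structure_def by blast
  qed
  have eval: "eval_trm U e (Fun f ts) = cl ?w" by (simp add: ultraproduct_def cl_def)
  have "\<forall>\<^sub>F i in F. \<forall>t \<in> set ts. rep (eval_trm U e t) i = eval_trm (Ms i) (\<lambda>j. rep (e j) i) t"
    using IH(2) by (intro eventually_ball_finite) auto
  then have "\<forall>\<^sub>F i in F. rep (cl ?w) i = eval_trm (Ms i) (\<lambda>j. rep (e j) i) (Fun f ts)"
    using rep_cl[OF w]
  proof eventually_elim
    case (elim i)
    have "map (\<lambda>c. rep c i) ?cs = map (eval_trm (Ms i) (\<lambda>j. rep (e j) i)) ts" using elim(1) by simp
    then show ?case by (simp only: elim(2) eval_trm.simps)
  qed
  then show ?case unfolding eval using cl_in[OF w] by simp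
qed simp

text \<open>
  This is the theorem of Los.  Only the values at the free variables have to lie in the ultraproduct,
  so that it applies to the environments \<^term>\<open>(!) a\<close> of tuples, which are arbitrary beyond their length.
\<close>

lemma sat_U:
  assumes "wf_fm L \<phi>" "\<And>j. j \<in> fv \<phi> \<Longrightarrow> e j \<in> dom U"
  shows "sat U e \<phi> \<longleftrightarrow> (\<forall>\<^sub>F i in F. sat (Ms i) (\<lambda>j. rep (e j) i) \<phi>)"
  using assms
proof (induction \<phi> arbitrary: e)
  case (Eq s t)
  have 1: "eval_trm U e s \<in> dom U" "\<forall>\<^sub>F i in F. rep (eval_trm U e s) i = eval_trm (Ms i) (\<lambda>j. rep (e j) i) s"
    and 2: "eval_trm U e t \<in> dom U" "\<forall>\<^sub>F i in F. rep (eval_trm U e t) i = eval_trm (Ms i) (\<lambda>j. rep (e j) i) t"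
    using eval_trm_U[of s e] eval_trm_U[of t e] Eq by auto
  have "sat U e (Eq s t) \<longleftrightarrow> (\<forall>\<^sub>F i in F. rep (eval_trm U e s) i = rep (eval_trm U e t) i)"
    using eq_iff[OF 1(1) 2(1)] by simp
  also have "\<dots> \<longleftrightarrow> (\<forall>\<^sub>F i in F. sat (Ms i) (\<lambda>j. rep (e j) i) (Eq s t))"
    by (rule eventually_subst) (use 1(2) 2(2) in eventually_elim, simp)
  finally show ?case .
next
  case (Rel r ts)
  let ?cs = "map (eval_trm U e) ts"
  have "\<forall>\<^sub>F i in F. \<forall>t \<in> set ts. rep (eval_trm U e t) i = eval_trm (Ms i) (\<lambda>j. rep (e j) i) t"
  proof (intro eventually_ball_finite ballI)
    fix t assume "t \<in> set ts"
    then show "\<forall>\<^sub>F i in F. rep (eval_trm U e t) i = eval_trm (Ms i) (\<lambda>j. rep (e j) i) t"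
      using eval_trm_U[of t e] Rel.prems by (auto simp: list_all_iff)
  qed simp
  then have "(\<forall>\<^sub>F i in F. rl (Ms i) r (map (\<lambda>c. rep c i) ?cs)) \<longleftrightarrow>
      (\<forall>\<^sub>F i in F. sat (Ms i) (\<lambda>j. rep (e j) i) (Rel r ts))"
  proof (intro eventually_subst, eventually_elim)
    case (elim i)
    then have "map (\<lambda>c. rep c i) ?cs = map (eval_trm (Ms i) (\<lambda>j. rep (e j) i)) ts" by simp
    then show ?case by (simp only: sat.simps)
  qed
  then show ?case by (simp add: ultraproduct_def)
next
  case (Neg p)
  then show ?case using ultrafilter_not[OF ultrafilter] by simp
next
  case (Conj p q)
  then show ?case by (simp add: eventually_conj_iff)
next
  case (Ex x p)
  have IH: "sat U (e(x := a)) p \<longleftrightarrow> (\<forall>\<^sub>F i in F. sat (Ms i) ((\<lambda>j. rep (e j) i)(x := rep a i)) p)"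
    if "a \<in> dom U" for a
  proof -
    have eq: "(\<lambda>j. rep ((e(x := a)) j) i) = (\<lambda>j. rep (e j) i)(x := rep a i)" for i by auto
    have "wf_fm L p" "\<And>j. j \<in> fv p \<Longrightarrow> (e(x := a)) j \<in> dom U" using Ex.prems that by auto
    then show ?thesis using Ex.IH[of "e(x := a)"] unfolding eq by blast
  qed
  show ?case
  proof
    assume "sat U e (Ex x p)"
    then obtain a where a: "a \<in> dom U" "\<forall>\<^sub>F i in F. sat (Ms i) ((\<lambda>j. rep (e j) i)(x := rep a i)) p"
      using IH by auto
    from a(2) show "\<forall>\<^sub>F i in F. sat (Ms i) (\<lambda>j. rep (e j) i) (Ex x p)"
      by eventually_elim (use rep_dom[OF a(1)] in auto)
  next
    assume ev: "\<forall>\<^sub>F i in F. sat (Ms i) (\<lambda>j. rep (e j) i) (Ex x p)"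
    have "\<exists>b. b \<in> dom (Ms i) \<and> (sat (Ms i) (\<lambda>j. rep (e j) i) (Ex x p) \<longrightarrow>
        sat (Ms i) ((\<lambda>j. rep (e j) i)(x := b)) p)" for i
      using structures[of i] unfolding sat.simps is_structure_def by blast
    then obtain w where w: "\<And>i. w i \<in> dom (Ms i)" "\<And>i. sat (Ms i) (\<lambda>j. rep (e j) i) (Ex x p) \<Longrightarrow>
        sat (Ms i) ((\<lambda>j. rep (e j) i)(x := w i)) p" by metis
    have ws: "w \<in> sections" using w(1) by (simp add: sections_def)
    from ev rep_cl[OF ws] have "\<forall>\<^sub>F i in F. sat (Ms i) ((\<lambda>j. rep (e j) i)(x := rep (cl w) i)) p"
      by eventually_elim (simp add: w(2))
    then show "sat U e (Ex x p)" using IH[OF cl_in[OF ws]] cl_in[OF ws] by auto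
  qed
qed

section \<open>Internal sets and their sizes\<close>

definition int_set :: "('i \<Rightarrow> 'c list set) \<Rightarrow> ('i \<Rightarrow> 'c) set list set" where
  "int_set A = {a. set a \<subseteq> dom U \<and> (\<forall>\<^sub>F i in F. pt a i \<in> A i)}"

definition bounded_arity :: "nat \<Rightarrow> ('i \<Rightarrow> 'c list set) \<Rightarrow> bool" where
  "bounded_arity n A \<longleftrightarrow> (\<forall>i. A i \<subseteq> tuples (dom (Ms i)) n)"

lemma length_pt [simp]: "length (pt a i) = length a"
  by (simp add: pt_def)

lemma pt_append: "pt (a @ b) i = pt a i @ pt b i"
  by (simp add: pt_def)

lemma pt_tuple: "a \<in> TU n \<Longrightarrow> pt a i \<in> tuples (dom (Ms i)) n"
  using rep_dom by (fastforce simp: pt_def tuples_iff)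

lemma int_set_mem: "a \<in> TU n \<Longrightarrow> a \<in> int_set A \<longleftrightarrow> (\<forall>\<^sub>F i in F. pt a i \<in> A i)"
  by (auto simp: int_set_def tuples_iff)

lemma int_set_arity:
  assumes "bounded_arity n A"
  shows "int_set A \<subseteq> TU n"
proof
  fix a assume a: "a \<in> int_set A"
  then have "\<forall>\<^sub>F i in F. length a = n"
    using assms by (auto simp: int_set_def bounded_arity_def tuples_iff elim!: eventually_mono)
      (metis length_pt subsetD tuples_iff)
  then show "a \<in> TU n" using a F_nontrivial by (simp add: int_set_def tuples_iff)
qed

lemma holds_U:
  assumes "frm L n \<phi>" "a \<in> TU n"
  shows "holds U \<phi> a \<longleftrightarrow> (\<forall>\<^sub>F i in F. holds (Ms i) \<phi> (pt a i))"
proof -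
  have "a ! j \<in> dom U" if "j < n" for j
    using assms(2) that nth_mem[of j a] by (auto simp: tuples_iff)
  then have 1: "holds U \<phi> a \<longleftrightarrow> (\<forall>\<^sub>F i in F. sat (Ms i) (\<lambda>j. rep (a ! j) i) \<phi>)"
    using assms(1) by (intro sat_U) (auto simp: frm_def)
  have 2: "sat (Ms i) (\<lambda>j. rep (a ! j) i) \<phi> \<longleftrightarrow> holds (Ms i) \<phi> (pt a i)" for i
    using assms by (intro sat_cong) (auto simp: frm_def tuples_iff pt_def)
  show ?thesis unfolding 1 2 ..
qed

lemma sols_U:
  assumes "part_fm L n m \<phi>" "b \<in> TU m"
  shows "sols U n \<phi> b = int_set (\<lambda>i. sols (Ms i) n \<phi> (pt b i))"
    and "bounded_arity n (\<lambda>i. sols (Ms i) n \<phi> (pt b i))"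
proof -
  show ba: "bounded_arity n (\<lambda>i. sols (Ms i) n \<phi> (pt b i))" by (auto simp: bounded_arity_def sols_iff)
  have "a \<in> sols U n \<phi> b \<longleftrightarrow> a \<in> int_set (\<lambda>i. sols (Ms i) n \<phi> (pt b i))" if a: "a \<in> TU n" for a
    using holds_U[of "n + m" \<phi> "a @ b"] assms tuples_append[OF a assms(2)] a pt_tuple[OF a]
    by (simp add: part_fm_iff sols_iff int_set_mem[OF a] pt_append)
  then show "sols U n \<phi> b = int_set (\<lambda>i. sols (Ms i) n \<phi> (pt b i))"
    using int_set_arity[OF ba] by (auto simp: sols_iff)
qed

text \<open>Every choice of tuples in the factors is, along the filter, a tuple of the ultraproduct.\<close>

lemma lift_tuple:
  assumes "\<And>i. w i \<in> tuples (dom (Ms i)) n"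
  obtains a where "a \<in> TU n" "\<forall>\<^sub>F i in F. pt a i = w i"
proof
  let ?u = "\<lambda>j i. w i ! j" and ?a = "map (\<lambda>j. cl (\<lambda>i. w i ! j)) [0..<n]"
  have u: "?u j \<in> sections" if "j < n" for j
    using assms that by (fastforce simp: sections_def tuples_iff)
  show "?a \<in> TU n" using cl_in[OF u] by (auto simp: tuples_iff)
  have "\<forall>\<^sub>F i in F. \<forall>j \<in> {..<n}. rep (cl (?u j)) i = ?u j i"
    using rep_cl[OF u] by (intro eventually_ball_finite) auto
  then show "\<forall>\<^sub>F i in F. pt ?a i = w i"
    by eventually_elim (use assms in \<open>auto simp: pt_def tuples_iff intro!: nth_equalityI\<close>)
qed

text \<open>
  A family of properties that holds, along the filter, at the coordinates of every tuple of the
  ultraproduct holds uniformly: otherwise counterexamples chosen in the factors form a tuple of the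
  ultraproduct.
\<close>

lemma eventually_all:
  assumes "\<And>a. a \<in> TU n \<Longrightarrow> \<forall>\<^sub>F i in F. P i (pt a i)"
  shows "\<forall>\<^sub>F i in F. \<forall>w \<in> tuples (dom (Ms i)) n. P i w"
proof -
  have "\<exists>w. w \<in> tuples (dom (Ms i)) n \<and> (P i w \<longrightarrow> (\<forall>w \<in> tuples (dom (Ms i)) n. P i w))" for i
  proof -
    obtain u where "u \<in> dom (Ms i)" using structures[of i] by (auto simp: is_structure_def)
    then have "replicate n u \<in> tuples (dom (Ms i)) n" by (auto simp: tuples_iff)
    then show ?thesis by blast
  qed
  then obtain w where w: "\<And>i. w i \<in> tuples (dom (Ms i)) n"
    "\<And>i. P i (w i) \<Longrightarrow> \<forall>w \<in> tuples (dom (Ms i)) n. P i w" by metis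
  obtain a where a: "a \<in> TU n" "\<forall>\<^sub>F i in F. pt a i = w i" using lift_tuple[of w n] w(1) by blast
  from assms[OF a(1)] a(2) show ?thesis by eventually_elim (use w(2) in simp)
qed

lemma eventually_imp:
  assumes "(\<forall>\<^sub>F i in F. P i) \<Longrightarrow> (\<forall>\<^sub>F i in F. Q i)"
  shows "\<forall>\<^sub>F i in F. P i \<longrightarrow> Q i"
proof (cases "\<forall>\<^sub>F i in F. P i")
  case True
  from assms[OF this] show ?thesis by eventually_elim simp
next
  case False
  then have "\<forall>\<^sub>F i in F. \<not> P i" using ultrafilter_not[OF ultrafilter] by blast
  then show ?thesis by eventually_elim simp
qed

lemma int_set_subset:
  assumes "bounded_arity n A" "int_set A \<subseteq> int_set B"
  shows "\<forall>\<^sub>F i in F. A i \<subseteq> B i"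
proof -
  have "\<forall>\<^sub>F i in F. \<forall>w \<in> tuples (dom (Ms i)) n. w \<in> A i \<longrightarrow> w \<in> B i"
  proof (rule eventually_all)
    fix a assume "a \<in> TU n"
    then show "\<forall>\<^sub>F i in F. pt a i \<in> A i \<longrightarrow> pt a i \<in> B i"
      using assms(2) by (intro eventually_imp) (auto simp flip: int_set_mem)
  qed
  then show ?thesis by eventually_elim (use assms(1) in \<open>auto simp: bounded_arity_def\<close>)
qed

lemma int_set_eq:
  assumes "bounded_arity n A" "bounded_arity m B" "int_set A = int_set B"
  shows "\<forall>\<^sub>F i in F. A i = B i"
proof -
  have "\<forall>\<^sub>F i in F. A i \<subseteq> B i" "\<forall>\<^sub>F i in F. B i \<subseteq> A i"
    using int_set_subset[OF assms(1), of B] int_set_subset[OF assms(2), of A] assms(3) by simp_all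
  then show ?thesis by eventually_elim simp
qed

definition size_of :: "('i \<Rightarrow> 'c list set) \<Rightarrow> ('i \<Rightarrow> real) set" where
  "size_of A = cls F (\<lambda>i. real (card (A i)))"

text \<open>An internal set determines its factors only along the filter, which suffices for their sizes.\<close>

definition msr :: "('i \<Rightarrow> 'c) set list set \<Rightarrow> ('i \<Rightarrow> real) set" where
  "msr X = (SOME s. \<exists>n A. bounded_arity n A \<and> X = int_set A \<and> s = size_of A)"

lemma msr_int_set:
  assumes "bounded_arity n A"
  shows "msr (int_set A) = size_of A"
proof -
  have "\<exists>s n' A'. bounded_arity n' A' \<and> int_set A = int_set A' \<and> s = size_of A'" using assms by blast
  then have "\<exists>n' A'. bounded_arity n' A' \<and> int_set A = int_set A' \<and> msr (int_set A) = size_of A'"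
    unfolding msr_def by (rule someI_ex)
  then obtain n' A' where A': "bounded_arity n' A'" "int_set A = int_set A'" "msr (int_set A) = size_of A'"
    by blast
  have "\<forall>\<^sub>F i in F. real (card (A i)) = real (card (A' i))"
    using int_set_eq[OF assms A'(1,2)] by eventually_elim simp
  then show ?thesis unfolding A'(3) size_of_def by (intro eventually_eq_cls[symmetric]) auto
qed

sublocale U: definability L U .

lemma definable_internal:
  assumes "U.D n X"
  obtains A where "bounded_arity n A" "X = int_set A"
proof -
  obtain m \<phi> b where "part_fm L n m \<phi>" "b \<in> TU m" "X = sols U n \<phi> b"
    using assms by (auto simp: definable_over_def)
  then show thesis using that sols_U by blast
qed

end

locale finite_ultra = ultra L Ms F
  for L :: "('f, 'r) lang" and Ms :: "'i \<Rightarrow> ('f, 'r, 'c) struct" and F :: "'i filter" +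
  assumes finite_structures: "\<And>i. finite (dom (Ms i))"
begin

sublocale S: measuring_semiring "growth_semiring F"
  by (rule growth_measuring_semiring[OF ultrafilter])

lemma finite_internal: "bounded_arity n A \<Longrightarrow> finite (A i)"
  using finite_tuples[OF finite_structures] finite_subset unfolding bounded_arity_def by metis

lemma size_of_closed: "size_of A \<in> carrier (growth_semiring F)"
  unfolding size_of_def by (intro growth_carrier) simp

lemma msr_closed: "U.D n X \<Longrightarrow> msr X \<in> carrier (growth_semiring F)"
  by (metis definable_internal msr_int_set size_of_closed)

lemma msr_Un:
  assumes "U.D n X" "U.D n Y" "X \<inter> Y = {}"
  shows "msr (X \<union> Y) = msr X \<oplus>\<^bsub>growth_semiring F\<^esub> msr Y"
proof -
  obtain A where A: "bounded_arity n A" "X = int_set A" using definable_internal[OF assms(1)] .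
  obtain B where B: "bounded_arity n B" "Y = int_set B" using definable_internal[OF assms(2)] .
  have AB: "bounded_arity n (\<lambda>i. A i \<union> B i)" "bounded_arity n (\<lambda>i. A i \<inter> B i)"
    using A B by (auto simp: bounded_arity_def)
  have "X \<union> Y = int_set (\<lambda>i. A i \<union> B i)"
    using ultrafilter_disj[OF ultrafilter] by (auto simp: A B int_set_def)
  then have 1: "msr (X \<union> Y) = size_of (\<lambda>i. A i \<union> B i)" using msr_int_set[OF AB(1)] by simp
  have "int_set (\<lambda>i. A i \<inter> B i) \<subseteq> int_set (\<lambda>i. {})"
    using assms(3) by (auto simp: A B int_set_def eventually_conj_iff)
  then have "\<forall>\<^sub>F i in F. A i \<inter> B i \<subseteq> {}" using int_set_subset[OF AB(2)] by blast
  then have "\<forall>\<^sub>F i in F. real (card (A i \<union> B i)) = real (card (A i)) + real (card (B i))"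
  proof eventually_elim
    case (elim i)
    then show ?case using card_Un_disjoint[OF finite_internal[OF A(1)] finite_internal[OF B(1)]] by simp
  qed
  then have "size_of (\<lambda>i. A i \<union> B i) = cls F (\<lambda>i. real (card (A i)) + real (card (B i)))"
    unfolding size_of_def by (intro eventually_eq_cls) auto
  also have "\<dots> = size_of A \<oplus>\<^bsub>growth_semiring F\<^esub> size_of B" unfolding size_of_def by (simp add: growth_add)
  finally show ?thesis using 1 msr_int_set[OF A(1)] msr_int_set[OF B(1)] A B by simp
qed

lemma msr_singleton:
  assumes a: "a \<in> TU n"
  shows "msr {a} = \<one>\<^bsub>growth_semiring F\<^esub>"
proof -
  let ?A = "\<lambda>i. {pt a i}"
  have A: "bounded_arity n ?A" using pt_tuple[OF a] by (auto simp: bounded_arity_def)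
  have "b = a" if b: "b \<in> int_set ?A" for b
  proof -
    have bT: "b \<in> TU n" using int_set_arity[OF A] b by blast
    have l: "length a = n" "length b = n" using a bT by (auto simp: tuples_iff)
    have ev: "\<forall>\<^sub>F i in F. pt b i = pt a i" using b by (simp add: int_set_def)
    have "b ! j = a ! j" if "j < n" for j
    proof -
      have "\<forall>\<^sub>F i in F. rep (b ! j) i = rep (a ! j) i"
        using ev by eventually_elim (use l that in \<open>metis (no_types, lifting) nth_map pt_def\<close>)
      moreover have "b ! j \<in> dom U" "a ! j \<in> dom U" using a bT that by (auto simp: tuples_iff)
      ultimately show ?thesis using eq_iff by blast
    qed
    then show ?thesis using l by (intro nth_equalityI) auto
  qed
  moreover have "a \<in> int_set ?A" using a by (simp add: int_set_def tuples_iff)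
  ultimately have "int_set ?A = {a}" by blast
  then have "msr {a} = size_of ?A" using msr_int_set[OF A] by simp
  then show ?thesis by (simp add: size_of_def growth_one)
qed

lemma msr_finite:
  assumes "U.D n X" "finite X"
  shows "msr X = [card X] \<cdot>\<^bsub>growth_semiring F\<^esub> \<one>\<^bsub>growth_semiring F\<^esub>"
  by (rule U.measure_of_finite[OF S.measuring_semiring_axioms msr_Un
        msr_closed[OF definable_empty] msr_singleton assms])

text \<open>
  Along the filter the factors of the graph are graphs of functions, whose fibres have, uniformly,
  nearly \<^term>\<open>u i\<close> elements.  Counting the domain by fibres gives nearly \<^term>\<open>u i\<close> times the
  size of the codomain.  The uniformity comes from \<^emph>\<open>eventually_all\<close>, applied to the points of the
  codomain.
\<close>

lemma msr_map:
  assumes p: "definable_map L U X Y p" and f: "f \<in> carrier (growth_semiring F)"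
    and fib: "\<And>a. a \<in> Y \<Longrightarrow> msr {x \<in> X. p x = a} = f"
  shows "msr X = f \<otimes>\<^bsub>growth_semiring F\<^esub> msr Y"
proof -
  obtain u where u: "\<And>i. 0 \<le> u i" "f = cls F u" using f by (metis growth_carrierE)
  let ?G = "{a @ p a | a. a \<in> X}"
  obtain n m where D: "U.D n X" "U.D m Y" "U.D (n + m) ?G" and pXY: "p \<in> X \<rightarrow> Y"
    using U.definable_mapE[OF p] .
  obtain A where A: "bounded_arity n A" "X = int_set A" using definable_internal[OF D(1)] .
  obtain B where B: "bounded_arity m B" "Y = int_set B" using definable_internal[OF D(2)] .
  obtain C where C: "bounded_arity (n + m) C" "?G = int_set C" using definable_internal[OF D(3)] .
  have G: "(\<forall>\<^sub>F i in F. pt x i @ pt y i \<in> C i) \<longleftrightarrow> x \<in> X \<and> p x = y" if "x \<in> TU n" "y \<in> TU m" for x y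
    using U.graph_mem[OF D(1) that(1) refl, of y p] int_set_mem[OF tuples_append[OF that], of C]
    unfolding C(2) by (simp add: pt_append)
  have X: "(\<forall>\<^sub>F i in F. pt x i \<in> A i) \<longleftrightarrow> x \<in> X" if "x \<in> TU n" for x
    using int_set_mem[OF that] A(2) by simp
  have Y: "(\<forall>\<^sub>F i in F. pt y i \<in> B i) \<longleftrightarrow> y \<in> Y" if "y \<in> TU m" for y
    using int_set_mem[OF that] B(2) by simp
  let ?fib = "\<lambda>i y. {x \<in> tuples (dom (Ms i)) n. x @ y \<in> C i}"
  have 1: "\<forall>\<^sub>F i in F. \<forall>z \<in> tuples (dom (Ms i)) (n + m). z \<in> C i \<longrightarrow> take n z \<in> A i \<and> drop n z \<in> B i"
  proof (rule eventually_all)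
    fix z assume "z \<in> TU (n + m)"
    then obtain x y where z: "z = x @ y" "x \<in> TU n" "y \<in> TU m" by (rule tuples_split)
    have "length x = n" using z by (simp add: tuples_iff)
    then have pz: "take n (pt z i) = pt x i" "drop n (pt z i) = pt y i" "pt z i = pt x i @ pt y i" for i
      by (simp_all add: z pt_append)
    show "\<forall>\<^sub>F i in F. pt z i \<in> C i \<longrightarrow> take n (pt z i) \<in> A i \<and> drop n (pt z i) \<in> B i"
      unfolding pz(1,2) unfolding pz(3)
    proof (rule eventually_imp)
      assume "\<forall>\<^sub>F i in F. pt x i @ pt y i \<in> C i"
      then have "x \<in> X" "p x = y" using G z by auto
      then have "\<forall>\<^sub>F i in F. pt x i \<in> A i" "\<forall>\<^sub>F i in F. pt y i \<in> B i"
        using X[OF z(2)] Y[OF z(3)] pXY by auto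
      then show "\<forall>\<^sub>F i in F. pt x i \<in> A i \<and> pt y i \<in> B i" by (rule eventually_conj)
    qed
  qed
  have 2: "\<forall>\<^sub>F i in F. \<forall>x \<in> tuples (dom (Ms i)) n. x \<in> A i \<longrightarrow> (\<exists>y \<in> tuples (dom (Ms i)) m. x @ y \<in> C i)"
  proof (rule eventually_all)
    fix x assume x: "x \<in> TU n"
    show "\<forall>\<^sub>F i in F. pt x i \<in> A i \<longrightarrow> (\<exists>y \<in> tuples (dom (Ms i)) m. pt x i @ y \<in> C i)"
    proof (rule eventually_imp)
      assume "\<forall>\<^sub>F i in F. pt x i \<in> A i"
      then have xX: "x \<in> X" using X x by blast
      then have y: "p x \<in> TU m" using pXY U.D_arity[OF D(2)] by blast
      then have "\<forall>\<^sub>F i in F. pt x i @ pt (p x) i \<in> C i" using G[OF x y] xX by simp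
      then show "\<forall>\<^sub>F i in F. \<exists>y \<in> tuples (dom (Ms i)) m. pt x i @ y \<in> C i"
        by eventually_elim (use pt_tuple[OF y] in blast)
    qed
  qed
  have 3: "\<forall>\<^sub>F i in F. \<forall>z \<in> tuples (dom (Ms i)) (n + (m + m)).
      take n z @ take m (drop n z) \<in> C i \<and> take n z @ drop m (drop n z) \<in> C i \<longrightarrow>
      take m (drop n z) = drop m (drop n z)"
  proof (rule eventually_all)
    fix z assume "z \<in> TU (n + (m + m))"
    then obtain x yy where z1: "z = x @ yy" "x \<in> TU n" "yy \<in> TU (m + m)" by (rule tuples_split)
    from z1(3) obtain y y' where z2: "yy = y @ y'" "y \<in> TU m" "y' \<in> TU m" by (rule tuples_split)
    have "length x = n" "length y = m" using z1 z2 by (simp_all add: tuples_iff)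
    then have pz: "take n (pt z i) = pt x i" "take m (drop n (pt z i)) = pt y i" "drop m (drop n (pt z i)) = pt y' i" for i
      by (simp_all add: z1 z2 pt_append)
    show "\<forall>\<^sub>F i in F. take n (pt z i) @ take m (drop n (pt z i)) \<in> C i \<and> take n (pt z i) @ drop m (drop n (pt z i)) \<in> C i \<longrightarrow>
      take m (drop n (pt z i)) = drop m (drop n (pt z i))"
      unfolding pz
    proof (rule eventually_imp)
      assume "\<forall>\<^sub>F i in F. pt x i @ pt y i \<in> C i \<and> pt x i @ pt y' i \<in> C i"
      then have "p x = y" "p x = y'" using G[OF z1(2) z2(2)] G[OF z1(2) z2(3)] by (auto simp: eventually_conj_iff)
      then show "\<forall>\<^sub>F i in F. pt y i = pt y' i" by simp
    qed
  qed
  have 4: "\<forall>\<^sub>F i in F. card (A i) = (\<Sum>y\<in>B i. card (?fib i y))"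
    using 1 2 3
  proof eventually_elim
    case (elim i)
    let ?T = "tuples (dom (Ms i))"
    have AB: "A i \<subseteq> ?T n" "B i \<subseteq> ?T m" using A B by (auto simp: bounded_arity_def)
    have e1: "x \<in> A i \<and> y \<in> B i" if "x \<in> ?T n" "y \<in> ?T m" "x @ y \<in> C i" for x y
    proof -
      have "length x = n" using that by (simp add: tuples_iff)
      then show ?thesis using elim(1)[rule_format, OF tuples_append[OF that(1,2)] that(3)] by simp
    qed
    have e3: "y = y'" if "x \<in> ?T n" "y \<in> ?T m" "y' \<in> ?T m" "x @ y \<in> C i" "x @ y' \<in> C i" for x y y'
    proof -
      have "length x = n" "length y = m" using that by (simp_all add: tuples_iff)
      then show ?thesis
        using elim(3)[rule_format, OF tuples_append[OF that(1) tuples_append[OF that(2,3)]]] that(4,5) by simp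
    qed
    have "A i = (\<Union>y\<in>B i. ?fib i y)"
    proof
      show "A i \<subseteq> (\<Union>y\<in>B i. ?fib i y)"
      proof
        fix x assume x: "x \<in> A i"
        then have xT: "x \<in> ?T n" using AB by blast
        then obtain y where y: "y \<in> ?T m" "x @ y \<in> C i" using elim(2) x by blast
        then show "x \<in> (\<Union>y\<in>B i. ?fib i y)" using e1[OF xT y] xT by blast
      qed
      show "(\<Union>y\<in>B i. ?fib i y) \<subseteq> A i"
      proof
        fix x assume "x \<in> (\<Union>y\<in>B i. ?fib i y)"
        then obtain y where "y \<in> B i" "x \<in> ?T n" "x @ y \<in> C i" by blast
        then show "x \<in> A i" using e1[of x y] AB by blast
      qed
    qed
    moreover have "card (\<Union>y\<in>B i. ?fib i y) = (\<Sum>y\<in>B i. card (?fib i y))"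
    proof (rule card_UN_disjoint)
      show "finite (B i)" by (rule finite_internal[OF B(1)])
      show "\<forall>y\<in>B i. finite (?fib i y)" using finite_tuples[OF finite_structures, of i n] by simp
      show "\<forall>y\<in>B i. \<forall>y'\<in>B i. y \<noteq> y' \<longrightarrow> ?fib i y \<inter> ?fib i y' = {}"
      proof (intro ballI impI)
        fix y y' assume y: "y \<in> B i" "y' \<in> B i" "y \<noteq> y'"
        then have "y \<in> ?T m" "y' \<in> ?T m" using AB by auto
        then show "?fib i y \<inter> ?fib i y' = {}" using e3[of _ y y'] y(3) by blast
      qed
    qed
    ultimately show ?case by simp
  qed
  have fib': "\<forall>\<^sub>F i in F. \<forall>y \<in> tuples (dom (Ms i)) m. y \<in> B i \<longrightarrow>
      real (card (?fib i y)) \<le> (1 + \<epsilon>) * u i \<and> u i \<le> (1 + \<epsilon>) * real (card (?fib i y))" if \<epsilon>: "\<epsilon> > 0" for \<epsilon>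
  proof (rule eventually_all)
    fix y assume y: "y \<in> TU m"
    show "\<forall>\<^sub>F i in F. pt y i \<in> B i \<longrightarrow> real (card (?fib i (pt y i))) \<le> (1 + \<epsilon>) * u i \<and>
        u i \<le> (1 + \<epsilon>) * real (card (?fib i (pt y i)))"
    proof (rule eventually_imp)
      assume "\<forall>\<^sub>F i in F. pt y i \<in> B i"
      then have yY: "y \<in> Y" using Y y by blast
      have ba: "bounded_arity n (\<lambda>i. ?fib i (pt y i))" by (auto simp: bounded_arity_def)
      have "x \<in> {x \<in> X. p x = y} \<longleftrightarrow> x \<in> int_set (\<lambda>i. ?fib i (pt y i))" if x: "x \<in> TU n" for x
        using G[OF x y] int_set_mem[OF x] pt_tuple[OF x] by simp
      then have "{x \<in> X. p x = y} = int_set (\<lambda>i. ?fib i (pt y i))"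
        using U.D_arity[OF D(1)] int_set_arity[OF ba] by blast
      then have "size_of (\<lambda>i. ?fib i (pt y i)) = cls F u"
        using fib[OF yY] msr_int_set[OF ba] u(2) by simp
      then have "apx_le F (\<lambda>i. real (card (?fib i (pt y i)))) u" "apx_le F u (\<lambda>i. real (card (?fib i (pt y i))))"
        unfolding size_of_def using u(1) by (simp_all add: cls_eq_iff)
      from eventually_conj[OF apx_leD[OF this(1) \<epsilon>] apx_leD[OF this(2) \<epsilon>]]
      show "\<forall>\<^sub>F i in F. real (card (?fib i (pt y i))) \<le> (1 + \<epsilon>) * u i \<and>
        u i \<le> (1 + \<epsilon>) * real (card (?fib i (pt y i)))" .
    qed
  qed
  have "apx_le F (\<lambda>i. real (card (A i))) (\<lambda>i. u i * real (card (B i)))"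
    unfolding apx_le_def
  proof (intro allI impI)
    fix \<epsilon> :: real assume "\<epsilon> > 0"
    from 4 fib'[OF this] show "\<forall>\<^sub>F i in F. real (card (A i)) \<le> (1 + \<epsilon>) * (u i * real (card (B i)))"
    proof eventually_elim
      case (elim i)
      have "real (card (A i)) = (\<Sum>y\<in>B i. real (card (?fib i y)))" using elim(1) by simp
      also have "\<dots> \<le> (\<Sum>y\<in>B i. (1 + \<epsilon>) * u i)"
        using elim(2) B(1) by (intro sum_mono) (auto simp: bounded_arity_def)
      finally show ?case by (simp add: algebra_simps)
    qed
  qed
  moreover have "apx_le F (\<lambda>i. u i * real (card (B i))) (\<lambda>i. real (card (A i)))"
    unfolding apx_le_def
  proof (intro allI impI)
    fix \<epsilon> :: real assume "\<epsilon> > 0"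
    from 4 fib'[OF this] show "\<forall>\<^sub>F i in F. u i * real (card (B i)) \<le> (1 + \<epsilon>) * real (card (A i))"
    proof eventually_elim
      case (elim i)
      have "u i * real (card (B i)) = (\<Sum>y\<in>B i. u i)" by simp
      also have "\<dots> \<le> (\<Sum>y\<in>B i. (1 + \<epsilon>) * real (card (?fib i y)))"
        using elim(2) B(1) by (intro sum_mono) (auto simp: bounded_arity_def)
      also have "\<dots> = (1 + \<epsilon>) * real (card (A i))" using elim(1) by (simp add: sum_distrib_left)
      finally show ?case .
    qed
  qed
  ultimately have "size_of A = cls F (\<lambda>i. u i * real (card (B i)))"
    unfolding size_of_def using u(1) by (simp add: cls_eq_iff)
  also have "\<dots> = f \<otimes>\<^bsub>growth_semiring F\<^esub> size_of B" unfolding size_of_def u(2) using u(1) by (simp add: growth_mult)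
  finally show ?thesis using msr_int_set[OF A(1)] msr_int_set[OF B(1)] A B by simp
qed

end

section \<open>Definability of sizes in finite structures\<close>

text \<open>
  Having at least \<^term>\<open>k + 1\<close> elements means having at least \<^term>\<open>k\<close> elements other than some
  element \<^term>\<open>z\<close>; the induction works on all families at once because \<^term>\<open>z\<close> becomes a parameter.
\<close>

lemma dp_card_ge:
  assumes "finite (dom M)" "dp L M {} (n + m) P"
  shows "dp L M {} m (\<lambda>b. k \<le> card {x \<in> tuples (dom M) n. P (x @ b)})"
  using assms(2)
proof (induction k arbitrary: m P)
  case 0
  show ?case by (rule dp_cong[OF dp_not[OF dp_False]]) simp
next
  case (Suc k)
  let ?T = "tuples (dom M)"
  let ?js = "[0..<n] @ [n + m..<n + m + n]"
  define P' where "P' d \<longleftrightarrow> P (take (n + m) d) \<and> \<not> (\<lambda>w. take n w = drop n w) (map ((!) d) ?js)" for d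
  have P': "P' (x @ b @ z) \<longleftrightarrow> P (x @ b) \<and> x \<noteq> z" if "x \<in> ?T n" "b \<in> ?T m" "z \<in> ?T n" for x b z
  proof -
    have l: "length x = n" "length b = m" "length z = n" using that by (auto simp: tuples_iff)
    have "map ((!) (x @ b @ z)) ?js = x @ z" using block_0[OF l(1), of "b @ z"] block_2[OF l] by simp
    moreover have "take (n + m) (x @ b @ z) = x @ b" using l by simp
    ultimately show ?thesis using l by (simp add: P'_def)
  qed
  have "dp L M {} (n + m + n) P'"
    unfolding P'_def by (intro dp_conj dp_take dp_not dp_coords[OF dp_eq] Suc.prems) auto
  then have "dp L M {} (m + n) (\<lambda>c. k \<le> card {x \<in> ?T n. P' (x @ c)})"
    by (intro Suc.IH) (simp add: add.assoc)
  moreover have "dp L M {} (m + n) (\<lambda>c. P (map ((!) c) ([m..<m + n] @ [0..<m])))"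
    by (rule dp_coords[OF Suc.prems]) auto
  ultimately have "dp L M {} m (\<lambda>b. \<exists>z \<in> ?T n. P (map ((!) (b @ z)) ([m..<m + n] @ [0..<m])) \<and>
      k \<le> card {x \<in> ?T n. P' (x @ b @ z)})"
    using dp_ex[OF dp_conj] by fastforce
  then show ?case
  proof (rule dp_cong)
    fix b assume b: "b \<in> ?T m"
    let ?X = "{x \<in> ?T n. P (x @ b)}"
    have fin: "finite ?X" using finite_tuples[OF assms(1), of n] by simp
    have "P (map ((!) (b @ z)) ([m..<m + n] @ [0..<m])) \<and> k \<le> card {x \<in> ?T n. P' (x @ b @ z)} \<longleftrightarrow>
        P (z @ b) \<and> k \<le> card (?X - {z})" if z: "z \<in> ?T n" for z
    proof -
      have l: "length b = m" "length z = n" using b z by (auto simp: tuples_iff)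
      have "map ((!) (b @ z)) ([m..<m + n] @ [0..<m]) = z @ b"
        using block_0[OF l(1), of z] block_1[OF l, of "[]"] by simp
      moreover have "{x \<in> ?T n. P' (x @ b @ z)} = ?X - {z}" using P' b z by blast
      ultimately show ?thesis by (simp only:)
    qed
    then have "(\<exists>z \<in> ?T n. P (map ((!) (b @ z)) ([m..<m + n] @ [0..<m])) \<and>
        k \<le> card {x \<in> ?T n. P' (x @ b @ z)}) \<longleftrightarrow> (\<exists>z \<in> ?X. k \<le> card (?X - {z}))"
      by blast
    also have "\<dots> \<longleftrightarrow> Suc k \<le> card ?X"
    proof
      assume "\<exists>z \<in> ?X. k \<le> card (?X - {z})"
      then obtain z where "z \<in> ?X" "k \<le> card (?X - {z})" by blast
      then show "Suc k \<le> card ?X" using card_Suc_Diff1[OF fin, of z] by simp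
    next
      assume k: "Suc k \<le> card ?X"
      then have "0 < card ?X" by simp
      then have "?X \<noteq> {}" using card_gt_0_iff by blast
      then obtain z where "z \<in> ?X" by blast
      then show "\<exists>z \<in> ?X. k \<le> card (?X - {z})" using k card_Suc_Diff1[OF fin, of z] by (intro bexI[of _ z]) simp_all
    qed
    finally show "(\<exists>z \<in> ?T n. P (map ((!) (b @ z)) ([m..<m + n] @ [0..<m])) \<and>
        k \<le> card {x \<in> ?T n. P' (x @ b @ z)}) \<longleftrightarrow> Suc k \<le> card ?X" .
  qed
qed

lemma dp_card_eq:
  assumes "finite (dom M)" "part_fm L n m \<phi>"
  shows "dp L M {} m (\<lambda>b. card (sols M n \<phi> b) = k)"
proof -
  have \<phi>: "dp L M {} (n + m) (holds M \<phi>)" using assms(2) by (simp add: part_fm_iff dp_holds)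
  have "{x \<in> tuples (dom M) n. holds M \<phi> (x @ b)} = sols M n \<phi> b" for b by (auto simp: sols_iff)
  then have "dp L M {} m (\<lambda>b. j \<le> card (sols M n \<phi> b))" for j
    using dp_card_ge[OF assms(1) \<phi>, of j] by simp
  then have "dp L M {} m (\<lambda>b. k \<le> card (sols M n \<phi> b) \<and> \<not> Suc k \<le> card (sols M n \<phi> b))"
    by (intro dp_conj dp_not)
  then show ?thesis by (rule dp_cong) auto
qed

section \<open>Ultraproducts of multidimensional asymptotic classes\<close>

lemma apx_le_of_abs:
  assumes "\<And>\<epsilon>. \<epsilon> > 0 \<Longrightarrow> \<forall>\<^sub>F i in F. \<bar>u i - v i\<bar> \<le> \<epsilon> * v i" "\<And>i. 0 \<le> v i" "\<And>i. 0 \<le> u i"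
  shows "apx_le F u v" "apx_le F v u"
proof -
  show "apx_le F u v"
    unfolding apx_le_def
  proof (intro allI impI)
    fix \<epsilon> :: real assume "\<epsilon> > 0"
    from assms(1)[OF this] show "\<forall>\<^sub>F i in F. u i \<le> (1 + \<epsilon>) * v i"
      by eventually_elim (simp add: distrib_right)
  qed
  show "apx_le F v u"
    unfolding apx_le_def
  proof (intro allI impI)
    fix \<delta> :: real assume \<delta>: "\<delta> > 0"
    (* This makes (1 + \<delta>) * (1 - \<epsilon>) equal to one. *)
    define \<epsilon> where "\<epsilon> = \<delta> / (1 + \<delta>)"
    have "\<epsilon> > 0" using \<delta> by (simp add: \<epsilon>_def)
    from assms(1)[OF this] show "\<forall>\<^sub>F i in F. v i \<le> (1 + \<delta>) * u i"
    proof eventually_elim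
      case (elim i)
      then have "v i * (1 - \<epsilon>) \<le> u i" by (simp add: algebra_simps)
      then have "(1 + \<delta>) * (v i * (1 - \<epsilon>)) \<le> (1 + \<delta>) * u i" using \<delta> by (intro mult_left_mono) auto
      moreover have "(1 + \<delta>) * (1 - \<epsilon>) = 1"
      proof -
        have "(1 + \<delta>) * \<epsilon> = \<delta>" using \<delta> by (simp add: \<epsilon>_def)
        then show ?thesis by (simp add: right_diff_distrib)
      qed
      then have "(1 + \<delta>) * (v i * (1 - \<epsilon>)) = v i" by (metis mult.commute mult.left_commute mult_1)
      ultimately show ?case by simp
    qed
  qed
qed

locale mac_ultra = finite_ultra L Ms F
  for L :: "('f, 'r) lang" and Ms :: "'i \<Rightarrow> ('f, 'r, 'c) struct" and F :: "'i filter" +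
  fixes C :: "('f, 'r, 'c) struct set" and R :: "(('f, 'r, 'c) struct \<Rightarrow> real) set"
  assumes mac: "is_mac L C R" and factors: "\<And>i. Ms i \<in> C"
begin

abbreviation large :: bool where
  "large \<equiv> \<forall>Q. \<forall>\<^sub>F i in F. Q < card (dom (Ms i))"

lemma nonneg: "g \<in> R \<Longrightarrow> 0 \<le> g (Ms i)"
  using mac factors by (simp add: is_mac_def)

text \<open>
  As there are finitely many parts, the coordinates of a parameter lie in one part along the
  ultrafilter.  The function that approximates the sizes on this part then gives the measure of the
  set defined with the parameter.
\<close>

lemma large_family:
  assumes large: large and \<phi>: "part_fm L n m \<phi>"
  obtains \<P> :: "(('f, 'r, 'c) struct \<times> 'c list) set set" and g \<psi> where "finite \<P>" "\<forall>\<pi> \<in> \<P>. g \<pi> \<in> R \<and> frm L m (\<psi> \<pi>)"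
    "\<forall>b \<in> TU m. \<exists>\<pi> \<in> \<P>. holds U (\<psi> \<pi>) b"
    "\<forall>b \<in> TU m. \<forall>\<pi> \<in> \<P>. holds U (\<psi> \<pi>) b \<longrightarrow> msr (sols U n \<phi> b) = cls F (\<lambda>i. g \<pi> (Ms i))"
proof -
  have "\<exists>\<P> h. finite \<P> \<and> partition_on (pointed C m) \<P> \<and>
           (\<forall>\<pi> \<in> \<P>. h \<pi> \<in> R \<and>
              (\<exists>\<psi>. part_fm L m 0 \<psi> \<and> \<pi> = {(M, b) \<in> pointed C m. b \<in> sols M m \<psi> []}) \<and>
              (\<forall>\<epsilon> > 0. \<exists>Q. \<forall>(M, b) \<in> \<pi>. card (dom M) > Q \<longrightarrow>
                 \<bar>real (card (sols M n \<phi> b)) - h \<pi> M\<bar> \<le> \<epsilon> * h \<pi> M))"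
    using mac \<phi> unfolding is_mac_def by blast
  then obtain \<P> g where \<P>: "finite \<P>" "partition_on (pointed C m) \<P>"
    and "\<forall>\<pi> \<in> \<P>. g \<pi> \<in> R \<and> (\<exists>\<psi>. part_fm L m 0 \<psi> \<and> \<pi> = {(M, b) \<in> pointed C m. b \<in> sols M m \<psi> []}) \<and>
              (\<forall>\<epsilon> > 0. \<exists>Q. \<forall>(M, b) \<in> \<pi>. card (dom M) > Q \<longrightarrow>
                 \<bar>real (card (sols M n \<phi> b)) - g \<pi> M\<bar> \<le> \<epsilon> * g \<pi> M)"
    by (elim exE conjE)
  then have g: "\<And>\<pi>. \<pi> \<in> \<P> \<Longrightarrow> g \<pi> \<in> R"
    and def: "\<forall>\<pi> \<in> \<P>. \<exists>\<psi>. part_fm L m 0 \<psi> \<and> \<pi> = {(M, b) \<in> pointed C m. b \<in> sols M m \<psi> []}"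
    and apx: "\<And>\<pi>. \<pi> \<in> \<P> \<Longrightarrow> \<forall>\<epsilon> > 0. \<exists>Q. \<forall>(M, b) \<in> \<pi>. card (dom M) > Q \<longrightarrow>
                 \<bar>real (card (sols M n \<phi> b)) - g \<pi> M\<bar> \<le> \<epsilon> * g \<pi> M"
    by simp_all
  from bchoice[OF def] obtain \<psi>
    where \<psi>: "\<forall>\<pi> \<in> \<P>. part_fm L m 0 (\<psi> \<pi>) \<and> \<pi> = {(M, b) \<in> pointed C m. b \<in> sols M m (\<psi> \<pi>) []}" ..
  have pt: "(Ms i, pt b i) \<in> pointed C m" if "b \<in> TU m" for b i
    using factors pt_tuple[OF that] by (simp add: pointed_def)
  have mem: "(Ms i, pt b i) \<in> \<pi> \<longleftrightarrow> holds (Ms i) (\<psi> \<pi>) (pt b i)" if "b \<in> TU m" "\<pi> \<in> \<P>" for b \<pi> i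
  proof -
    have "\<pi> = {(M, b) \<in> pointed C m. b \<in> sols M m (\<psi> \<pi>) []}" using \<psi> that(2) by blast
    then have "(Ms i, pt b i) \<in> \<pi> \<longleftrightarrow> (Ms i, pt b i) \<in> {(M, b) \<in> pointed C m. b \<in> sols M m (\<psi> \<pi>) []}"
      by simp
    then show ?thesis using pt[OF that(1)] pt_tuple[OF that(1)] by (simp add: sols_iff)
  qed
  have frm: "frm L m (\<psi> \<pi>)" if "\<pi> \<in> \<P>" for \<pi> using \<psi> that by (simp add: part_fm_iff)
  have U: "holds U (\<psi> \<pi>) b \<longleftrightarrow> (\<forall>\<^sub>F i in F. (Ms i, pt b i) \<in> \<pi>)" if "b \<in> TU m" "\<pi> \<in> \<P>" for b \<pi>
    using holds_U[OF frm[OF that(2)] that(1)] mem[OF that] by simp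
  show thesis
  proof (rule that[OF \<P>(1)])
    show "\<forall>\<pi> \<in> \<P>. g \<pi> \<in> R \<and> frm L m (\<psi> \<pi>)" using g frm by blast
    show "\<forall>b \<in> TU m. \<exists>\<pi> \<in> \<P>. holds U (\<psi> \<pi>) b"
    proof
      fix b assume b: "b \<in> TU m"
      have "\<exists>\<pi> \<in> \<P>. (Ms i, pt b i) \<in> \<pi>" for i using pt[OF b, of i] \<P>(2) by (auto simp: partition_on_def)
      then have "\<exists>\<pi> \<in> \<P>. \<forall>\<^sub>F i in F. (Ms i, pt b i) \<in> \<pi>"
        by (intro ultrafilter_bex[OF ultrafilter \<P>(1)] always_eventually allI)
      then show "\<exists>\<pi> \<in> \<P>. holds U (\<psi> \<pi>) b" using U[OF b] by blast
    qed
    show "\<forall>b \<in> TU m. \<forall>\<pi> \<in> \<P>. holds U (\<psi> \<pi>) b \<longrightarrow> msr (sols U n \<phi> b) = cls F (\<lambda>i. g \<pi> (Ms i))"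
    proof (intro ballI impI)
      fix b \<pi> assume b: "b \<in> TU m" and \<pi>: "\<pi> \<in> \<P>" and holds: "holds U (\<psi> \<pi>) b"
      let ?A = "\<lambda>i. sols (Ms i) n \<phi> (pt b i)"
      have ev: "\<forall>\<^sub>F i in F. (Ms i, pt b i) \<in> \<pi>" using U[OF b \<pi>] holds by blast
      have nn: "0 \<le> g \<pi> (Ms i)" for i using nonneg g \<pi> by blast
      have "\<forall>\<^sub>F i in F. \<bar>real (card (?A i)) - g \<pi> (Ms i)\<bar> \<le> \<epsilon> * g \<pi> (Ms i)" if "\<epsilon> > 0" for \<epsilon>
      proof -
        obtain Q where "\<forall>(M, b) \<in> \<pi>. card (dom M) > Q \<longrightarrow> \<bar>real (card (sols M n \<phi> b)) - g \<pi> M\<bar> \<le> \<epsilon> * g \<pi> M"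
          using apx[OF \<pi>] \<open>\<epsilon> > 0\<close> by blast
        with ev large[rule_format, of Q] show ?thesis by (auto elim: eventually_elim2)
      qed
      from apx_le_of_abs[OF this] have "size_of ?A = cls F (\<lambda>i. g \<pi> (Ms i))"
        unfolding size_of_def using nn by (simp add: cls_eq_iff)
      then show "msr (sols U n \<phi> b) = cls F (\<lambda>i. g \<pi> (Ms i))"
        using msr_int_set[OF sols_U(2)[OF \<phi> b]] sols_U(1)[OF \<phi> b] by simp
    qed
  qed
qed

text \<open>
  Finitely many distinct elements of the ultraproduct have distinct coordinates in some factor of
  bounded size, so the same bound holds for their number.
\<close>

lemma finite_U:
  assumes "\<not> large"
  shows "finite (dom U)"
proof -
  obtain Q where "\<not> (\<forall>\<^sub>F i in F. Q < card (dom (Ms i)))" using assms by blast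
  then have Q: "\<forall>\<^sub>F i in F. \<not> Q < card (dom (Ms i))" using ultrafilter_not[OF ultrafilter] by blast
  have "card G \<le> Q" if G: "G \<subseteq> dom U" "finite G" for G
  proof -
    have "\<forall>\<^sub>F i in F. \<forall>c \<in> G. \<forall>d \<in> G. c \<noteq> d \<longrightarrow> rep c i \<noteq> rep d i"
    proof (intro eventually_ball_finite G(2) ballI)
      fix c d assume cd: "c \<in> G" "d \<in> G"
      show "\<forall>\<^sub>F i in F. c \<noteq> d \<longrightarrow> rep c i \<noteq> rep d i"
      proof (cases "c = d")
        case False
        then have "\<not> (\<forall>\<^sub>F i in F. rep c i = rep d i)" using eq_iff[of c d] cd G by blast
        then show ?thesis using ultrafilter_not[OF ultrafilter] by (auto elim: eventually_mono)
      qed simp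
    qed
    with Q have "\<forall>\<^sub>F i in F. card G \<le> Q"
    proof eventually_elim
      case (elim i)
      have "inj_on (\<lambda>c. rep c i) G" using elim(2) by (auto simp: inj_on_def)
      moreover have "(\<lambda>c. rep c i) ` G \<subseteq> dom (Ms i)" using rep_dom G by blast
      ultimately have "card G \<le> card (dom (Ms i))" using card_inj_on_le finite_structures by blast
      then show ?case using elim(1) by simp
    qed
    then show ?thesis using F_nontrivial by simp
  qed
  then show ?thesis using finite_if_finite_subsets_card_bdd by blast
qed

text \<open>
  If the sizes of the factors tend to infinity along the filter, then the parts of the partition
  define the values; otherwise the ultraproduct is finite and sizes are definable by counting.
\<close>

lemma msr_family:
  assumes \<phi>: "part_fm L n m \<phi>"
  shows "finite ((\<lambda>b. msr (sols U n \<phi> b)) ` TU m) \<and> dp L U {} m (\<lambda>b. msr (sols U n \<phi> b) = f)"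
proof (cases large)
  case True
  obtain \<P> :: "(('f, 'r, 'c) struct \<times> 'c list) set set" and g \<psi> where \<P>: "finite \<P>" "\<forall>\<pi> \<in> \<P>. g \<pi> \<in> R \<and> frm L m (\<psi> \<pi>)"
    "\<forall>b \<in> TU m. \<exists>\<pi> \<in> \<P>. holds U (\<psi> \<pi>) b"
    "\<forall>b \<in> TU m. \<forall>\<pi> \<in> \<P>. holds U (\<psi> \<pi>) b \<longrightarrow> msr (sols U n \<phi> b) = cls F (\<lambda>i. g \<pi> (Ms i))"
    by (rule large_family[OF True \<phi>])
  have "(\<lambda>b. msr (sols U n \<phi> b)) ` TU m \<subseteq> (\<lambda>\<pi>. cls F (\<lambda>i. g \<pi> (Ms i))) ` \<P>"
    using \<P>(3,4) by fastforce
  then have fin: "finite ((\<lambda>b. msr (sols U n \<phi> b)) ` TU m)" using \<P>(1) finite_surj by blast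
  let ?Q = "{\<pi> \<in> \<P>. cls F (\<lambda>i. g \<pi> (Ms i)) = f}"
  have "dp L U {} m (\<lambda>b. \<exists>\<pi> \<in> ?Q. holds U (\<psi> \<pi>) b)"
    using \<P>(1,2) by (intro dp_finite_disj dp_holds) auto
  then have "dp L U {} m (\<lambda>b. msr (sols U n \<phi> b) = f)"
  proof (rule dp_cong)
    fix b assume b: "b \<in> TU m"
    then obtain \<pi> where \<pi>: "\<pi> \<in> \<P>" "holds U (\<psi> \<pi>) b" using \<P>(3) by blast
    show "(\<exists>\<pi> \<in> ?Q. holds U (\<psi> \<pi>) b) \<longleftrightarrow> msr (sols U n \<phi> b) = f"
      using bspec[OF \<P>(4) b] \<pi> by auto
  qed
  then show ?thesis using fin by blast
next
  case False
  then have U: "finite (dom U)" by (rule finite_U)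
  let ?e = "\<lambda>k::nat. [k] \<cdot>\<^bsub>growth_semiring F\<^esub> \<one>\<^bsub>growth_semiring F\<^esub>"
  have msr: "msr (sols U n \<phi> b) = ?e (card (sols U n \<phi> b))" and fin: "finite (sols U n \<phi> b)"
    and bound: "card (sols U n \<phi> b) \<le> card (TU n)" if "b \<in> TU m" for b
  proof -
    have sub: "sols U n \<phi> b \<subseteq> TU n" by (auto simp: sols_iff)
    then show fin: "finite (sols U n \<phi> b)" using finite_tuples[OF U] finite_subset by blast
    show "card (sols U n \<phi> b) \<le> card (TU n)" using sub finite_tuples[OF U] card_mono by blast
    have "U.D n (sols U n \<phi> b)" using \<phi> that by (auto simp: definable_over_def)
    then show "msr (sols U n \<phi> b) = ?e (card (sols U n \<phi> b))" using msr_finite fin by blast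
  qed
  have "dp L U {} m (\<lambda>b. \<exists>k \<in> {k. k \<le> card (TU n) \<and> ?e k = f}. card (sols U n \<phi> b) = k)"
    by (intro dp_finite_disj dp_card_eq[OF U \<phi>]) simp
  then have "dp L U {} m (\<lambda>b. msr (sols U n \<phi> b) = f)"
    by (rule dp_cong) (use msr bound in auto)
  then show ?thesis using finite_tuples[OF U] by blast
qed

lemma is_measure_msr: "is_measure L U (growth_semiring F) msr"
  by (rule U.is_measureI[OF S.measuring_semiring_axioms msr_closed msr_Un msr_singleton
        msr_family[THEN conjunct1] msr_family[THEN conjunct2] msr_map])

end

section \<open>Well-ordered dimensions\<close>

lemma nat_mono_subseq:
  fixes s :: "nat \<Rightarrow> nat"
  obtains r :: "nat \<Rightarrow> nat" where "strict_mono r" "mono (\<lambda>n. s (r n))"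
proof -
  obtain r where r: "strict_mono r" "monoseq (\<lambda>n. s (r n))" using seq_monosub by blast
  show thesis
  proof (cases "mono (\<lambda>n. s (r n))")
    case True
    then show thesis using that[OF r(1)] by blast
  next
    case False
    then have dec: "\<And>i j. i \<le> j \<Longrightarrow> s (r j) \<le> s (r i)" using r(2) by (auto simp: monoseq_def monotone_def)
    define v where "v = (LEAST v. \<exists>n. v = s (r n))"
    have "\<exists>n. v = s (r n)" unfolding v_def by (rule LeastI_ex) blast
    then obtain N where N: "v = s (r N)" by blast
    have "s (r (N + n)) = v" for n
      using dec[of N "N + n"] N Least_le[of "\<lambda>v. \<exists>n. v = s (r n)" "s (r (N + n))"] by (fastforce simp: v_def)
    then have "mono (\<lambda>n. s (r (N + n)))" by (simp add: monotone_def)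
    moreover have "strict_mono (\<lambda>n. r (N + n))" using r(1) by (auto simp: strict_mono_def)
    ultimately show thesis using that by blast
  qed
qed

text \<open>Successive passage to subsequences makes every coordinate nondecreasing.\<close>

lemma dickson:
  fixes f :: "nat \<Rightarrow> nat \<Rightarrow> nat"
  shows "\<exists>i j. i < j \<and> (\<forall>l<k. f i l \<le> f j l)"
proof -
  have "\<exists>r :: nat \<Rightarrow> nat. strict_mono r \<and> (\<forall>l<k. mono (\<lambda>n. f (r n) l))"
  proof (induction k)
    case 0
    show ?case by (intro exI[of _ id]) (auto simp: strict_mono_def)
  next
    case (Suc k)
    then obtain r :: "nat \<Rightarrow> nat" where r: "strict_mono r" "\<forall>l<k. mono (\<lambda>n. f (r n) l)" by blast
    obtain q :: "nat \<Rightarrow> nat" where q: "strict_mono q" "mono (\<lambda>n. f (r (q n)) k)" using nat_mono_subseq[of "\<lambda>n. f (r n) k"] .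
    have qm: "mono q" using q(1) by (rule strict_mono_mono)
    have "mono (\<lambda>n. f (r (q n)) l)" if "l < k" for l
      using r(2) that qm by (auto simp: monotone_def)
    then have "\<forall>l<Suc k. mono (\<lambda>n. f (r (q n)) l)" using q(2) by (auto simp: less_Suc_eq)
    moreover have "strict_mono (\<lambda>n. r (q n))" using r(1) q(1) by (auto simp: strict_mono_def)
    ultimately show ?case by blast
  qed
  then obtain r :: "nat \<Rightarrow> nat" where r: "strict_mono r" "\<forall>l<k. mono (\<lambda>n. f (r n) l)" by blast
  have "r 0 < r 1" using r(1) by (auto simp: strict_mono_def)
  moreover have "\<forall>l<k. f (r 0) l \<le> f (r 1) l" using r(2) by (auto simp: monotone_def)
  ultimately show ?thesis by blast
qed

text \<open>
  In a strictly descending sequence of dimensions no term is dominated by a later one.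
\<close>

lemma (in ordered_srig) well_order_dim:
  assumes V: "V \<subseteq> carrier S"
    and good: "\<And>s :: nat \<Rightarrow> 's. (\<And>n. s n \<in> V) \<Longrightarrow> \<exists>i j. i < j \<and> dominated (s i) (s j)"
  shows "well_order_on (dim S ` V) (Restr (dim_order S) (dim S ` V))"
  unfolding well_order_on_def
proof (intro conjI linear_dim_order[OF V])
  let ?r = "Restr (dim_order S) (dim S ` V)"
  show "wf (?r - Id)"
    unfolding wf_iff_no_infinite_down_chain
  proof
    assume "\<exists>f. \<forall>i. (f (Suc i), f i) \<in> ?r - Id"
    then obtain f where f: "\<And>i. (f (Suc i), f i) \<in> ?r - Id" by blast
    have "\<exists>v. v \<in> V \<and> f i = dim S v" for i using f[of i] by blast
    then obtain s where s: "\<And>i. s i \<in> V" "\<And>i. f i = dim S (s i)" by metis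
    have c: "s i \<in> carrier S" for i using s V by blast
    have step: "dominated (s (Suc i)) (s i)" "\<not> dominated (s i) (s (Suc i))" for i
      using f[of i] dim_order_iff[OF c c, of "Suc i" i] dim_eq_iff[OF c c, of "Suc i" i] by (auto simp: s)
    have down: "dominated (s (i + n)) (s i)" for i n
    proof (induction n)
      case 0
      then show ?case by (simp add: dominated_refl c)
    next
      case (Suc n)
      then show ?case using step(1)[of "i + n"] dominated_trans c by (metis add_Suc_right)
    qed
    obtain i j where ij: "i < j" "dominated (s i) (s j)" using good[of s] s by blast
    have "dominated (s j) (s (Suc i))" using down[of "Suc i" "j - Suc i"] ij by simp
    then have "dominated (s i) (s (Suc i))" using ij(2) dominated_trans c by blast
    then show False using step(2) by blast
  qed
qed

lemma root_le_two_mult: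
  assumes "r > 0" "0 \<le> y" "x \<le> 2 * y"
  shows "root r x \<le> 2 * root r y"
proof -
  have "(2::real) \<le> 2 ^ r" using assms(1) self_le_power[of "2::real" r] by simp
  then have "x \<le> 2 ^ r * y" using assms(2,3) mult_right_mono[of 2 "2 ^ r" y] by simp
  then have "root r x \<le> root r (2 ^ r * y)" using assms(1) by simp
  also have "\<dots> = 2 * root r y" using assms(1) by (simp add: real_root_mult real_root_power_cancel)
  finally show ?thesis .
qed

text \<open>
  The monomial with exponents \<^term>\<open>e\<close> in the first \<^term>\<open>k\<close> variables; a plain function as
  exponent vector lets the sequences of Dickson's lemma be compared pointwise.
\<close>

definition mval :: "nat \<Rightarrow> (nat \<Rightarrow> real) \<Rightarrow> (nat \<Rightarrow> nat) \<Rightarrow> real" where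
  "mval k x e = (\<Prod>j<k. x j ^ e j)"

lemma mval_nonneg: "(\<And>j. j < k \<Longrightarrow> 0 \<le> x j) \<Longrightarrow> 0 \<le> mval k x e"
  unfolding mval_def by (intro prod_nonneg) auto

lemma mval_le:
  assumes "\<And>j. j < k \<Longrightarrow> 0 \<le> x j" "\<And>j. j < k \<Longrightarrow> x j \<le> 2 * y j"
  shows "mval k x e \<le> 2 ^ (\<Sum>j<k. e j) * mval k y e"
proof -
  have "mval k x e \<le> (\<Prod>j<k. (2 * y j) ^ e j)"
    unfolding mval_def
  proof (rule prod_mono)
    fix j assume "j \<in> {..<k}"
    then show "0 \<le> x j ^ e j \<and> x j ^ e j \<le> (2 * y j) ^ e j"
      using assms by (intro conjI zero_le_power power_mono) auto
  qed
  also have "\<dots> = 2 ^ (\<Sum>j<k. e j) * mval k y e"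
    by (simp add: mval_def power_mult_distrib prod.distrib power_sum)
  finally show ?thesis .
qed

lemma mval_mono:
  assumes "\<And>j. j < k \<Longrightarrow> 1 \<le> x j" "\<And>j. j < k \<Longrightarrow> e j \<le> e' j"
  shows "mval k x e \<le> mval k x e'"
  unfolding mval_def
proof (rule prod_mono)
  fix j assume "j \<in> {..<k}"
  then have "1 \<le> x j" "e j \<le> e' j" using assms by auto
  then show "0 \<le> x j ^ e j \<and> x j ^ e j \<le> x j ^ e' j" by (simp add: power_increasing)
qed

lemma mpoly_eval_mval:
  assumes "mpoly_vars p \<subseteq> {..<k}"
  shows "mpoly_eval p x = (\<Sum>m \<in> Poly_Mapping.keys p. Poly_Mapping.lookup p m * mval k x (Poly_Mapping.lookup m))"
  unfolding mpoly_eval_def mval_def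
proof (intro sum.cong refl arg_cong2[where f = "(*)"] prod.mono_neutral_left)
  fix m assume "m \<in> Poly_Mapping.keys p"
  then show "Poly_Mapping.keys m \<subseteq> {..<k}" using assms by (auto simp: mpoly_vars_def)
qed (auto simp: in_keys_iff)

lemma lookup_mpoly_abs: "Poly_Mapping.lookup (mpoly_abs p) m = \<bar>Poly_Mapping.lookup p m\<bar>"
  by (simp add: mpoly_abs_def Poly_Mapping.map.rep_eq when_def)

lemma keys_mpoly_abs: "Poly_Mapping.keys (mpoly_abs p) = Poly_Mapping.keys p"
  by (auto simp: in_keys_iff lookup_mpoly_abs)

lemma mpoly_abs_eval_mval:
  assumes "mpoly_vars p \<subseteq> {..<k}"
  shows "mpoly_eval (mpoly_abs p) x =
    (\<Sum>m \<in> Poly_Mapping.keys p. \<bar>Poly_Mapping.lookup p m\<bar> * mval k x (Poly_Mapping.lookup m))"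
proof -
  have "mpoly_vars (mpoly_abs p) \<subseteq> {..<k}" using assms by (simp add: mpoly_vars_def keys_mpoly_abs)
  then show ?thesis by (simp add: mpoly_eval_mval keys_mpoly_abs lookup_mpoly_abs)
qed

context mac_ultra
begin

lemma dominated_cls:
  "(\<And>i. 0 \<le> u i) \<Longrightarrow> (\<And>i. 0 \<le> v i) \<Longrightarrow>
    S.dominated (cls F u) (cls F v) \<longleftrightarrow> (\<exists>C. \<forall>\<^sub>F i in F. u i \<le> C * v i)"
  unfolding S.dominated_def by (rule growth_arch_le[OF F_nontrivial])

text \<open>
  If every nonzero measure has the dimension of a monomial in fixed functions that are at least one,
  then dimensions are well-ordered by Dickson's lemma, since such monomials grow with the exponents.
\<close>

lemma well_order_of_monomials:
  assumes x: "\<And>i j. 1 \<le> x i j"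
    and monomial: "\<And>X. X \<in> Def L U \<Longrightarrow> msr X = \<zero>\<^bsub>growth_semiring F\<^esub> \<or>
      (\<exists>e. S.dominated (msr X) (cls F (\<lambda>i. mval k (x i) e)) \<and> S.dominated (cls F (\<lambda>i. mval k (x i) e)) (msr X))"
  shows "well_order_on (dims L U (growth_semiring F) msr)
    (Restr (dim_order (growth_semiring F)) (dims L U (growth_semiring F) msr))"
proof -
  let ?S = "growth_semiring F" and ?W = "\<lambda>e. cls F (\<lambda>i. mval k (x i) e)"
  let ?V = "msr ` Def L U"
  have x0: "0 \<le> x i j" for i j using x[of i j] by simp
  have W0: "0 \<le> mval k (x i) e" for i e using x0 by (intro mval_nonneg)
  have V: "?V \<subseteq> carrier ?S" using msr_closed by (auto simp: Def_iff)
  have Wc: "?W e \<in> carrier ?S" for e using W0 by (intro growth_carrier)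
  have Wle: "S.dominated (?W e) (?W e')" if "\<forall>j<k. e j \<le> e' j" for e e'
  proof -
    have "mval k (x i) e \<le> 1 * mval k (x i) e'" for i using mval_mono[of k "x i" e e'] x that by simp
    then have "\<forall>\<^sub>F i in F. mval k (x i) e \<le> 1 * mval k (x i) e'" by (intro always_eventually allI)
    then show ?thesis
      using dominated_cls[of "\<lambda>i. mval k (x i) e" "\<lambda>i. mval k (x i) e'"] W0 by blast
  qed
  have "well_order_on (dim ?S ` ?V) (Restr (dim_order ?S) (dim ?S ` ?V))"
  proof (rule S.well_order_dim[OF V])
    fix s :: "nat \<Rightarrow> ('i \<Rightarrow> real) set" assume s: "\<And>n. s n \<in> ?V"
    have sc: "s n \<in> carrier ?S" for n using s V by blast
    show "\<exists>i j. i < j \<and> S.dominated (s i) (s j)"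
    proof (cases "\<exists>n. s n = \<zero>\<^bsub>?S\<^esub>")
      case True
      then obtain n where "s n = \<zero>\<^bsub>?S\<^esub>" ..
      then have "S.dominated (s n) (s (Suc n))"
        using S.zero_least[OF sc] sc[of "Suc n"] by (intro S.le_dominated) auto
      then show ?thesis by blast
    next
      case False
      have "\<exists>e. S.dominated (s n) (?W e) \<and> S.dominated (?W e) (s n)" for n
      proof -
        obtain X where "X \<in> Def L U" "s n = msr X" using s[of n] by blast
        then show ?thesis using monomial[of X] False by auto
      qed
      then obtain e where e: "\<And>n. S.dominated (s n) (?W (e n))" "\<And>n. S.dominated (?W (e n)) (s n)" by metis
      obtain i j where ij: "i < j" "\<forall>l<k. e i l \<le> e j l" using dickson[of k e] by blast
      have "S.dominated (s i) (?W (e j))" using S.dominated_trans[OF e(1) Wle[OF ij(2)]] sc Wc by blast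
      then have "S.dominated (s i) (s j)" using S.dominated_trans[OF _ e(2)] sc Wc by blast
      then show ?thesis using ij(1) by blast
    qed
  qed
  moreover have "dims L U ?S msr = dim ?S ` ?V" by (auto simp: dims_def)
  ultimately show ?thesis by simp
qed

text \<open>
  Without cancellation a polynomial is, up to a constant factor, the largest of its monomials.  The
  choice of the tuples at which the balanced formulas are evaluated only matters up to a factor two
  for each variable.
\<close>

lemma polynomial_dimension:
  assumes pp: "poly_presentation L C R Dt" and nc: "no_cancellation C R Dt" and large: large
    and a0: "\<And>i. admissible Dt (Ms i) (a0 i)"
    and x_def: "x = (\<lambda>i j. max 1 (coords Dt (Ms i) (a0 i) j))"
    and g: "g \<in> R"
  shows "cls F (\<lambda>i. g (Ms i)) = \<zero>\<^bsub>growth_semiring F\<^esub> \<or>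
    (\<exists>e. S.dominated (cls F (\<lambda>i. g (Ms i))) (cls F (\<lambda>i. mval (num Dt) (x i) e)) \<and>
         S.dominated (cls F (\<lambda>i. mval (num Dt) (x i) e)) (cls F (\<lambda>i. g (Ms i))))"
proof -
  let ?k = "num Dt" and ?p = "pol Dt g"
  let ?K = "Poly_Mapping.keys ?p" and ?c = "Poly_Mapping.lookup ?p"
  let ?ex = "Poly_Mapping.lookup :: (nat \<Rightarrow>\<^sub>0 nat) \<Rightarrow> nat \<Rightarrow> nat"
  have vars: "mpoly_vars ?p \<subseteq> {..<?k}" using pp g by (simp add: poly_presentation_def)
  have delta: "part_fm L (xlen Dt j) (ylen Dt j) (delta Dt j)" "balanced C (xlen Dt j) (ylen Dt j) (delta Dt j)"
    "rt Dt j > 0" if "j < ?k" for j using pp that by (simp_all add: poly_presentation_def)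
  have coords_ge: "1 \<le> coords Dt (Ms i) a j" if "admissible Dt (Ms i) a" "j < ?k" for i a j
  proof -
    let ?X = "sols (Ms i) (xlen Dt j) (delta Dt j) (a j)"
    have "?X \<subseteq> tuples (dom (Ms i)) (xlen Dt j)" by (auto simp: sols_iff)
    then have "finite ?X" using finite_tuples[OF finite_structures] finite_subset by blast
    moreover have "?X \<noteq> {}" using that by (simp add: admissible_def)
    ultimately have "1 \<le> card ?X" by (simp add: Suc_leI card_gt_0_iff)
    then show ?thesis using delta(3)[OF that(2)] by (simp add: coords_def)
  qed
  have x1: "1 \<le> x i j" for i j by (simp add: x_def)
  have x_eq: "x i j = coords Dt (Ms i) (a0 i) j" if "j < ?k" for i j
    using coords_ge[OF a0 that] by (simp add: x_def)
  have x0: "0 \<le> x i j" for i j using x1[of i j] by simp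
  have W0: "0 \<le> mval ?k (x i) e" for i e using x0 by (intro mval_nonneg)
  have g0: "0 \<le> g (Ms i)" for i using nonneg[OF g] .
  have near: "\<forall>\<^sub>F i in F. \<forall>a b. admissible Dt (Ms i) a \<longrightarrow> admissible Dt (Ms i) b \<longrightarrow>
      (\<forall>j<?k. coords Dt (Ms i) a j \<le> 2 * coords Dt (Ms i) b j)"
  proof -
    have "\<forall>\<^sub>F i in F. \<forall>j \<in> {..<?k}. \<forall>a b. admissible Dt (Ms i) a \<longrightarrow> admissible Dt (Ms i) b \<longrightarrow>
        coords Dt (Ms i) a j \<le> 2 * coords Dt (Ms i) b j"
    proof (intro eventually_ball_finite ballI)
      fix j assume "j \<in> {..<?k}"
      then have j: "j < ?k" by simp
      let ?N = "\<lambda>M a. real (card (sols M (xlen Dt j) (delta Dt j) a))"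
      obtain Q where Q: "\<forall>M \<in> C. card (dom M) > Q \<longrightarrow>
        (\<forall>a \<in> tuples (dom M) (ylen Dt j). \<forall>b \<in> tuples (dom M) (ylen Dt j).
           sols M (xlen Dt j) (delta Dt j) a \<noteq> {} \<and> sols M (xlen Dt j) (delta Dt j) b \<noteq> {} \<longrightarrow>
           \<bar>?N M a - ?N M b\<bar> < 1 * ?N M b)"
        using delta(2)[OF j] unfolding balanced_def by (meson zero_less_one)
      from large have "\<forall>\<^sub>F i in F. Q < card (dom (Ms i))" by blast
      then show "\<forall>\<^sub>F i in F. \<forall>a b. admissible Dt (Ms i) a \<longrightarrow> admissible Dt (Ms i) b \<longrightarrow>
        coords Dt (Ms i) a j \<le> 2 * coords Dt (Ms i) b j"
      proof eventually_elim
        case (elim i)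
        show ?case
        proof (intro allI impI)
          fix a b assume ab: "admissible Dt (Ms i) a" "admissible Dt (Ms i) b"
          then have "\<bar>?N (Ms i) (a j) - ?N (Ms i) (b j)\<bar> < 1 * ?N (Ms i) (b j)"
            using Q factors[of i] elim j by (simp add: admissible_def)
          then have "?N (Ms i) (a j) \<le> 2 * ?N (Ms i) (b j)" by simp
          then show "coords Dt (Ms i) a j \<le> 2 * coords Dt (Ms i) b j"
            unfolding coords_def by (intro root_le_two_mult delta(3)[OF j]) auto
        qed
      qed
    qed simp
    then show ?thesis by eventually_elim auto
  qed
  obtain c Q where "\<forall>M \<in> C. card (dom M) > Q \<longrightarrow> (\<exists>a. admissible Dt M a \<and> g M = mpoly_eval ?p (coords Dt M a) \<and>
      mpoly_eval (mpoly_abs ?p) (coords Dt M a) \<le> c * g M)"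
    using nc g unfolding no_cancellation_def by blast
  then have val: "\<forall>\<^sub>F i in F. \<exists>a. admissible Dt (Ms i) a \<and> g (Ms i) = mpoly_eval ?p (coords Dt (Ms i) a) \<and>
      mpoly_eval (mpoly_abs ?p) (coords Dt (Ms i) a) \<le> c * g (Ms i)"
    using large[rule_format, of Q] factors by (auto elim: eventually_mono)
  have "\<forall>\<^sub>F i in F. \<exists>y. (\<forall>j<?k. 0 \<le> y j \<and> y j \<le> 2 * x i j \<and> x i j \<le> 2 * y j) \<and>
      g (Ms i) \<le> (\<Sum>m\<in>?K. \<bar>?c m\<bar> * mval ?k y (?ex m)) \<and> (\<Sum>m\<in>?K. \<bar>?c m\<bar> * mval ?k y (?ex m)) \<le> c * g (Ms i)"
    using near val
  proof eventually_elim
    case (elim i)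
    then obtain a where a: "admissible Dt (Ms i) a" "g (Ms i) = mpoly_eval ?p (coords Dt (Ms i) a)"
      "mpoly_eval (mpoly_abs ?p) (coords Dt (Ms i) a) \<le> c * g (Ms i)" by blast
    let ?y = "coords Dt (Ms i) a"
    have y0: "0 \<le> ?y j" if "j < ?k" for j using coords_ge[OF a(1) that] by simp
    have "\<forall>j<?k. 0 \<le> ?y j \<and> ?y j \<le> 2 * x i j \<and> x i j \<le> 2 * ?y j"
      using elim(1) a(1) a0[of i] y0 x_eq by simp
    moreover have "g (Ms i) \<le> (\<Sum>m\<in>?K. \<bar>?c m\<bar> * mval ?k ?y (?ex m))"
      unfolding a(2) mpoly_eval_mval[OF vars]
      using y0 by (intro sum_mono mult_right_mono mval_nonneg) auto
    moreover have "(\<Sum>m\<in>?K. \<bar>?c m\<bar> * mval ?k ?y (?ex m)) \<le> c * g (Ms i)"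
      using a(3) by (simp add: mpoly_abs_eval_mval[OF vars])
    ultimately show ?case by blast
  qed
  then have val': "\<forall>\<^sub>F i in F. g (Ms i) \<le> (\<Sum>m\<in>?K. \<bar>?c m\<bar> * (2 ^ (\<Sum>j<?k. ?ex m j) * mval ?k (x i) (?ex m))) \<and>
      (\<forall>m\<in>?K. \<bar>?c m\<bar> * mval ?k (x i) (?ex m) \<le> 2 ^ (\<Sum>j<?k. ?ex m j) * (c * g (Ms i)))"
  proof eventually_elim
    case (elim i)
    then obtain y where y: "\<forall>j<?k. 0 \<le> y j \<and> y j \<le> 2 * x i j \<and> x i j \<le> 2 * y j"
      and u: "g (Ms i) \<le> (\<Sum>m\<in>?K. \<bar>?c m\<bar> * mval ?k y (?ex m))"
      and l: "(\<Sum>m\<in>?K. \<bar>?c m\<bar> * mval ?k y (?ex m)) \<le> c * g (Ms i)" by blast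
    have "(\<Sum>m\<in>?K. \<bar>?c m\<bar> * mval ?k y (?ex m)) \<le> (\<Sum>m\<in>?K. \<bar>?c m\<bar> * (2 ^ (\<Sum>j<?k. ?ex m j) * mval ?k (x i) (?ex m)))"
      using y by (intro sum_mono mult_left_mono mval_le) auto
    moreover have "\<bar>?c m\<bar> * mval ?k (x i) (?ex m) \<le> 2 ^ (\<Sum>j<?k. ?ex m j) * (c * g (Ms i))" if m: "m \<in> ?K" for m
    proof -
      have y0: "0 \<le> \<bar>?c m\<bar> * mval ?k y (?ex m)" for m using y by (intro mult_nonneg_nonneg mval_nonneg) auto
      have "\<bar>?c m\<bar> * mval ?k (x i) (?ex m) \<le> \<bar>?c m\<bar> * (2 ^ (\<Sum>j<?k. ?ex m j) * mval ?k y (?ex m))"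
        using y x0 by (intro mult_left_mono mval_le) auto
      also have "\<dots> = 2 ^ (\<Sum>j<?k. ?ex m j) * (\<bar>?c m\<bar> * mval ?k y (?ex m))" by simp
      also have "\<dots> \<le> 2 ^ (\<Sum>j<?k. ?ex m j) * (c * g (Ms i))"
        using member_le_sum[OF m, of "\<lambda>m. \<bar>?c m\<bar> * mval ?k y (?ex m)"] y0 l
        by (intro mult_left_mono) auto
      finally show ?thesis .
    qed
    ultimately show ?case using u by auto
  qed
  show ?thesis
  proof (cases "?K = {}")
    case True
    then have "\<forall>\<^sub>F i in F. g (Ms i) = 0"
      using val' g0 by (auto elim!: eventually_mono intro: antisym)
    then have "cls F (\<lambda>i. g (Ms i)) = cls F (\<lambda>_. 0)" using g0 by (intro eventually_eq_cls) auto
    then show ?thesis by (simp add: growth_zero)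
  next
    case False
    let ?W = "\<lambda>m. cls F (\<lambda>i. mval ?k (x i) (?ex m))"
    have Wc: "?W m \<in> carrier (growth_semiring F)" for m using W0 by (intro growth_carrier)
    (* A monomial of the largest order of magnitude. *)
    have "\<exists>\<mu>\<in>?K. \<forall>m\<in>?K. S.dominated (?W m) (?W \<mu>)"
    proof -
      have "\<exists>\<mu>\<in>A. \<forall>m\<in>A. S.dominated (?W m) (?W \<mu>)" if "finite A" "A \<noteq> {}" for A
        using that
      proof (induction rule: finite_ne_induct)
        case (singleton m)
        then show ?case using S.dominated_refl[OF Wc] by blast
      next
        case (insert m A)
        then obtain \<mu> where \<mu>: "\<mu> \<in> A" "\<forall>m\<in>A. S.dominated (?W m) (?W \<mu>)" by blast
        show ?case
        proof (cases "S.dominated (?W m) (?W \<mu>)")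
          case True
          then show ?thesis using \<mu> by blast
        next
          case False
          then have "S.dominated (?W \<mu>) (?W m)" using S.dominated_linear Wc by blast
          then have "\<forall>m'\<in>insert m A. S.dominated (?W m') (?W m)"
            using \<mu>(2) S.dominated_trans Wc S.dominated_refl by blast
          then show ?thesis by blast
        qed
      qed
      then show ?thesis using False by simp
    qed
    then obtain \<mu> where \<mu>: "\<mu> \<in> ?K" "\<forall>m\<in>?K. S.dominated (?W m) (?W \<mu>)" by blast
    have "\<forall>m\<in>?K. \<exists>N. \<forall>\<^sub>F i in F. mval ?k (x i) (?ex m) \<le> N * mval ?k (x i) (?ex \<mu>)"
    proof
      fix m assume "m \<in> ?K"
      then show "\<exists>N. \<forall>\<^sub>F i in F. mval ?k (x i) (?ex m) \<le> N * mval ?k (x i) (?ex \<mu>)"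
        using \<mu>(2) dominated_cls[of "\<lambda>i. mval ?k (x i) (?ex m)" "\<lambda>i. mval ?k (x i) (?ex \<mu>)"] W0 by simp
    qed
    from bchoice[OF this] obtain N
      where N: "\<forall>m\<in>?K. \<forall>\<^sub>F i in F. mval ?k (x i) (?ex m) \<le> N m * mval ?k (x i) (?ex \<mu>)" ..
    have N': "\<forall>\<^sub>F i in F. \<forall>m\<in>?K. mval ?k (x i) (?ex m) \<le> N m * mval ?k (x i) (?ex \<mu>)"
      using N by (intro eventually_ball_finite) auto
    let ?B = "\<Sum>m\<in>?K. \<bar>?c m\<bar> * (2 ^ (\<Sum>j<?k. ?ex m j) * N m)"
    have "\<forall>\<^sub>F i in F. g (Ms i) \<le> ?B * mval ?k (x i) (?ex \<mu>)"
      using val' N'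
    proof eventually_elim
      case (elim i)
      have "g (Ms i) \<le> (\<Sum>m\<in>?K. \<bar>?c m\<bar> * (2 ^ (\<Sum>j<?k. ?ex m j) * mval ?k (x i) (?ex m)))"
        using elim(1) by blast
      also have "\<dots> \<le> (\<Sum>m\<in>?K. \<bar>?c m\<bar> * (2 ^ (\<Sum>j<?k. ?ex m j) * (N m * mval ?k (x i) (?ex \<mu>))))"
        using elim(2) by (intro sum_mono mult_left_mono) auto
      also have "\<dots> = ?B * mval ?k (x i) (?ex \<mu>)" by (simp add: sum_distrib_right mult.assoc)
      finally show ?case .
    qed
    then have 1: "S.dominated (cls F (\<lambda>i. g (Ms i))) (?W \<mu>)"
      using dominated_cls[of "\<lambda>i. g (Ms i)" "\<lambda>i. mval ?k (x i) (?ex \<mu>)"] g0 W0 by blast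
    have c\<mu>: "\<bar>?c \<mu>\<bar> > 0" using \<mu>(1) by (simp add: in_keys_iff)
    let ?D = "2 ^ (\<Sum>j<?k. ?ex \<mu> j) * c / \<bar>?c \<mu>\<bar>"
    have "\<forall>\<^sub>F i in F. mval ?k (x i) (?ex \<mu>) \<le> ?D * g (Ms i)"
      using val'
    proof eventually_elim
      case (elim i)
      then have "\<bar>?c \<mu>\<bar> * mval ?k (x i) (?ex \<mu>) \<le> 2 ^ (\<Sum>j<?k. ?ex \<mu> j) * (c * g (Ms i))" using \<mu>(1) by blast
      then show ?case using c\<mu> by (simp add: field_simps)
    qed
    then have "S.dominated (?W \<mu>) (cls F (\<lambda>i. g (Ms i)))"
      using dominated_cls[of "\<lambda>i. mval ?k (x i) (?ex \<mu>)" "\<lambda>i. g (Ms i)"] g0 W0 by blast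
    then show ?thesis using 1 by blast
  qed
qed

lemma well_ordered_dims:
  assumes pp: "poly_presentation L C R Dt" and nc: "no_cancellation C R Dt"
  shows "well_order_on (dims L U (growth_semiring F) msr)
    (Restr (dim_order (growth_semiring F)) (dims L U (growth_semiring F) msr))"
proof (cases large)
  case True
  (* Some function approximates the sizes in the family defined by the contradictory formula. *)
  obtain g0 where g0: "g0 \<in> R"
  proof -
    have \<phi>: "part_fm L 0 0 (Fals :: ('f, 'r) fm)" by (simp add: part_fm_iff)
    obtain \<P> :: "(('f, 'r, 'c) struct \<times> 'c list) set set" and g \<psi> where \<P>: "finite \<P>" "\<forall>\<pi> \<in> \<P>. g \<pi> \<in> R \<and> frm L 0 (\<psi> \<pi>)"
      "\<forall>b \<in> TU 0. \<exists>\<pi> \<in> \<P>. holds U (\<psi> \<pi>) b"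
      "\<forall>b \<in> TU 0. \<forall>\<pi> \<in> \<P>. holds U (\<psi> \<pi>) b \<longrightarrow> msr (sols U 0 Fals b) = cls F (\<lambda>i. g \<pi> (Ms i))"
      by (rule large_family[OF True \<phi>])
    then obtain \<pi> where "\<pi> \<in> \<P>" using \<P>(3) by auto
    then show thesis using that \<P>(2) by blast
  qed
  have "\<exists>a. admissible Dt (Ms i) a" for i
    using pp g0 factors[of i] unfolding poly_presentation_def by blast
  then obtain a0 where a0: "\<And>i. admissible Dt (Ms i) (a0 i)" by metis
  (* Coordinates are at least one below num Dt; the maximum only fixes the irrelevant ones. *)
  define x where "x = (\<lambda>i j. max 1 (coords Dt (Ms i) (a0 i) j))"
  show ?thesis
  proof (rule well_order_of_monomials)
    show "1 \<le> x i j" for i j by (simp add: x_def)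
    fix X assume "X \<in> Def L U"
    then obtain n m \<phi> b where X: "part_fm L n m \<phi>" "b \<in> TU m" "X = sols U n \<phi> b"
      by (auto simp: Def_iff definable_over_def)
    obtain \<P> :: "(('f, 'r, 'c) struct \<times> 'c list) set set" and g \<psi> where \<P>: "finite \<P>" "\<forall>\<pi> \<in> \<P>. g \<pi> \<in> R \<and> frm L m (\<psi> \<pi>)"
      "\<forall>b \<in> TU m. \<exists>\<pi> \<in> \<P>. holds U (\<psi> \<pi>) b"
      "\<forall>b \<in> TU m. \<forall>\<pi> \<in> \<P>. holds U (\<psi> \<pi>) b \<longrightarrow> msr (sols U n \<phi> b) = cls F (\<lambda>i. g \<pi> (Ms i))"
      by (rule large_family[OF True X(1)])
    obtain \<pi> where "\<pi> \<in> \<P>" "holds U (\<psi> \<pi>) b" using \<P>(3) X(2) by blast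
    then have "g \<pi> \<in> R" "msr X = cls F (\<lambda>i. g \<pi> (Ms i))" using \<P>(2,4) X(2,3) by auto
    then show "msr X = \<zero>\<^bsub>growth_semiring F\<^esub> \<or>
      (\<exists>e. S.dominated (msr X) (cls F (\<lambda>i. mval (num Dt) (x i) e)) \<and>
           S.dominated (cls F (\<lambda>i. mval (num Dt) (x i) e)) (msr X))"
      using polynomial_dimension[OF pp nc True a0 x_def] by simp
  qed
next
  case False
  then have U: "finite (dom U)" by (rule finite_U)
  show ?thesis
  proof (rule well_order_of_monomials[where k = 0])
    show "1 \<le> (1::real)" by simp
    fix X assume "X \<in> Def L U"
    then obtain n where n: "U.D n X" by (auto simp: Def_iff)
    have "finite X" using finite_subset[OF definable_over_dp(1)[OF n] finite_tuples[OF U]] .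
    then have X: "msr X = cls F (\<lambda>i. real (card X))"
      using msr_finite[OF n] by (simp add: growth_one growth_nat_mult)
    show "msr X = \<zero>\<^bsub>growth_semiring F\<^esub> \<or>
      (\<exists>e. S.dominated (msr X) (cls F (\<lambda>i. mval 0 (\<lambda>j. 1) e)) \<and>
           S.dominated (cls F (\<lambda>i. mval 0 (\<lambda>j. 1) e)) (msr X))"
    proof (cases "card X = 0")
      case True
      then show ?thesis using X by (simp add: growth_zero)
    next
      case False
      have "\<exists>C. \<forall>\<^sub>F i in F. real (card X) \<le> C * 1" by (rule exI[of _ "real (card X)"]) simp
      moreover have "\<exists>C. \<forall>\<^sub>F i in F. 1 \<le> C * real (card X)" using False by (intro exI[of _ 1]) simp
      ultimately have "S.dominated (msr X) (cls F (\<lambda>_. 1))" "S.dominated (cls F (\<lambda>_. 1)) (msr X)"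
        unfolding X by (simp_all add: dominated_cls)
      then show ?thesis by (auto simp: mval_def)
    qed
  qed
qed

end

section \<open>Generalised measurable theories\<close>

text \<open>The measure on the saturated model takes no new values, so its dimensions stay well-ordered.\<close>

lemma supersimple_of_wo:
  fixes L :: "('f, 'r) lang" and M :: "('f, 'r, 'm) struct"
  assumes M: "is_structure L M" and wo: "generalised_measurable_wo TYPE('s) L M"
  shows "supersimple TYPE('n) L (Th L M)"
  unfolding supersimple_def
proof (intro allI impI, elim conjE)
  fix U :: "('f, 'r, 'n) struct" and \<kappa> :: "'n rel" and B n a
  assume U: "is_model L U (Th L M)" and \<kappa>: "card_order_on (Field \<kappa>) \<kappa>"
    and fms: "(card_of {p :: ('f, 'r) fm. wf_fm L p}, \<kappa>) \<in> ordLess" and sat: "saturated L \<kappa> U"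
    and B: "B \<subseteq> dom U" "(card_of B, \<kappa>) \<in> ordLess" and a: "a \<in> tuples (dom U) n"
  obtain S :: "'s ordered_ring" and h where S: "measuring_semiring S" and h: "is_measure L M S h"
    and w: "well_order_on (dims L M S h) (Restr (dim_order S) (dims L M S h))"
    using wo by (auto simp: generalised_measurable_wo_def)
  note U' = model_of_Th_elementarily_equivalent[OF M U]
  obtain h' where h': "is_measure L U S h'" "h' ` Def L U \<subseteq> h ` Def L M"
    using measure_transfer[OF M U' S h] .
  interpret S: measuring_semiring S by fact
  interpret measured_structure S L U h' by unfold_locales (use U' h' in auto)
  have eq: "dims L M S h = dim S ` (h ` Def L M)" "dims L U S h' = dim S ` (h' ` Def L U)"
    by (auto simp: dims_def)
  have "well_order_on (dims L U S h') (Restr (dim_order S) (dims L U S h'))"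
    unfolding well_order_on_def
  proof
    show "linear_order_on (dims L U S h') (Restr (dim_order S) (dims L U S h'))"
      unfolding eq using measure_closed by (intro S.linear_dim_order) (auto simp: Def_iff)
    have "wf (Restr (dim_order S) (dims L M S h) - Id)" using w by (simp add: well_order_on_def)
    then show "wf (Restr (dim_order S) (dims L U S h') - Id)"
      by (rule wf_subset) (use h'(2) in \<open>auto simp: eq\<close>)
  qed
  moreover have "infinite (Field \<kappa>)"
  proof
    assume fin: "finite (Field \<kappa>)"
    have "infinite {p :: ('f, 'r) fm. wf_fm L p}"
    proof -
      have "inj (\<lambda>i. Eq (Var i) (Var i) :: ('f, 'r) fm)" by (simp add: inj_def)
      then have "infinite (range (\<lambda>i. Eq (Var i) (Var i) :: ('f, 'r) fm))" by (rule range_inj_infinite)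
      moreover have "range (\<lambda>i. Eq (Var i) (Var i) :: ('f, 'r) fm) \<subseteq> {p. wf_fm L p}" by auto
      ultimately show ?thesis using infinite_super by blast
    qed
    then have "(\<kappa>, card_of {p :: ('f, 'r) fm. wf_fm L p}) \<in> ordLess"
      by (intro finite_ordLess_infinite[OF _ card_of_Well_order])
        (use fin \<kappa> in \<open>auto simp: card_order_on_well_order_on Field_card_of\<close>)
    then show False using fms not_ordLess_ordLeq ordLess_imp_ordLeq by blast
  qed
  ultimately show "\<exists>B\<^sub>0 \<subseteq> B. finite B\<^sub>0 \<and> \<not> forks L U B\<^sub>0 B a"
    using not_forks_over_finite[OF _ \<kappa> _ sat B a] by blast
qed

theorem theorem6:
  fixes L :: "('f, 'r) lang" and M :: "('f, 'r, 'm) struct"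
  assumes "is_structure L M"
  shows
    "(\<forall>N :: ('f, 'r, 'n) struct.
        is_structure L N \<and> elementarily_equivalent L M N \<and> generalised_measurable TYPE('s) L M
        \<longrightarrow> generalised_measurable TYPE('s) L N)
   \<and> (generalised_measurable TYPE('s) L M
        \<longrightarrow> \<not> strict_order_property TYPE('n) L (Th L M) \<and>
            functionally_unimodular TYPE('n) L (Th L M))
   \<and> (ring_measurable TYPE('s) L M
        \<longrightarrow> (\<forall>X f. definable_map L M X X f \<longrightarrow> (inj_on f X \<longleftrightarrow> f ` X = X)))
   \<and> (generalised_measurable_wo TYPE('s) L M \<longrightarrow> supersimple TYPE('n) L (Th L M))
   \<and> (\<forall>(C :: ('f, 'r, 'c) struct set) R (Ms :: 'i \<Rightarrow> ('f, 'r, 'c) struct) F.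
        polynomial_mac L C R \<and> range Ms \<subseteq> C \<and> is_ultrafilter F
        \<longrightarrow> generalised_measurable TYPE(('i \<Rightarrow> real) set) L (ultraproduct Ms F) \<and>
            ((\<exists>D. poly_presentation L C R D \<and> no_cancellation C R D)
             \<longrightarrow> generalised_measurable_wo TYPE(('i \<Rightarrow> real) set) L (ultraproduct Ms F) \<and>
                 supersimple TYPE('n) L (Th L (ultraproduct Ms F))))"
proof (intro conjI allI impI)
  have transfer: "\<exists>(S :: 's ordered_ring) h. measured_structure S L N h"
    if N: "is_structure L N" "elementarily_equivalent L M N" and gm: "generalised_measurable TYPE('s) L M"
    for N :: "('f, 'r, 'n) struct"
  proof -
    obtain S :: "'s ordered_ring" and h where S: "measuring_semiring S" "is_measure L M S h"
      using gm by (auto simp: generalised_measurable_def measurable_by_def)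
    obtain h' where "is_measure L N S h'" using measure_transfer[OF assms N S] by blast
    then show ?thesis
      using S N by (auto simp: measured_structure_def measured_structure_axioms_def)
  qed
  show "generalised_measurable TYPE('s) L N"
    if "is_structure L N \<and> elementarily_equivalent L M N \<and> generalised_measurable TYPE('s) L M"
    for N :: "('f, 'r, 'n) struct"
    using transfer[of N] that
    by (auto simp: generalised_measurable_def measurable_by_def measured_structure_def measured_structure_axioms_def)
  show "\<not> strict_order_property TYPE('n) L (Th L M)" if gm: "generalised_measurable TYPE('s) L M"
  proof
    assume "strict_order_property TYPE('n) L (Th L M)"
    then obtain N :: "('f, 'r, 'n) struct" and P lq K where N: "is_model L N (Th L M)"
      and P: "interpretable_partial_order L N P lq" "K \<subseteq> P" "infinite K"
        "\<forall>u \<in> K. \<forall>v \<in> K. (u, v) \<in> lq \<or> (v, u) \<in> lq"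
      unfolding strict_order_property_def by blast
    obtain S :: "'s ordered_ring" and h where "measured_structure S L N h"
      using transfer[OF model_of_Th_elementarily_equivalent[OF assms N] gm] by blast
    then show False using measured_structure.no_infinite_chain P by blast
  qed
  show "functionally_unimodular TYPE('n) L (Th L M)" if gm: "generalised_measurable TYPE('s) L M"
    unfolding functionally_unimodular_def
  proof (intro allI impI)
    fix N :: "('f, 'r, 'n) struct" assume N: "is_model L N (Th L M)"
    obtain S :: "'s ordered_ring" and h where "measured_structure S L N h"
      using transfer[OF model_of_Th_elementarily_equivalent[OF assms N] gm] by blast
    then show "functionally_unimodular_structure L N" by (rule measured_structure.functionally_unimodular)
  qed
  show "inj_on f X \<longleftrightarrow> f ` X = X" if rm: "ring_measurable TYPE('s) L M" and f: "definable_map L M X X f" for X f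
  proof -
    obtain R :: "'s ordered_ring" and h where R: "ordered_comm_ring R" "measuring_semiring (nonneg_part R)"
      "is_measure L M (nonneg_part R) h"
      using rm by (auto simp: ring_measurable_def measurable_by_def)
    interpret S: measuring_semiring "nonneg_part R" by fact
    interpret measured_structure "nonneg_part R" L M h by unfold_locales (use assms R in auto)
    show ?thesis using injective_iff_surjective[OF ordered_comm_ring_cancel[OF R(1,2)] f] .
  qed
  show "supersimple TYPE('n) L (Th L M)" if "generalised_measurable_wo TYPE('s) L M"
    using supersimple_of_wo[OF assms that] .
  fix C :: "('f, 'r, 'c) struct set" and R :: "(('f, 'r, 'c) struct \<Rightarrow> real) set"
    and Ms :: "'i \<Rightarrow> ('f, 'r, 'c) struct" and F :: "'i filter"
  assume asm: "polynomial_mac L C R \<and> range Ms \<subseteq> C \<and> is_ultrafilter F"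
  then have mac: "is_mac L C R" by (simp add: polynomial_mac_def)
  have C: "Ms i \<in> C" for i using asm by blast
  interpret mac_ultra L Ms F C R
    by unfold_locales (use asm mac C in \<open>auto simp: is_mac_def\<close>)
  show "generalised_measurable TYPE(('i \<Rightarrow> real) set) L (ultraproduct Ms F)"
    using is_measure_msr S.measuring_semiring_axioms
    by (auto simp: generalised_measurable_def measurable_by_def)
  assume "\<exists>D. poly_presentation L C R D \<and> no_cancellation C R D"
  then obtain D where "poly_presentation L C R D" "no_cancellation C R D" by blast
  from well_ordered_dims[OF this]
  show wo: "generalised_measurable_wo TYPE(('i \<Rightarrow> real) set) L (ultraproduct Ms F)"
    using is_measure_msr S.measuring_semiring_axioms unfolding generalised_measurable_wo_def by blast
  show "supersimple TYPE('n) L (Th L (ultraproduct Ms F))"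
    using supersimple_of_wo[OF is_structure_U wo] .
qed

end
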